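(* Let $w\in\mathfrak{S}_n$ and let $Y_w$ be the closure of a generic $T$-orbit in $X_w$. Then $Y_w$ is smooth at the $T$-fixed point $wB$ if and only if the graph $\Gamma_w$ is a forest.
   Context: $G=\mathrm{GL}_n(\mathbb{C})$, $B$ the upper triangular Borel subgroup, $T$ the diagonal torus acting on $G/B$ by left multiplication; permutations (one-line notation) are identified with permutation matrices with $i$-th column $e_{w(i)}$; $\le$ is Bruhat order, $\ell$ length, $t_{a,b}$ the transposition of $a,b$. $X_w=\overline{BwB/B}$; a $T$-orbit in $X_w$ is generic if its closure contains all $T$-fixed points $uB$ ($u\le w$) of $X_w$; $Y_w$ is the closure of a generic $T$-orbit. $E(w)=\{(w(i),w(j)) : 1\le i<j\le n,\ \ell(w)-\ell(t_{w(i),w(j)}w)=1\}$ (equivalently $w(i)>w(j)$ and $w(k)\notin[w(j),w(i)]$ for $i<k<j$); $\Gamma_w$ is the graph whose vertices are the integers appearing in pairs of $E(w)$ and whose edges are the elements of $E(w)$; forest refers to the underlying undirected graph. *)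

theory Defs
  imports
    "HOL-Analysis.Abstract_Topology"
    "HOL-Algebra.Coset"
    "HOL-Library.Extended_Nat"
    "HOL-Library.Function_Algebras"
    "HOL-Combinatorics.Permutations"
    "HOL-Combinatorics.Transposition"
    "Jordan_Normal_Form.Determinant"
    "Graph_Theory.Digraph_Component"
begin

section \<open>The flag variety as a topological space\<close>

definition GL :: "nat \<Rightarrow> complex mat monoid" where
  "GL n = units_of (ring_mat TYPE(complex) n ())"

definition borel :: "nat \<Rightarrow> complex mat set" where
  "borel n = {A \<in> carrier (GL n). upper_triangular A}"

definition torus :: "nat \<Rightarrow> complex mat set" where
  "torus n = {A \<in> carrier (GL n). diagonal_mat A}"

abbreviation flag :: "nat \<Rightarrow> complex mat \<Rightarrow> complex mat set" where
  "flag n g \<equiv> g <#\<^bsub>GL n\<^esub> borel n"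

definition flag_variety :: "nat \<Rightarrow> complex mat set set" where
  "flag_variety n = flag n ` carrier (GL n)"

text \<open>Polynomials in the \<open>n\<^sup>2\<close> matrix entries, as functions. As \<open>\<complex>\<close> is infinite, nothing is lost by
  identifying a polynomial with its polynomial function.\<close>

inductive_set poly_funs :: "nat \<Rightarrow> (complex mat \<Rightarrow> complex) set" for n where
  const: "(\<lambda>_. c) \<in> poly_funs n"
| entry: "i < n \<Longrightarrow> j < n \<Longrightarrow> (\<lambda>A. A $$ (i, j)) \<in> poly_funs n"
| add: "f \<in> poly_funs n \<Longrightarrow> g \<in> poly_funs n \<Longrightarrow> (\<lambda>A. f A + g A) \<in> poly_funs n"
| mult: "f \<in> poly_funs n \<Longrightarrow> g \<in> poly_funs n \<Longrightarrow> (\<lambda>A. f A * g A) \<in> poly_funs n"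

definition zariski_GL :: "nat \<Rightarrow> complex mat topology" where
  "zariski_GL n =
     topology (\<lambda>U. \<exists>F \<subseteq> poly_funs n. U = {A \<in> carrier (GL n). \<exists>f\<in>F. f A \<noteq> 0})"

text \<open>\<open>G/B\<close> carries the quotient of the Zariski topology.\<close>

definition flag_topology :: "nat \<Rightarrow> complex mat set topology" where
  "flag_topology n =
     topology (\<lambda>U. U \<subseteq> flag_variety n \<and>
                    openin (zariski_GL n) {g \<in> carrier (GL n). flag n g \<in> U})"

abbreviation zariski_closure :: "nat \<Rightarrow> complex mat set set \<Rightarrow> complex mat set set" where
  "zariski_closure n S \<equiv> Abstract_Topology.closure_of (flag_topology n) S"

lemma istopology_zariski_GL:
  "istopology (\<lambda>U. \<exists>F \<subseteq> poly_funs n. U = {A \<in> carrier (GL n). \<exists>f\<in>F. f A \<noteq> 0})"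
  (is "istopology ?L")
  unfolding istopology_def
proof (intro conjI allI impI)
  fix S T assume "?L S" "?L T"
  then obtain F F' where F: "F \<subseteq> poly_funs n" "S = {A \<in> carrier (GL n). \<exists>f\<in>F. f A \<noteq> 0}"
    and F': "F' \<subseteq> poly_funs n" "T = {A \<in> carrier (GL n). \<exists>f\<in>F'. f A \<noteq> 0}" by auto
  let ?H = "{(\<lambda>A. f A * g A) | f g. f \<in> F \<and> g \<in> F'}"
  have "?H \<subseteq> poly_funs n" using F F' by (auto intro: poly_funs.mult)
  moreover have "S \<inter> T = {A \<in> carrier (GL n). \<exists>f\<in>?H. f A \<noteq> 0}"
  proof (rule Set.set_eqI, rule iffI)
    fix A assume "A \<in> S \<inter> T"
    then obtain f g where fg: "A \<in> carrier (GL n)" "f \<in> F" "g \<in> F'" "f A * g A \<noteq> 0"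
      unfolding F(2) F'(2) by auto
    from fg(2,3) have "(\<lambda>A. f A * g A) \<in> ?H" by (intro CollectI exI conjI) (rule refl)
    with fg(4) have "\<exists>h\<in>?H. h A \<noteq> 0" by (rule bexI)
    with fg(1) show "A \<in> {A \<in> carrier (GL n). \<exists>f\<in>?H. f A \<noteq> 0}" by (intro CollectI conjI)
  next
    fix A assume "A \<in> {A \<in> carrier (GL n). \<exists>f\<in>?H. f A \<noteq> 0}"
    then show "A \<in> S \<inter> T" unfolding F(2) F'(2) by auto
  qed
  ultimately show "?L (S \<inter> T)" by blast
next
  fix \<K> assume "\<forall>K\<in>\<K>. ?L K"
  then have "\<forall>K\<in>\<K>. \<exists>F. F \<subseteq> poly_funs n \<and> K = {A \<in> carrier (GL n). \<exists>f\<in>F. f A \<noteq> 0}"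
    by simp
  from bchoice[OF this] obtain F
    where F: "\<forall>K\<in>\<K>. F K \<subseteq> poly_funs n \<and> K = {A \<in> carrier (GL n). \<exists>f\<in>F K. f A \<noteq> 0}"
    by (elim exE)
  have F1: "F K \<subseteq> poly_funs n" if "K \<in> \<K>" for K
    using bspec[OF F that] by (rule conjunct1)
  have F2: "A \<in> K \<longleftrightarrow> A \<in> carrier (GL n) \<and> (\<exists>f\<in>F K. f A \<noteq> 0)" if "K \<in> \<K>" for K A
    using arg_cong[OF conjunct2[OF bspec[OF F that]], of "\<lambda>S. A \<in> S"] by (simp only: mem_Collect_eq)
  have "\<Union>\<K> = {A \<in> carrier (GL n). \<exists>f\<in>\<Union>(F ` \<K>). f A \<noteq> 0}"
  proof (rule Set.set_eqI, rule iffI)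
    fix A assume "A \<in> \<Union>\<K>"
    then obtain K where K: "K \<in> \<K>" "A \<in> K" by blast
    with F2[OF K(1)] show "A \<in> {A \<in> carrier (GL n). \<exists>f\<in>\<Union>(F ` \<K>). f A \<noteq> 0}" by blast
  next
    fix A assume "A \<in> {A \<in> carrier (GL n). \<exists>f\<in>\<Union>(F ` \<K>). f A \<noteq> 0}"
    then obtain K f where K: "K \<in> \<K>" "f \<in> F K" "f A \<noteq> 0" "A \<in> carrier (GL n)" by auto
    with F2[OF K(1)] show "A \<in> \<Union>\<K>" by blast
  qed
  moreover have "\<Union>(F ` \<K>) \<subseteq> poly_funs n" using F1 by blast
  ultimately show "?L (\<Union>\<K>)" by blast
qed

lemma openin_zariski_GL:
  "openin (zariski_GL n) U \<longleftrightarrow>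
     (\<exists>F \<subseteq> poly_funs n. U = {A \<in> carrier (GL n). \<exists>f\<in>F. f A \<noteq> 0})"
  unfolding zariski_GL_def by (subst topology_inverse'[OF istopology_zariski_GL]) (rule refl)

lemma openin_flag_topology:
  "openin (flag_topology n) U \<longleftrightarrow>
     U \<subseteq> flag_variety n \<and> openin (zariski_GL n) {g \<in> carrier (GL n). flag n g \<in> U}"
proof -
  have "istopology (\<lambda>U. U \<subseteq> flag_variety n \<and>
          openin (zariski_GL n) {g \<in> carrier (GL n). flag n g \<in> U})"
    unfolding istopology_def
  proof (intro conjI allI impI)
    fix S T
    assume S: "S \<subseteq> flag_variety n \<and> openin (zariski_GL n) {g \<in> carrier (GL n). flag n g \<in> S}"
      and T: "T \<subseteq> flag_variety n \<and> openin (zariski_GL n) {g \<in> carrier (GL n). flag n g \<in> T}"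
    show "S \<inter> T \<subseteq> flag_variety n" using S by blast
    have "{g \<in> carrier (GL n). flag n g \<in> S \<inter> T}
        = {g \<in> carrier (GL n). flag n g \<in> S} \<inter> {g \<in> carrier (GL n). flag n g \<in> T}" by blast
    then show "openin (zariski_GL n) {g \<in> carrier (GL n). flag n g \<in> S \<inter> T}"
      using S T by (simp add: openin_Int)
  next
    fix \<K>
    assume K: "\<forall>K\<in>\<K>. K \<subseteq> flag_variety n \<and> openin (zariski_GL n) {g \<in> carrier (GL n). flag n g \<in> K}"
    show "\<Union>\<K> \<subseteq> flag_variety n" using K by blast
    have "{g \<in> carrier (GL n). flag n g \<in> \<Union>\<K>}
        = (\<Union>K\<in>\<K>. {g \<in> carrier (GL n). flag n g \<in> K})" by blast
    moreover have "openin (zariski_GL n) (\<Union>K\<in>\<K>. {g \<in> carrier (GL n). flag n g \<in> K})"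
    proof (rule openin_Union)
      fix V assume "V \<in> (\<lambda>K. {g \<in> carrier (GL n). flag n g \<in> K}) ` \<K>"
      then obtain K where "K \<in> \<K>" "V = {g \<in> carrier (GL n). flag n g \<in> K}" by (rule imageE)
      with K show "openin (zariski_GL n) V" by simp
    qed
    ultimately show "openin (zariski_GL n) {g \<in> carrier (GL n). flag n g \<in> \<Union>\<K>}"
      by (simp only:)
  qed
  then show ?thesis unfolding flag_topology_def by simp
qed


section \<open>Smoothness of a closed subset at a point\<close>

definition regular_at :: "nat \<Rightarrow> (complex mat \<Rightarrow> complex) \<Rightarrow> complex mat \<Rightarrow> bool" where
  "regular_at n \<phi> g \<longleftrightarrow>
     (\<exists>a \<in> poly_funs n. \<exists>b \<in> poly_funs n. b g \<noteq> 0 \<and>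
        (\<forall>x \<in> carrier (GL n). b x \<noteq> 0 \<longrightarrow> \<phi> x = a x / b x))"

text \<open>Functions on \<open>G/B\<close> that are regular near \<open>p\<close>: the structure sheaf of \<open>G/B\<close> consists of the
  functions whose pullback to \<open>G\<close> is regular. The stalk at \<open>p\<close> is represented by total functions
  instead of germs; values away from \<open>p\<close> are irrelevant.\<close>

definition local_functions ::
    "nat \<Rightarrow> complex mat set \<Rightarrow> (complex mat set \<Rightarrow> complex) set" where
  "local_functions n p =
     {f. \<exists>U. openin (flag_topology n) U \<and> p \<in> U \<and>
            (\<forall>g \<in> carrier (GL n). flag n g \<in> U \<longrightarrow> regular_at n (\<lambda>x. f (flag n x)) g)}"

text \<open>The Zariski tangent space at \<open>p\<close> of the closed subset \<open>Y\<close> (with its reduced structure), as the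
  space of point derivations of the local ring \<open>\<O>\<^bsub>G/B,p\<^esub>\<close> modulo the functions vanishing on \<open>Y\<close>
  near \<open>p\<close>. Derivations are set to 0 outside \<^const>\<open>local_functions\<close>, so that distinct members
  are distinct as derivations.\<close>

definition tangent_space ::
    "nat \<Rightarrow> complex mat set set \<Rightarrow> complex mat set \<Rightarrow>
     ((complex mat set \<Rightarrow> complex) \<Rightarrow> complex) set" where
  "tangent_space n Y p =
     {D. (\<forall>f. f \<notin> local_functions n p \<longrightarrow> D f = 0) \<and>
         (\<forall>f \<in> local_functions n p. \<forall>g \<in> local_functions n p.
            D (\<lambda>q. f q + g q) = D f + D g \<and>
            D (\<lambda>q. f q * g q) = f p * D g + g p * D f) \<and>
         (\<forall>c. \<forall>f \<in> local_functions n p. D (\<lambda>q. c * f q) = c * D f) \<and>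
         (\<forall>f \<in> local_functions n p.
            (\<exists>U. openin (flag_topology n) U \<and> p \<in> U \<and> (\<forall>q \<in> U \<inter> Y. f q = 0)) \<longrightarrow> D f = 0)}"

definition tangent_dim :: "nat \<Rightarrow> complex mat set set \<Rightarrow> complex mat set \<Rightarrow> nat" where
  "tangent_dim n Y p = vector_space.dim (\<lambda>c D f. c * D f) (tangent_space n Y p)"

lemma vector_space_fun_scale: "vector_space (\<lambda>c (D :: 'b \<Rightarrow> complex) f. c * D f)"
  by unfold_locales (auto simp: fun_eq_iff algebra_simps)

definition irreducible_in :: "'a topology \<Rightarrow> 'a set \<Rightarrow> bool" where
  "irreducible_in X S \<longleftrightarrow> S \<subseteq> topspace X \<and> S \<noteq> {} \<and>
     (\<forall>C D. closedin X C \<and> closedin X D \<and> S \<subseteq> C \<union> D \<longrightarrow> S \<subseteq> C \<or> S \<subseteq> D)"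

text \<open>For a closed subset \<open>Y\<close> of a variety with Zariski topology \<open>X\<close>, this is the Krull dimension of
  the local ring \<open>\<O>\<^bsub>Y,p\<^esub>\<close>: the primes of that ring are the irreducible closed subsets of \<open>Y\<close>
  through \<open>p\<close>, ordered by reverse inclusion.\<close>

definition local_dim :: "'a topology \<Rightarrow> 'a set \<Rightarrow> 'a \<Rightarrow> enat" where
  "local_dim X Y p =
     (SUP m \<in> {m. \<exists>Z :: nat \<Rightarrow> 'a set.
                    (\<forall>i\<le>m. closedin X (Z i) \<and> irreducible_in X (Z i) \<and> p \<in> Z i \<and> Z i \<subseteq> Y) \<and>
                    (\<forall>i<m. Z i \<subset> Z (Suc i))}. enat m)"

definition smooth_at :: "nat \<Rightarrow> complex mat set set \<Rightarrow> complex mat set \<Rightarrow> bool" where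
  "smooth_at n Y p \<longleftrightarrow> enat (tangent_dim n Y p) = local_dim (flag_topology n) Y p"


section \<open>Schubert varieties and torus orbits\<close>

text \<open>Permutations act on \<open>{1..n}\<close>, matrix indices start at 0.\<close>

definition perm_mat :: "nat \<Rightarrow> (nat \<Rightarrow> nat) \<Rightarrow> complex mat" where
  "perm_mat n w = mat n n (\<lambda>(r, c). if Suc r = w (Suc c) then 1 else 0)"

definition schubert_variety :: "nat \<Rightarrow> (nat \<Rightarrow> nat) \<Rightarrow> complex mat set set" where
  "schubert_variety n w =
     zariski_closure n {b <#\<^bsub>GL n\<^esub> flag n (perm_mat n w) | b. b \<in> borel n}"

definition torus_orbit :: "nat \<Rightarrow> complex mat set \<Rightarrow> complex mat set set" where
  "torus_orbit n p = {t <#\<^bsub>GL n\<^esub> p | t. t \<in> torus n}"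

definition torus_fixed :: "nat \<Rightarrow> complex mat set \<Rightarrow> bool" where
  "torus_fixed n p \<longleftrightarrow> (\<forall>t \<in> torus n. t <#\<^bsub>GL n\<^esub> p = p)"

definition generic_orbit :: "nat \<Rightarrow> (nat \<Rightarrow> nat) \<Rightarrow> complex mat set set \<Rightarrow> bool" where
  "generic_orbit n w Q \<longleftrightarrow>
     (\<exists>p \<in> schubert_variety n w. Q = torus_orbit n p) \<and>
     {p \<in> schubert_variety n w. torus_fixed n p} \<subseteq> zariski_closure n Q"


section \<open>The graph of a permutation\<close>

definition perm_length :: "nat \<Rightarrow> (nat \<Rightarrow> nat) \<Rightarrow> nat" where
  "perm_length n w = card {(i, j). 1 \<le> i \<and> i < j \<and> j \<le> n \<and> w j < w i}"

definition cover_pairs :: "nat \<Rightarrow> (nat \<Rightarrow> nat) \<Rightarrow> (nat \<times> nat) set" where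
  "cover_pairs n w =
     {(w i, w j) | i j. 1 \<le> i \<and> i < j \<and> j \<le> n \<and>
        int (perm_length n w) - int (perm_length n (transpose (w i) (w j) \<circ> w)) = 1}"

definition cover_graph :: "nat \<Rightarrow> (nat \<Rightarrow> nat) \<Rightarrow> nat pair_pre_digraph" where
  "cover_graph n w =
     \<lparr>pverts = fst ` cover_pairs n w \<union> snd ` cover_pairs n w, parcs = cover_pairs n w\<rparr>"

text \<open>\<^const>\<open>Digraph_Component.forest\<close> concerns directed cycles, and in a symmetric digraph every
  edge forms a cycle of length 2; so the cycles of the underlying simple undirected graph are those
  of length at least 3 in the symmetrization. The digraphs considered here have neither loops nor
  antiparallel arcs.\<close>

definition underlying_forest :: "'a pair_pre_digraph \<Rightarrow> bool" where
  "underlying_forest H \<longleftrightarrow>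
     \<not> (\<exists>p. 3 \<le> length p \<and>
            pre_digraph.cycle (with_proj (mk_symmetric (with_proj H))) p)"

end

theory Submission
  imports Defs
begin

text \<open>
  Write \<open>w\<close> times a lower unitriangular matrix for the points of the affine chart around \<open>wB\<close>. The
  torus scales the coordinate at positions \<open>i < j\<close> by \<open>t\<^bsub>w(j)\<^esub> / t\<^bsub>w(i)\<^esub>\<close>, and on a point of a
  generic orbit exactly the coordinates at inversions are nonzero: the other ones vanish on the whole
  Schubert cell, and the ones at inversions are Pluecker coordinates that do not vanish at
  \<open>t\<^bsub>w(i),w(j)\<^esub>w \<le> w\<close>. So near \<open>wB\<close> the closure of the orbit is the affine toric variety of the semigroup
  generated by the roots of the inversions. An inversion that is not a cover is a product of two
  smaller ones, while each cover spans an extremal ray, so the tangent space has the covers as a basis.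

  The local dimension is at most \<open>|F|\<close> whenever the covers are integer combinations of \<open>F\<close>: a chain of
  irreducible closed sets yields algebraically independent functions, and a count of Laurent monomials
  bounds their number. If an edge lies on a cycle it can be left out of \<open>F\<close>, so the dimension drops
  below that of the tangent space. In a forest all edge values are realised by potentials; the
  degenerations along the resulting one-parameter subgroups form a chain of maximal length.
\<close>

section \<open>The affine chart around a torus fixed point\<close>

text \<open>The tangent space has one dimension per cover whether or not the graph is a forest, so
  smoothness at \<open>wB\<close> only asks whether the local dimension reaches that number. The
  count behind the upper bound: m algebraically independent functions have k^m independent monomials
  with exponents below k, whereas on the torus these lie in the span of Laurent monomials in |F|
  characters with exponents O(k), a space of dimension O(k^|F|); large k forces m \<le> |F|. The
  root of an edge on a cycle is a signed sum of the roots of the other edges of the cycle, so its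
  character is a monomial in theirs with exponents 1 and -1; this is why Laurent monomials are
  counted. Limits of torus points are needed in the Zariski topology. Polynomial curves provide
  them, since an open condition that holds at one point of such a curve fails at finitely many
  parameters only. The graph arguments are carried out on positions i < j, counted from 0, and are
  moved to the values w(i), w(j) at the very end.\<close>

lemma carrier_GL: "A \<in> carrier (GL n) \<longleftrightarrow> A \<in> carrier_mat n n \<and> det A \<noteq> 0"
proof
  assume "A \<in> carrier (GL n)"
  then have "A \<in> Units (ring_mat TYPE(complex) n ())" by (simp add: GL_def units_of_def)
  then show "A \<in> carrier_mat n n \<and> det A \<noteq> 0"
    using unit_imp_det_non_zero[of A n "()"] by (auto simp: Units_def ring_mat_def)
next
  assume "A \<in> carrier_mat n n \<and> det A \<noteq> 0"
  then show "A \<in> carrier (GL n)"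
    using det_non_zero_imp_unit[of A n "()"] by (simp add: GL_def units_of_def)
qed

lemma mult_GL: "(\<otimes>\<^bsub>GL n\<^esub>) = (*)"
  by (simp add: GL_def units_of_def ring_mat_def)

lemma group_GL: "group (GL n)"
proof -
  interpret ring "ring_mat TYPE(complex) n ()" by (rule ring_mat)
  show ?thesis unfolding GL_def by (rule units_group)
qed

lemma GL_D: "A \<in> carrier (GL n) \<Longrightarrow> A \<in> carrier_mat n n"
  by (simp add: carrier_GL)

lemma GL_mult: "A \<in> carrier (GL n) \<Longrightarrow> B \<in> carrier (GL n) \<Longrightarrow> A * B \<in> carrier (GL n)"
  using group.is_monoid[OF group_GL, THEN monoid.m_closed] by (simp add: mult_GL)

lemma mult_entry:
  assumes "A \<in> carrier_mat n n" "B \<in> carrier_mat n n" "i < n" "j < n"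
  shows "(A * B) $$ (i, j) = (\<Sum>k<n. A $$ (i, k) * B $$ (k, j))"
  using assms by (auto simp: scalar_prod_def atLeast0LessThan intro!: sum.cong)

lemma borel_iff: "A \<in> borel n \<longleftrightarrow> A \<in> carrier_mat n n \<and> det A \<noteq> 0 \<and> upper_triangular A"
  by (auto simp: borel_def carrier_GL)

lemma borel_GL: "A \<in> borel n \<Longrightarrow> A \<in> carrier (GL n)"
  by (simp add: borel_def)

lemma borel_diag: "A \<in> borel n \<Longrightarrow> i < n \<Longrightarrow> A $$ (i, i) \<noteq> 0"
  by (auto simp: borel_iff upper_triangular_imp_det_eq_0_iff diag_mat_def)

lemma borelI:
  assumes "A \<in> carrier_mat n n" "\<And>i j. j < i \<Longrightarrow> i < n \<Longrightarrow> A $$ (i, j) = 0"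
    "\<And>i. i < n \<Longrightarrow> A $$ (i, i) \<noteq> 0"
  shows "A \<in> borel n"
proof -
  have "upper_triangular A" using assms by auto
  then show ?thesis using assms
    by (auto simp: borel_iff upper_triangular_imp_det_eq_0_iff diag_mat_def)
qed

lemma borel_mult:
  assumes "A \<in> borel n" "B \<in> borel n"
  shows "A * B \<in> borel n"
proof -
  have "upper_triangular (A * B)"
  proof (rule upper_triangularI)
    fix i j assume ij: "j < i" "i < dim_row (A * B)"
    then have "(A * B) $$ (i, j) = (\<Sum>k<n. A $$ (i, k) * B $$ (k, j))"
      using assms by (intro mult_entry) (auto simp: borel_iff)
    also have "\<dots> = 0"
    proof (rule sum.neutral, rule ballI)
      fix k assume "k \<in> {..<n}"
      then show "A $$ (i, k) * B $$ (k, j) = 0"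
        using assms ij by (cases "k < i") (auto simp: borel_iff upper_triangular_def)
    qed
    finally show "(A * B) $$ (i, j) = 0" .
  qed
  then show ?thesis using assms GL_mult[of A n B] by (auto simp: borel_def)
qed

text \<open>Back substitution: below the diagonal, entry (i, j) of A B = 1 reduces to A_ii B_ij = 0,
  because A_ik = 0 for k < i and, working upwards from the last row, B_kj = 0 for k > i.\<close>

lemma borel_right_inverse:
  assumes "A \<in> borel n"
  shows "\<exists>B \<in> borel n. A * B = 1\<^sub>m n"
proof -
  obtain B where B: "B \<in> carrier (GL n)" "A * B = 1\<^sub>m n"
  proof -
    have "A \<in> Units (ring_mat TYPE(complex) n ())"
      using assms det_non_zero_imp_unit[of A n "()"] by (auto simp: borel_iff)
    then obtain B where "B \<in> carrier_mat n n" "A * B = 1\<^sub>m n"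
      by (auto simp: Units_def ring_mat_def)
    moreover from this have "det A * det B = 1"
      using assms det_mult[of A n B] by (auto simp: borel_iff)
    ultimately show thesis using that[of B] by (cases "det B = 0") (auto simp: carrier_GL)
  qed
  have "B $$ (i, j) = 0" if "j < i" "i < n" for i j
    using that
  proof (induction "n - i" arbitrary: i rule: less_induct)
    case less
    have "0 = (A * B) $$ (i, j)" using less.prems B(2) by simp
    also have "\<dots> = (\<Sum>k<n. A $$ (i, k) * B $$ (k, j))"
      using less.prems assms B by (intro mult_entry) (auto simp: borel_iff carrier_GL)
    also have "\<dots> = (\<Sum>k<n. if k = i then A $$ (i, i) * B $$ (i, j) else 0)"
    proof (rule sum.cong[OF refl])
      fix k assume k: "k \<in> {..<n}"
      consider "k < i" | "k = i" | "i < k" by linarith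
      then show "A $$ (i, k) * B $$ (k, j) = (if k = i then A $$ (i, i) * B $$ (i, j) else 0)"
      proof cases
        case 1
        then show ?thesis using assms less.prems by (auto simp: borel_iff upper_triangular_def)
      next
        case 3
        then have "B $$ (k, j) = 0" using less.hyps[of k] less.prems k by auto
        then show ?thesis using 3 by simp
      qed simp
    qed
    also have "\<dots> = A $$ (i, i) * B $$ (i, j)" using less.prems by simp
    finally show ?case using borel_diag[OF assms less.prems(2)] by simp
  qed
  then have "B \<in> borel n" using B by (auto simp: borel_def carrier_GL)
  then show ?thesis using B by blast
qed

lemma flag_eq: "flag n g = {g * b | b. b \<in> borel n}"
  by (auto simp: l_coset_def mult_GL)

lemma one_borel: "1\<^sub>m n \<in> borel n"
  by (auto simp: borel_iff)

lemma flag_mult_borel: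
  assumes "g \<in> carrier (GL n)" "b \<in> borel n"
  shows "flag n (g * b) = flag n g"
proof -
  obtain b' where b': "b' \<in> borel n" "b * b' = 1\<^sub>m n" using borel_right_inverse[OF assms(2)] by blast
  have c: "g \<in> carrier_mat n n" "b \<in> carrier_mat n n" "b' \<in> carrier_mat n n"
    using assms b' by (auto simp: carrier_GL borel_iff)
  show ?thesis
  proof (rule Set.set_eqI, rule iffI)
    fix x assume "x \<in> flag n (g * b)"
    then obtain d where d: "d \<in> borel n" "x = g * b * d" by (auto simp: flag_eq)
    then have "x = g * (b * d)" using c by (simp add: assoc_mult_mat[of _ n n _ n _ n] borel_iff)
    then show "x \<in> flag n g" using borel_mult[OF assms(2) d(1)] by (auto simp: flag_eq)
  next
    fix x assume "x \<in> flag n g"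
    then obtain d where d: "d \<in> borel n" "x = g * d" by (auto simp: flag_eq)
    then have dc: "d \<in> carrier_mat n n" by (simp add: borel_iff)
    have "g * b * (b' * d) = g * (b * (b' * d))"
      using c dc by (intro assoc_mult_mat) auto
    also have "b * (b' * d) = b * b' * d"
      using c dc by (intro assoc_mult_mat[symmetric]) auto
    also have "\<dots> = d" using b' dc by simp
    finally have "x = g * b * (b' * d)" using d by simp
    then show "x \<in> flag n (g * b)" using borel_mult[OF b'(1) d(1)] by (auto simp: flag_eq)
  qed
qed

lemma mem_flag: "g \<in> carrier (GL n) \<Longrightarrow> g \<in> flag n g"
  using one_borel[of n] by (force simp: flag_eq carrier_GL)

lemma flag_eqD:
  assumes "g \<in> carrier (GL n)" "flag n g = flag n g'"
  obtains b where "b \<in> borel n" "g = g' * b"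
  using mem_flag[OF assms(1)] assms(2) by (auto simp: flag_eq)

lemma flag_in_variety: "g \<in> carrier (GL n) \<Longrightarrow> flag n g \<in> flag_variety n"
  by (simp add: flag_variety_def)

lemma coset_flag:
  assumes "t \<in> carrier (GL n)" "g \<in> carrier (GL n)"
  shows "t <#\<^bsub>GL n\<^esub> flag n g = flag n (t * g)"
  using group.lcos_m_assoc[OF group_GL, of "borel n" n t g] assms
  by (auto simp: mult_GL borel_def)

lemma topspace_flag: "topspace (flag_topology n) = flag_variety n"
proof
  show "topspace (flag_topology n) \<subseteq> flag_variety n"
    by (auto simp: topspace_def openin_flag_topology)
  have "openin (zariski_GL n) (carrier (GL n))"
    unfolding openin_zariski_GL
    by (rule exI[of _ "{\<lambda>_. 1}"]) (auto intro: poly_funs.const)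
  moreover have "{g \<in> carrier (GL n). flag n g \<in> flag_variety n} = carrier (GL n)"
    by (auto simp: flag_variety_def)
  ultimately have "openin (flag_topology n) (flag_variety n)"
    by (simp add: openin_flag_topology)
  then show "flag_variety n \<subseteq> topspace (flag_topology n)" by (rule openin_subset)
qed

section \<open>Polynomial functions and linear systems\<close>

lemma poly_funs_sum:
  "finite S \<Longrightarrow> (\<And>s. s \<in> S \<Longrightarrow> f s \<in> poly_funs n) \<Longrightarrow> (\<lambda>A. \<Sum>s\<in>S. f s A) \<in> poly_funs n"
proof (induction S rule: finite_induct)
  case (insert x F)
  then have "(\<lambda>A. f x A + (\<Sum>s\<in>F. f s A)) \<in> poly_funs n" by (intro poly_funs.add) auto
  then show ?case using insert by simp
qed (simp add: poly_funs.const)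

lemma poly_funs_prod:
  "finite S \<Longrightarrow> (\<And>s. s \<in> S \<Longrightarrow> f s \<in> poly_funs n) \<Longrightarrow> (\<lambda>A. \<Prod>s\<in>S. f s A) \<in> poly_funs n"
proof (induction S rule: finite_induct)
  case (insert x F)
  then have "(\<lambda>A. f x A * (\<Prod>s\<in>F. f s A)) \<in> poly_funs n" by (intro poly_funs.mult) auto
  then show ?case using insert by simp
qed (simp add: poly_funs.const)

lemma poly_funs_power: "f \<in> poly_funs n \<Longrightarrow> (\<lambda>A. f A ^ k) \<in> poly_funs n"
  by (induction k) (auto intro: poly_funs.intros)

lemma poly_funs_det:
  assumes "\<And>a b. a < k \<Longrightarrow> b < k \<Longrightarrow> (\<lambda>A. F A a b) \<in> poly_funs n"
  shows "(\<lambda>A. det (Matrix.mat k k (\<lambda>(a, b). F A a b))) \<in> poly_funs n"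
proof -
  have "(\<lambda>A. det (Matrix.mat k k (\<lambda>(a, b). F A a b))) =
    (\<lambda>A. \<Sum>p | p permutes {0..<k}. signof p * (\<Prod>a = 0..<k. F A a (p a)))"
    by (rule ext, subst det_def'[of _ k])
       (auto intro!: sum.cong prod.cong simp: permutes_in_image)
  also have "\<dots> \<in> poly_funs n"
    by (intro poly_funs_sum poly_funs.mult poly_funs.const poly_funs_prod assms)
       (auto simp: finite_permutations permutes_in_image)
  finally show ?thesis .
qed

lemma nonsingular_system_solvable:
  fixes A :: "'a::field mat"
  assumes "A \<in> carrier_mat k k" "det A \<noteq> 0"
  shows "\<exists>y. \<forall>i<k. (\<Sum>l<k. A $$ (i, l) * y l) = u i"
proof -
  obtain B where B: "B \<in> carrier_mat k k" "A * B = 1\<^sub>m k"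
    using det_non_zero_imp_unit[OF assms, of "()"] by (auto simp: Units_def ring_mat_def)
  have "(\<Sum>l<k. A $$ (i, l) * (\<Sum>m<k. B $$ (l, m) * u m)) = u i" if i: "i < k" for i
  proof -
    have "(\<Sum>l<k. A $$ (i, l) * (\<Sum>m<k. B $$ (l, m) * u m)) =
      (\<Sum>m<k. (\<Sum>l<k. A $$ (i, l) * B $$ (l, m)) * u m)"
      by (subst sum_distrib_left, subst sum.swap) (simp add: sum_distrib_right mult.assoc)
    also have "\<dots> = (\<Sum>m<k. (A * B) $$ (i, m) * u m)"
    proof (rule sum.cong[OF refl])
      fix m assume "m \<in> {..<k}"
      then have "(A * B) $$ (i, m) = (\<Sum>l<k. A $$ (i, l) * B $$ (l, m))"
        using assms(1) B(1) i by (auto simp: scalar_prod_def atLeast0LessThan intro!: sum.cong)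
      then show "(\<Sum>l<k. A $$ (i, l) * B $$ (l, m)) * u m = (A * B) $$ (i, m) * u m" by simp
    qed
    also have "\<dots> = (\<Sum>m<k. if m = i then u i else 0)"
      using i by (intro sum.cong) (auto simp: B(2))
    also have "\<dots> = u i" using i by simp
    finally show ?thesis .
  qed
  then show ?thesis by (intro exI[of _ "\<lambda>l. \<Sum>m<k. B $$ (l, m) * u m"]) blast
qed

section \<open>Pluecker minors as coordinates around a torus fixed point\<close>

locale perm_chart =
  fixes n :: nat and v :: "nat \<Rightarrow> nat"
  assumes perm: "v permutes {0..<n}"
begin

definition pos :: "nat \<Rightarrow> nat" where
  "pos = inv_into UNIV v"

lemma pos_v [simp]: "pos (v k) = k"
  unfolding pos_def using permutes_inj[OF perm] by simp

lemma v_pos [simp]: "v (pos r) = r"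
  unfolding pos_def using permutes_surj[OF perm] by (simp add: surj_f_inv_f)

lemma v_less [simp]: "v k < n \<longleftrightarrow> k < n"
  using permutes_in_image[OF perm, of k] by simp

lemma pos_less [simp]: "pos r < n \<longleftrightarrow> r < n"
  using v_less[of "pos r"] by simp

lemma v_eq [simp]: "v a = v b \<longleftrightarrow> a = b"
  using pos_v by metis

text \<open>The permutation matrix of \<open>v\<close> times a lower unitriangular matrix with entry
  \<open>c k j\<close> in row j and column k < j. Both arguments of \<open>c\<close> are positions,
  the smaller one first; equality of points is therefore tested on \<open>chart_mat c\<close> and
  not on \<open>c\<close>.\<close>

definition chart_mat :: "(nat \<Rightarrow> nat \<Rightarrow> complex) \<Rightarrow> complex mat" where
  "chart_mat c = Matrix.mat n n (\<lambda>(r, k).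
     if pos r = k then 1 else if k < pos r then c k (pos r) else 0)"

definition chart_point :: "(nat \<Rightarrow> nat \<Rightarrow> complex) \<Rightarrow> complex mat set" where
  "chart_point c = flag n (chart_mat c)"

text \<open>The Pluecker coordinate with columns 0, ..., i and rows v(0), ..., v(i-1), v(j). On the
  chart it is the affine coordinate (i, j), or 1 when i = j.\<close>

definition minor :: "nat \<Rightarrow> nat \<Rightarrow> complex mat \<Rightarrow> complex" where
  "minor i j g = det (Matrix.mat (Suc i) (Suc i) (\<lambda>(a, b). g $$ (v (if a < i then a else j), b)))"

lemma chart_mat_carrier [simp]: "chart_mat c \<in> carrier_mat n n"
  by (simp add: chart_mat_def)

lemma chart_mat_entry:
  "j < n \<Longrightarrow> k < n \<Longrightarrow> chart_mat c $$ (v j, k) = (if j = k then 1 else if k < j then c k j else 0)"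
  by (simp add: chart_mat_def)

lemma chart_mat_cong:
  "(\<And>i j. i < j \<Longrightarrow> j < n \<Longrightarrow> c i j = d i j) \<Longrightarrow> chart_mat c = chart_mat d"
  unfolding chart_mat_def by (rule cong_mat) auto

lemma v_mat_eqI:
  assumes "A \<in> carrier_mat n n" "B \<in> carrier_mat n n"
    "\<And>j k. j < n \<Longrightarrow> k < n \<Longrightarrow> A $$ (v j, k) = B $$ (v j, k)"
  shows "A = B"
proof (rule eq_matI)
  fix i k assume "i < dim_row B" "k < dim_col B"
  then have "A $$ (v (pos i), k) = B $$ (v (pos i), k)" using assms by (intro assms(3)) auto
  then show "A $$ (i, k) = B $$ (i, k)" by simp
qed (use assms in auto)

text \<open>The columns 0, ..., i of g b are combinations of the columns 0, ..., i of g alone, so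
  the minor gets multiplied by the leading principal minor of b.\<close>

lemma minor_mult_upper:
  assumes "g \<in> carrier_mat n n" "b \<in> borel n" "i \<le> j" "j < n"
  shows "minor i j (g * b) = minor i j g * (\<Prod>a<Suc i. b $$ (a, a))"
proof -
  let ?r = "\<lambda>a. v (if a < i then a else j)"
  let ?G = "Matrix.mat (Suc i) (Suc i) (\<lambda>(a, k). g $$ (?r a, k))"
  let ?B = "Matrix.mat (Suc i) (Suc i) (\<lambda>(a, k). b $$ (a, k))"
  have b: "b \<in> carrier_mat n n" "upper_triangular b" using assms by (auto simp: borel_iff)
  have "Matrix.mat (Suc i) (Suc i) (\<lambda>(a, k). (g * b) $$ (?r a, k)) = ?G * ?B"
  proof (rule eq_matI)
    fix a k assume "a < dim_row (?G * ?B)" "k < dim_col (?G * ?B)"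
    then have ak: "a < Suc i" "k < Suc i" by auto
    have "(g * b) $$ (?r a, k) = (\<Sum>l<n. g $$ (?r a, l) * b $$ (l, k))"
      using assms b ak by (intro mult_entry) auto
    also have "\<dots> = (\<Sum>l<Suc i. g $$ (?r a, l) * b $$ (l, k))"
      using assms b ak by (intro sum.mono_neutral_right) (auto simp: upper_triangular_def)
    also have "\<dots> = (?G * ?B) $$ (a, k)"
      using ak by (auto simp: scalar_prod_def atLeast0LessThan intro!: sum.cong)
    finally show "Matrix.mat (Suc i) (Suc i) (\<lambda>(a, k). (g * b) $$ (?r a, k)) $$ (a, k) =
      (?G * ?B) $$ (a, k)" using ak by simp
  qed auto
  then have "minor i j (g * b) = det ?G * det ?B"
    unfolding minor_def by (simp add: det_mult[of _ "Suc i"])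
  moreover have "det ?B = (\<Prod>a<Suc i. b $$ (a, a))"
  proof -
    have "upper_triangular ?B" using b assms by (intro upper_triangularI) (auto simp: upper_triangular_def)
    then have "det ?B = prod_list (diag_mat ?B)" by (rule det_upper_triangular) auto
    also have "\<dots> = (\<Prod>a<Suc i. ?B $$ (a, a))"
      by (simp only: prod_list_diag_prod atLeast0LessThan dim_row_mat)
    finally show ?thesis by simp
  qed
  ultimately show ?thesis by (simp add: minor_def)
qed

text \<open>With row v(j) in place of row v(i) the submatrix is still lower triangular, and only its
  last diagonal entry can differ from 1.\<close>

lemma minor_chart_mat:
  assumes "i \<le> j" "j < n"
  shows "minor i j (chart_mat c) = (if i = j then 1 else c i j)"
proof -
  let ?M = "Matrix.mat (Suc i) (Suc i) (\<lambda>(a, k). chart_mat c $$ (v (if a < i then a else j), k))"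
  have "det ?M = prod_list (diag_mat ?M)"
    using assms by (intro det_lower_triangular[of "Suc i"]) (auto simp: chart_mat_entry)
  also have "\<dots> = (\<Prod>a<Suc i. ?M $$ (a, a))"
    by (simp only: prod_list_diag_prod atLeast0LessThan dim_row_mat)
  also have "\<dots> = (\<Prod>a<i. 1) * ?M $$ (i, i)"
    unfolding prod.lessThan_Suc using assms
    by (intro arg_cong2[of _ _ _ _ "(*)"] prod.cong) (auto simp: chart_mat_entry)
  finally show ?thesis using assms by (simp add: minor_def chart_mat_entry)
qed

lemma det_row_perm:
  assumes "g \<in> carrier_mat n n"
  shows "det (Matrix.mat n n (\<lambda>(a, b). g $$ (v a, b))) = signof v * det g"
  by (rule det_permute_rows[OF assms perm])

lemma chart_mat_GL [simp]: "chart_mat c \<in> carrier (GL n)"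
proof -
  let ?M = "Matrix.mat n n (\<lambda>(a, b). chart_mat c $$ (v a, b))"
  have "det ?M = prod_list (diag_mat ?M)"
    by (intro det_lower_triangular[of n]) (auto simp: chart_mat_entry)
  also have "\<dots> = (\<Prod>a<n. ?M $$ (a, a))"
    by (simp only: prod_list_diag_prod atLeast0LessThan dim_row_mat)
  also have "\<dots> = 1" by (intro prod.neutral) (auto simp: chart_mat_entry)
  finally show ?thesis using det_row_perm[OF chart_mat_carrier, of c] by (auto simp: carrier_GL)
qed

text \<open>LU decomposition with the rows taken in the order given by \<open>v\<close>: since the
  leading minors do not vanish, earlier columns can clear rows v(0), ..., v(k-1) of column k, and a
  diagonal matrix then normalizes the pivots.\<close>

lemma chart_exists:
  assumes g: "g \<in> carrier (GL n)" and m: "\<And>i. i < n \<Longrightarrow> minor i i g \<noteq> 0"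
  shows "\<exists>c. \<exists>b \<in> borel n. g * b = chart_mat c"
proof -
  have gc: "g \<in> carrier_mat n n" using g by (simp add: carrier_GL)
  have "\<exists>y. \<forall>i<k. (\<Sum>l<k. g $$ (v i, l) * y l) = - g $$ (v i, k)" if "k < n" for k
  proof (cases k)
    case (Suc k')
    let ?A = "Matrix.mat k k (\<lambda>(a, b). g $$ (v a, b))"
    have "?A = Matrix.mat (Suc k') (Suc k') (\<lambda>(a, b). g $$ (v (if a < k' then a else k'), b))"
      unfolding Suc by (rule cong_mat) (auto simp: less_Suc_eq)
    then have "det ?A \<noteq> 0" using m[of k'] that Suc by (auto simp: minor_def)
    from nonsingular_system_solvable[OF mat_carrier this, where u = "\<lambda>i. - g $$ (v i, k)"]
    obtain y where "\<forall>i<k. (\<Sum>l<k. ?A $$ (i, l) * y l) = - g $$ (v i, k)" by auto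
    then show ?thesis by (intro exI[of _ y]) simp
  qed simp
  then obtain y where y: "\<And>k i. k < n \<Longrightarrow> i < k \<Longrightarrow>
      (\<Sum>l<k. g $$ (v i, l) * y k l) = - g $$ (v i, k)" by metis
  define b where "b = Matrix.mat n n (\<lambda>(l, k). if l < k then y k l else if l = k then 1 else 0)"
  have b: "b \<in> borel n" by (rule borelI) (auto simp: b_def)
  define h where "h = g * b"
  have hc: "h \<in> carrier_mat n n" using gc b by (auto simp: h_def borel_iff)
  have h0: "h $$ (v i, k) = 0" if "i < k" "k < n" for i k
  proof -
    have "h $$ (v i, k) = (\<Sum>l<n. g $$ (v i, l) * b $$ (l, k))"
      unfolding h_def using that gc b by (intro mult_entry) (auto simp: borel_iff)
    also have "\<dots> = (\<Sum>l<Suc k. g $$ (v i, l) * b $$ (l, k))"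
      using that by (intro sum.mono_neutral_right) (auto simp: b_def)
    also have "\<dots> = (\<Sum>l<k. g $$ (v i, l) * y k l) + g $$ (v i, k)"
      using that by (simp add: b_def)
    finally show ?thesis using y[OF that(2,1)] by simp
  qed
  have hd: "h $$ (v i, i) \<noteq> 0" if "i < n" for i
  proof -
    let ?M = "Matrix.mat n n (\<lambda>(a, b). h $$ (v a, b))"
    have "h \<in> carrier (GL n)" unfolding h_def by (intro GL_mult borel_GL[OF b] g)
    then have "det ?M \<noteq> 0" using det_row_perm[OF hc] sign_nz[of v] by (auto simp: carrier_GL sign_def)
    moreover have "det ?M = prod_list (diag_mat ?M)"
      by (intro det_lower_triangular[of n]) (auto simp: h0)
    moreover have "\<dots> = (\<Prod>a<n. ?M $$ (a, a))"
      by (simp only: prod_list_diag_prod atLeast0LessThan dim_row_mat)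
    ultimately have "(\<Prod>a<n. ?M $$ (a, a)) \<noteq> 0" by metis
    then show ?thesis using that by (auto simp: prod_zero_iff)
  qed
  define d where "d = mat_diag n (\<lambda>k. inverse (h $$ (v k, k)))"
  have d: "d \<in> borel n" by (rule borelI) (auto simp: d_def mat_diag_def hd)
  have "h * d = chart_mat (\<lambda>i j. h $$ (v j, i) * inverse (h $$ (v i, i)))"
  proof (rule v_mat_eqI)
    fix j k assume "j < n" "k < n"
    then show "(h * d) $$ (v j, k) = chart_mat (\<lambda>i j. h $$ (v j, i) * inverse (h $$ (v i, i))) $$ (v j, k)"
      unfolding d_def mat_diag_mult_right[OF hc] by (auto simp: chart_mat_entry h0 hd)
  qed (use hc d in \<open>auto simp: borel_iff\<close>)
  moreover have "h * d = g * (b * d)" unfolding h_def using gc b d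
    by (intro assoc_mult_mat) (auto simp: borel_iff)
  ultimately show ?thesis using borel_mult[OF b d]
    by (intro exI bexI[of _ "b * d"]) simp_all
qed

text \<open>Right multiplication by a Borel element scales both minors by the same factor, so the
  quotient descends to flags and recovers the coordinates of a point of the chart.\<close>

definition ratio :: "complex mat \<Rightarrow> nat \<Rightarrow> nat \<Rightarrow> complex" where
  "ratio g i j = minor i j g / minor i i g"

lemma minor_borel_nz:
  assumes "g \<in> carrier_mat n n" "b \<in> borel n" "i \<le> j" "j < n"
  shows "minor i j (g * b) = 0 \<longleftrightarrow> minor i j g = 0"
  using minor_mult_upper[OF assms] borel_diag[OF assms(2)] assms by auto

lemma ratio_borel:
  assumes "g \<in> carrier_mat n n" "b \<in> borel n" "i \<le> j" "j < n"
  shows "ratio (g * b) i j = ratio g i j"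
proof -
  have "(\<Prod>a<Suc i. b $$ (a, a)) \<noteq> 0" using borel_diag[OF assms(2)] assms by auto
  then show ?thesis
    unfolding ratio_def using minor_mult_upper[OF assms] minor_mult_upper[OF assms(1,2), of i i] assms
    by (simp del: prod.lessThan_Suc)
qed

lemma ratio_chart_mat: "i < j \<Longrightarrow> j < n \<Longrightarrow> ratio (chart_mat c) i j = c i j"
  by (simp add: ratio_def minor_chart_mat)

lemma chart_ratio:
  assumes g: "g \<in> carrier (GL n)" and m: "\<And>i. i < n \<Longrightarrow> minor i i g \<noteq> 0"
  shows "flag n g = chart_point (ratio g)"
proof -
  obtain c b where cb: "b \<in> borel n" "g * b = chart_mat c" using chart_exists[OF assms] by blast
  have "chart_mat c = chart_mat (ratio g)"
  proof (rule chart_mat_cong)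
    fix i j assume "i < j" "j < n"
    then show "c i j = ratio g i j"
      using ratio_chart_mat[of i j c] ratio_borel[of g b i j] cb GL_D[OF g] by simp
  qed
  then show ?thesis using flag_mult_borel[OF g cb(1)] cb(2) by (simp add: chart_point_def)
qed

lemma flag_eq_chart_point:
  assumes g: "g \<in> carrier (GL n)" and e: "flag n g = chart_point c"
  shows "i < n \<Longrightarrow> minor i i g \<noteq> 0" and "i < j \<Longrightarrow> j < n \<Longrightarrow> ratio g i j = c i j"
proof -
  obtain b where b: "b \<in> borel n" "g = chart_mat c * b"
    using flag_eqD[OF g e[unfolded chart_point_def]] by blast
  show "i < n \<Longrightarrow> minor i i g \<noteq> 0"
    using minor_borel_nz[of "chart_mat c" b i i] b by (simp add: minor_chart_mat)
  show "i < j \<Longrightarrow> j < n \<Longrightarrow> ratio g i j = c i j"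
    using ratio_borel[of "chart_mat c" b i j] b by (simp add: ratio_chart_mat)
qed

lemma chart_point_eq_iff: "chart_point c = chart_point d \<longleftrightarrow> chart_mat c = chart_mat d"
proof
  assume a: "chart_point c = chart_point d"
  show "chart_mat c = chart_mat d"
  proof (rule chart_mat_cong)
    fix i j assume "i < j" "j < n"
    then show "c i j = d i j"
      using flag_eq_chart_point(2)[of "chart_mat c" d i j] a
      by (simp add: chart_point_def ratio_chart_mat)
  qed
qed (simp add: chart_point_def)

definition chart :: "complex mat set set" where
  "chart = range chart_point"

text \<open>A section of G -> G/B over the chart. The choice of \<open>c\<close> affects only
  arguments that \<open>chart_mat\<close> does not read, so the matrix is unique on the chart;
  elsewhere its value is arbitrary.\<close>

definition rep :: "complex mat set \<Rightarrow> complex mat" where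
  "rep q = chart_mat (SOME c. q = chart_point c)"

lemma rep_chart_point [simp]: "rep (chart_point c) = chart_mat c"
proof -
  have "chart_point c = chart_point (SOME d. chart_point c = chart_point d)"
    by (rule someI[of _ c]) simp
  then show ?thesis by (simp add: rep_def chart_point_eq_iff)
qed

lemma flag_in_chart_iff:
  "g \<in> carrier (GL n) \<Longrightarrow> flag n g \<in> chart \<longleftrightarrow> (\<forall>i<n. minor i i g \<noteq> 0)"
  using flag_eq_chart_point(1)[of g] chart_ratio[of g] by (auto simp: chart_def)

section \<open>Regular functions and open sets on the chart\<close>

lemma minor_poly_funs: "i \<le> j \<Longrightarrow> j < n \<Longrightarrow> minor i j \<in> poly_funs n"
  unfolding minor_def[abs_def] by (rule poly_funs_det) (auto intro: poly_funs.entry)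

definition den :: "complex mat \<Rightarrow> complex" where
  "den g = (\<Prod>i<n. minor i i g)"

lemma den_poly_funs: "den \<in> poly_funs n"
  unfolding den_def[abs_def] by (intro poly_funs_prod minor_poly_funs) auto

lemma den_nz: "g \<in> carrier (GL n) \<Longrightarrow> den g \<noteq> 0 \<longleftrightarrow> flag n g \<in> chart"
  by (auto simp: den_def flag_in_chart_iff)

lemma rep_flag: "g \<in> carrier (GL n) \<Longrightarrow> den g \<noteq> 0 \<Longrightarrow> rep (flag n g) = chart_mat (ratio g)"
  using chart_ratio[of g] by (auto simp: den_def)

text \<open>Polynomials in the chart coordinates pull back to regular functions on the preimage of
  the chart: a coordinate is a quotient of minors whose denominator divides \<open>den\<close>, and
  fractions over powers of \<open>den\<close> are closed under sums and products.\<close>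

lemma rep_rational:
  assumes "h \<in> poly_funs n"
  shows "\<exists>a \<in> poly_funs n. \<exists>N. \<forall>x \<in> carrier (GL n). den x \<noteq> 0 \<longrightarrow> h (rep (flag n x)) = a x / den x ^ N"
  using assms
proof induction
  case (const c)
  show ?case by (rule bexI[of _ "\<lambda>_. c"], rule exI[of _ 0]) (auto intro: poly_funs.const)
next
  case (entry i j)
  let ?k = "pos i"
  consider "?k = j" | "j < ?k" | "?k < j" by linarith
  then show ?case
  proof cases
    case 1
    then show ?thesis using entry
      by (intro bexI[of _ "\<lambda>_. 1"] exI[of _ 0]) (auto intro: poly_funs.const simp: rep_flag chart_mat_def)
  next
    case 2
    have k: "?k < n" using entry by simp
    let ?a = "\<lambda>x. minor j ?k x * (\<Prod>i\<in>{..<n} - {j}. minor i i x)"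
    have "?a \<in> poly_funs n"
      using 2 k by (intro poly_funs.mult poly_funs_prod minor_poly_funs) auto
    moreover have "rep (flag n x) $$ (i, j) = ?a x / den x ^ 1"
      if x: "x \<in> carrier (GL n)" "den x \<noteq> 0" for x
    proof -
      have d: "den x = minor j j x * (\<Prod>i\<in>{..<n} - {j}. minor i i x)"
        unfolding den_def using entry by (intro prod.remove) auto
      show ?thesis using x entry 2 d by (auto simp: rep_flag chart_mat_def ratio_def)
    qed
    ultimately show ?thesis by (intro bexI[of _ ?a] exI[of _ 1]) blast+
  next
    case 3
    then show ?thesis using entry
      by (intro bexI[of _ "\<lambda>_. 0"] exI[of _ 0]) (auto intro: poly_funs.const simp: rep_flag chart_mat_def)
  qed
next
  case (add f g)
  obtain a N where a: "a \<in> poly_funs n"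
    "\<forall>x \<in> carrier (GL n). den x \<noteq> 0 \<longrightarrow> f (rep (flag n x)) = a x / den x ^ N" using add by auto
  obtain b M where b: "b \<in> poly_funs n"
    "\<forall>x \<in> carrier (GL n). den x \<noteq> 0 \<longrightarrow> g (rep (flag n x)) = b x / den x ^ M" using add by auto
  show ?case
  proof (rule bexI[of _ "\<lambda>x. a x * den x ^ M + b x * den x ^ N"], rule exI[of _ "N + M"], intro ballI impI)
    fix x assume "x \<in> carrier (GL n)" "den x \<noteq> 0"
    then show "f (rep (flag n x)) + g (rep (flag n x)) = (a x * den x ^ M + b x * den x ^ N) / den x ^ (N + M)"
      using a b by (simp add: field_simps power_add)
  qed (intro poly_funs.add poly_funs.mult a b poly_funs_power den_poly_funs)
next
  case (mult f g)
  obtain a N where a: "a \<in> poly_funs n"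
    "\<forall>x \<in> carrier (GL n). den x \<noteq> 0 \<longrightarrow> f (rep (flag n x)) = a x / den x ^ N" using mult by auto
  obtain b M where b: "b \<in> poly_funs n"
    "\<forall>x \<in> carrier (GL n). den x \<noteq> 0 \<longrightarrow> g (rep (flag n x)) = b x / den x ^ M" using mult by auto
  show ?case
  proof (rule bexI[of _ "\<lambda>x. a x * b x"], rule exI[of _ "N + M"], intro ballI impI)
    fix x assume "x \<in> carrier (GL n)" "den x \<noteq> 0"
    then show "f (rep (flag n x)) * g (rep (flag n x)) = (a x * b x) / den x ^ (N + M)"
      using a b by (simp add: power_add)
  qed (intro poly_funs.mult a b)
qed

text \<open>The preimage in G is the nonvanishing locus of the numerator of the pullback times
  \<open>den\<close>; the factor \<open>den\<close> enforces membership in the chart, also when the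
  power N is 0.\<close>

lemma openin_chart_nonzero:
  assumes "h \<in> poly_funs n"
  shows "openin (flag_topology n) {q \<in> chart. h (rep q) \<noteq> 0}"
proof -
  obtain a N where a: "a \<in> poly_funs n"
    "\<And>x. x \<in> carrier (GL n) \<Longrightarrow> den x \<noteq> 0 \<Longrightarrow> h (rep (flag n x)) = a x / den x ^ N"
    using rep_rational[OF assms] by blast
  have "{g \<in> carrier (GL n). flag n g \<in> {q \<in> chart. h (rep q) \<noteq> 0}} =
    {g \<in> carrier (GL n). \<exists>f\<in>{\<lambda>x. a x * den x}. f g \<noteq> 0}"
  proof (rule Collect_cong, rule conj_cong[OF refl])
    fix g assume "g \<in> carrier (GL n)"
    then show "flag n g \<in> {q \<in> chart. h (rep q) \<noteq> 0} \<longleftrightarrow> (\<exists>f\<in>{\<lambda>x. a x * den x}. f g \<noteq> 0)"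
      using a(2)[of g] den_nz[of g] by (cases "den g = 0") auto
  qed
  moreover have "{\<lambda>x. a x * den x} \<subseteq> poly_funs n"
    using a den_poly_funs by (auto intro: poly_funs.mult)
  moreover have "{q \<in> chart. h (rep q) \<noteq> 0} \<subseteq> flag_variety n"
    by (auto simp: chart_def chart_point_def intro: flag_in_variety)
  ultimately show ?thesis unfolding openin_flag_topology openin_zariski_GL by blast
qed

lemma openin_chart: "openin (flag_topology n) chart"
  using openin_chart_nonzero[OF poly_funs.const[of 1]] by simp

text \<open>In contrast to conditions on \<open>rep\<close>, this one is meaningful outside the
  chart, which matters at the neighbouring torus fixed points.\<close>

definition minor_open :: "nat \<Rightarrow> nat \<Rightarrow> complex mat set set" where
  "minor_open i j = {flag n g | g. g \<in> carrier (GL n) \<and> minor i j g \<noteq> 0}"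

lemma flag_in_minor_open:
  assumes "i \<le> j" "j < n" and g: "g \<in> carrier (GL n)"
  shows "flag n g \<in> minor_open i j \<longleftrightarrow> minor i j g \<noteq> 0"
proof
  assume "flag n g \<in> minor_open i j"
  then obtain h where h: "flag n g = flag n h" "h \<in> carrier (GL n)" "minor i j h \<noteq> 0"
    by (auto simp: minor_open_def)
  then obtain b where "b \<in> borel n" "g = h * b" using flag_eqD[OF g] by blast
  then show "minor i j g \<noteq> 0" using minor_borel_nz[of h b i j] h assms by (auto simp: carrier_GL)
qed (use g in \<open>auto simp: minor_open_def\<close>)

lemma openin_minor_open:
  assumes "i \<le> j" "j < n"
  shows "openin (flag_topology n) (minor_open i j)"
proof -
  have "{g \<in> carrier (GL n). flag n g \<in> minor_open i j} = {g \<in> carrier (GL n). \<exists>f\<in>{minor i j}. f g \<noteq> 0}"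
    using flag_in_minor_open[OF assms] by auto
  moreover have "minor_open i j \<subseteq> flag_variety n" by (auto simp: minor_open_def intro: flag_in_variety)
  moreover have "{minor i j} \<subseteq> poly_funs n" using minor_poly_funs[OF assms] by simp
  ultimately show ?thesis
    unfolding openin_flag_topology openin_zariski_GL by blast
qed

end

section \<open>Curves, torus orbits and Schubert varieties\<close>

lemma poly_funs_curve:
  assumes "h \<in> poly_funs n" and e: "\<And>i j. i < n \<Longrightarrow> j < n \<Longrightarrow> \<exists>p. \<forall>s. M s $$ (i, j) = poly p s"
  shows "\<exists>p. \<forall>s. h (M s) = poly p s"
  using assms(1)
proof induction
  case (const c)
  show ?case by (rule exI[of _ "[:c:]"]) simp
next
  case (entry i j)
  then show ?case by (rule e)
next
  case (add f g)
  then obtain p q where "\<forall>s. f (M s) = poly p s" "\<forall>s. g (M s) = poly q s" by auto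
  then show ?case by (intro exI[of _ "p + q"]) simp
next
  case (mult f g)
  then obtain p q where "\<forall>s. f (M s) = poly p s" "\<forall>s. g (M s) = poly q s" by auto
  then show ?case by (intro exI[of _ "p * q"]) simp
qed

text \<open>On G the open set is a union of nonvanishing loci of polynomial functions; one of them
  that is nonzero at s0 becomes a polynomial in s along the curve.\<close>

lemma open_flag_curve:
  assumes e: "\<And>i j. i < n \<Longrightarrow> j < n \<Longrightarrow> \<exists>p. \<forall>s. M s $$ (i, j) = poly p s"
    and U: "openin (flag_topology n) U" "flag n (M s0) \<in> U" "M s0 \<in> carrier (GL n)"
  shows "\<exists>p. poly p s0 \<noteq> 0 \<and> (\<forall>s. poly p s \<noteq> 0 \<longrightarrow> M s \<in> carrier (GL n) \<longrightarrow> flag n (M s) \<in> U)"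
proof -
  obtain F where F: "F \<subseteq> poly_funs n"
    "{g \<in> carrier (GL n). flag n g \<in> U} = {A \<in> carrier (GL n). \<exists>f\<in>F. f A \<noteq> 0}"
    using U(1) unfolding openin_flag_topology openin_zariski_GL by blast
  have "M s0 \<in> {g \<in> carrier (GL n). flag n g \<in> U}" using U by simp
  then obtain f where f: "f \<in> F" "f (M s0) \<noteq> 0" unfolding F(2) by blast
  obtain p where p: "\<forall>s. f (M s) = poly p s" using poly_funs_curve[of f n M] f F(1) e by blast
  have "flag n (M s) \<in> U" if "poly p s \<noteq> 0" "M s \<in> carrier (GL n)" for s
  proof -
    have "M s \<in> {A \<in> carrier (GL n). \<exists>f\<in>F. f A \<noteq> 0}" using that f p by (auto intro!: bexI[of _ f])
    then show ?thesis unfolding F(2)[symmetric] by blast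
  qed
  then show ?thesis using f(2) p by auto
qed

lemma poly_nonroot:
  fixes p :: "'a::{idom, ring_char_0} poly"
  assumes "p \<noteq> 0"
  obtains s where "s \<noteq> 0" "poly p s \<noteq> 0"
proof -
  have "finite ({s. poly p s = 0} \<union> {0})" using poly_roots_finite[OF assms] by simp
  then have "\<exists>s. s \<notin> {s. poly p s = 0} \<union> {0}" using infinite_UNIV_char_0 ex_new_if_finite by blast
  then show thesis using that by blast
qed

text \<open>The substitute for a limit s -> 0: a neighbourhood of the point at 0 excludes only
  finitely many of the points with s \<noteq> 0, hence contains one of them.\<close>

lemma closure_flag_curve:
  assumes e: "\<And>i j. i < n \<Longrightarrow> j < n \<Longrightarrow> \<exists>p. \<forall>s. M s $$ (i, j) = poly p s"
    and M0: "M 0 \<in> carrier (GL n)"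
    and S: "\<And>s. s \<noteq> 0 \<Longrightarrow> M s \<in> carrier (GL n) \<and> flag n (M s) \<in> S"
  shows "flag n (M 0) \<in> zariski_closure n S"
  unfolding in_closure_of
proof (intro conjI allI impI)
  show "flag n (M 0) \<in> topspace (flag_topology n)"
    using M0 by (simp add: topspace_flag flag_in_variety)
  fix U assume U: "flag n (M 0) \<in> U \<and> openin (flag_topology n) U"
  obtain p where p: "poly p 0 \<noteq> 0"
      "\<forall>s. poly p s \<noteq> 0 \<longrightarrow> M s \<in> carrier (GL n) \<longrightarrow> flag n (M s) \<in> U"
    using open_flag_curve[of n M U 0] e U M0 by blast
  from p(1) have "p \<noteq> 0" by auto
  then obtain s where s: "s \<noteq> 0" "poly p s \<noteq> 0" by (rule poly_nonroot)
  then show "\<exists>y. y \<in> S \<and> y \<in> U" using S[OF s(1)] p(2) by blast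
qed

section \<open>The torus action in chart coordinates\<close>

lemma torus_borel: "t \<in> torus n \<Longrightarrow> t \<in> borel n"
  by (auto simp: torus_def borel_def diagonal_mat_def carrier_GL)

lemma torusI: "(\<And>i. i < n \<Longrightarrow> f i \<noteq> 0) \<Longrightarrow> mat_diag n f \<in> torus n"
  using borelI[of "mat_diag n f" n] by (auto simp: torus_def borel_def diagonal_mat_def mat_diag_def)

lemma torus_is_mat_diag:
  "t \<in> torus n \<Longrightarrow> t = mat_diag n (\<lambda>i. t $$ (i, i))"
  by (auto simp: torus_def carrier_GL diagonal_mat_def mat_diag_def intro!: eq_matI)

text \<open>A torus element is recorded by \<open>\<tau> k\<close>, its diagonal entry in row v(k),
  so that the action too is indexed by positions.\<close>

definition scale :: "(nat \<Rightarrow> complex) \<Rightarrow> (nat \<Rightarrow> nat \<Rightarrow> complex) \<Rightarrow> nat \<Rightarrow> nat \<Rightarrow> complex" where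
  "scale \<tau> c = (\<lambda>i j. \<tau> j / \<tau> i * c i j)"

context perm_chart
begin

text \<open>Scaling the rows turns the pivot of column k into \<open>\<tau> k\<close>; dividing the
  columns by these factors is right multiplication by a Borel element and restores the normal
  form.\<close>

lemma torus_chart_point:
  assumes "\<And>k. k < n \<Longrightarrow> \<tau> k \<noteq> 0"
  shows "mat_diag n (\<lambda>r. \<tau> (pos r)) <#\<^bsub>GL n\<^esub> chart_point c = chart_point (scale \<tau> c)"
proof -
  let ?t = "mat_diag n (\<lambda>r. \<tau> (pos r))" and ?d = "mat_diag n \<tau>"
  have t: "?t \<in> torus n" "?d \<in> torus n" using assms by (auto intro!: torusI)
  have "?t * chart_mat c = chart_mat (scale \<tau> c) * ?d"
  proof (rule v_mat_eqI)
    fix j k assume "j < n" "k < n"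
    then show "(?t * chart_mat c) $$ (v j, k) = (chart_mat (scale \<tau> c) * ?d) $$ (v j, k)"
      unfolding mat_diag_mult_left[OF chart_mat_carrier] mat_diag_mult_right[OF chart_mat_carrier]
      using assms by (auto simp: chart_mat_entry scale_def)
  next
    show "?t * chart_mat c \<in> carrier_mat n n" by (rule mult_carrier_mat[of _ n n]) auto
    show "chart_mat (scale \<tau> c) * ?d \<in> carrier_mat n n" by (rule mult_carrier_mat[of _ n n]) auto
  qed
  then have "flag n (?t * chart_mat c) = chart_point (scale \<tau> c)"
    using flag_mult_borel[OF chart_mat_GL torus_borel[OF t(2)]] by (simp add: chart_point_def)
  then show ?thesis
    using coset_flag[of ?t n "chart_mat c"] t borel_GL[OF torus_borel[OF t(1)]] by (simp add: chart_point_def)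
qed

lemma torus_orbit_chart_point:
  "torus_orbit n (chart_point c) = {chart_point (scale \<tau> c) | \<tau>. \<forall>k. \<tau> k \<noteq> 0}"
proof (rule Set.set_eqI, rule iffI)
  fix q assume "q \<in> torus_orbit n (chart_point c)"
  then obtain t where t: "t \<in> torus n" "q = t <#\<^bsub>GL n\<^esub> chart_point c" by (auto simp: torus_orbit_def)
  \<comment> \<open>The default 1 outside the matrix makes \<tau> nonzero at every index, as the
    right-hand side requires.\<close>
  define \<tau> where "\<tau> k = (if k < n then t $$ (v k, v k) else 1)" for k
  have nz: "\<tau> k \<noteq> 0" for k using borel_diag[OF torus_borel[OF t(1)]] by (simp add: \<tau>_def)
  have "t = mat_diag n (\<lambda>r. \<tau> (pos r))"
    by (subst torus_is_mat_diag[OF t(1)]) (auto simp: mat_diag_def \<tau>_def intro!: eq_matI)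
  then have "q = chart_point (scale \<tau> c)" using torus_chart_point[of \<tau> c] nz t(2) by metis
  then show "q \<in> {chart_point (scale \<tau> c) | \<tau>. \<forall>k. \<tau> k \<noteq> 0}" using nz by blast
next
  fix q assume "q \<in> {chart_point (scale \<tau> c) | \<tau>. \<forall>k. \<tau> k \<noteq> 0}"
  then obtain \<tau> where \<tau>: "\<forall>k. \<tau> k \<noteq> 0" "q = chart_point (scale \<tau> c)" by blast
  have "mat_diag n (\<lambda>r. \<tau> (pos r)) \<in> torus n" using \<tau> by (intro torusI) auto
  then show "q \<in> torus_orbit n (chart_point c)"
    using torus_chart_point[of \<tau> c] \<tau> unfolding torus_orbit_def by force
qed

lemma scale_zero [simp]: "scale \<tau> (\<lambda>_ _. 0) = (\<lambda>_ _. 0)"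
  by (simp add: scale_def)

lemma torus_fixed_origin: "torus_fixed n (chart_point (\<lambda>_ _. 0))"
proof -
  have "torus_orbit n (chart_point (\<lambda>_ _. 0)) \<subseteq> {chart_point (\<lambda>_ _. 0)}"
    by (auto simp: torus_orbit_chart_point)
  then show ?thesis by (auto simp: torus_fixed_def torus_orbit_def)
qed

lemma chart_curve_closure:
  assumes "\<And>i j. i < j \<Longrightarrow> j < n \<Longrightarrow> \<exists>p. \<forall>s. c s i j = poly p s"
    and "\<And>s. s \<noteq> 0 \<Longrightarrow> chart_point (c s) \<in> S"
  shows "chart_point (c 0) \<in> zariski_closure n S"
  unfolding chart_point_def
proof (rule closure_flag_curve[where M = "\<lambda>s. chart_mat (c s)"])
  fix r k assume rk: "r < n" "k < n"
  consider "pos r = k" | "k < pos r" | "pos r < k" by linarith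
  then show "\<exists>p. \<forall>s. chart_mat (c s) $$ (r, k) = poly p s"
  proof cases
    case 1
    then show ?thesis using rk by (intro exI[of _ 1]) (simp add: chart_mat_def)
  next
    case 2
    then obtain p where "\<forall>s. c s k (pos r) = poly p s" using assms(1)[of k "pos r"] rk by auto
    then show ?thesis using rk 2 by (intro exI[of _ p]) (simp add: chart_mat_def)
  next
    case 3
    then show ?thesis using rk by (intro exI[of _ 0]) (simp add: chart_mat_def)
  qed
qed (use assms(2) in \<open>auto simp: chart_point_def\<close>)

text \<open>The limit of a one-parameter subgroup with weights \<open>\<mu>\<close>.\<close>

lemma torus_limit:
  fixes \<mu> :: "nat \<Rightarrow> int"
  assumes "\<And>i j. i < j \<Longrightarrow> j < n \<Longrightarrow> c i j \<noteq> 0 \<Longrightarrow> \<mu> i \<le> \<mu> j"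
    and "\<And>i j. i < j \<Longrightarrow> j < n \<Longrightarrow> d i j = (if \<mu> i = \<mu> j then c i j else 0)"
  shows "torus_orbit n (chart_point d) \<subseteq> zariski_closure n (torus_orbit n (chart_point c))"
proof
  fix q assume "q \<in> torus_orbit n (chart_point d)"
  then obtain \<sigma> where \<sigma>: "\<forall>k. \<sigma> k \<noteq> 0" "q = chart_point (scale \<sigma> d)"
    by (auto simp: torus_orbit_chart_point)
  \<comment> \<open>The truncation by \<open>nat\<close> is exact wherever the coordinate is
    nonzero. So C is polynomial in s, and for s \<noteq> 0 it is the translate of \<open>c\<close>
    by the torus element with entries \<sigma>(k) s^\<mu>(k).\<close>
  define C where "C s i j = \<sigma> j / \<sigma> i * s ^ nat (\<mu> j - \<mu> i) * c i j" for s i j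
  have "chart_point (C 0) \<in> zariski_closure n (torus_orbit n (chart_point c))"
  proof (rule chart_curve_closure)
    fix i j assume "i < j" "j < n"
    show "\<exists>p. \<forall>s. C s i j = poly p s"
      by (rule exI[of _ "monom (\<sigma> j / \<sigma> i * c i j) (nat (\<mu> j - \<mu> i))"])
        (simp add: C_def poly_monom mult_ac)
  next
    fix s :: complex assume s: "s \<noteq> 0"
    have "chart_mat (C s) = chart_mat (scale (\<lambda>k. \<sigma> k * s powi \<mu> k) c)"
    proof (rule chart_mat_cong)
      fix i j assume ij: "i < j" "j < n"
      show "C s i j = scale (\<lambda>k. \<sigma> k * s powi \<mu> k) c i j"
      proof (cases "c i j = 0")
        case False
        then have "\<mu> i \<le> \<mu> j" using assms(1) ij by blast
        then have "s ^ nat (\<mu> j - \<mu> i) = s powi (\<mu> j - \<mu> i)" by (simp add: power_int_def)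
        then show ?thesis using s by (simp add: C_def scale_def power_int_diff)
      qed (simp add: C_def scale_def)
    qed
    then show "chart_point (C s) \<in> torus_orbit n (chart_point c)"
      unfolding torus_orbit_chart_point using \<sigma>(1) s
      by (intro CollectI exI[of _ "\<lambda>k. \<sigma> k * s powi \<mu> k"]) (simp add: chart_point_def)
  qed
  moreover have "chart_mat (C 0) = chart_mat (scale \<sigma> d)"
  proof (rule chart_mat_cong)
    fix i j assume ij: "i < j" "j < n"
    show "C 0 i j = scale \<sigma> d i j"
      using assms(1)[OF ij] assms(2)[OF ij] by (auto simp: C_def scale_def power_0_left)
  qed
  ultimately show "q \<in> zariski_closure n (torus_orbit n (chart_point c))"
    using \<sigma>(2) by (simp add: chart_point_def)
qed

section \<open>The Schubert variety in the chart\<close>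

definition schubert :: "complex mat set set" where
  "schubert = zariski_closure n {b <#\<^bsub>GL n\<^esub> chart_point (\<lambda>_ _. 0) | b. b \<in> borel n}"

lemma mult_origin_entry:
  assumes "b \<in> carrier_mat n n" "r < n" "k < n"
  shows "(b * chart_mat (\<lambda>_ _. 0)) $$ (r, k) = b $$ (r, v k)"
proof -
  have "(b * chart_mat (\<lambda>_ _. 0)) $$ (r, k) = (\<Sum>l<n. b $$ (r, l) * chart_mat (\<lambda>_ _. 0) $$ (l, k))"
    using assms by (intro mult_entry) auto
  also have "\<dots> = (\<Sum>l<n. if l = v k then b $$ (r, v k) else 0)"
    using assms by (intro sum.cong) (auto simp: chart_mat_def)
  also have "\<dots> = b $$ (r, v k)" using assms by simp
  finally show ?thesis .
qed

text \<open>As b is upper triangular, a nonzero term of the Leibniz expansion would pair each row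
  with a column of b that is at least as large. The rows v(0), ..., v(i-1), v(j) have a larger sum
  than the columns v(0), ..., v(i), so there is no such term.\<close>

lemma minor_borel_origin:
  assumes "b \<in> borel n" and ij: "i < j" "j < n" "v i < v j"
  shows "minor i j (b * chart_mat (\<lambda>_ _. 0)) = 0"
proof -
  have b: "b \<in> carrier_mat n n" "upper_triangular b" using assms by (auto simp: borel_iff)
  let ?r = "\<lambda>a. v (if a < i then a else j)"
  let ?M = "Matrix.mat (Suc i) (Suc i) (\<lambda>(a, k). (b * chart_mat (\<lambda>_ _. 0)) $$ (?r a, k))"
  have "det ?M = (\<Sum>p | p permutes {0..<Suc i}. signof p * (\<Prod>a = 0..<Suc i. ?M $$ (a, p a)))"
    by (rule det_def') simp
  also have "\<dots> = 0"
  proof (rule sum.neutral, rule ballI)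
    fix p assume "p \<in> {p. p permutes {0..<Suc i}}"
    then have p: "p permutes {0..<Suc i}" by simp
    have "\<exists>a\<in>{0..<Suc i}. ?M $$ (a, p a) = 0"
    proof (rule ccontr)
      assume "\<not> ?thesis"
      then have nz: "?M $$ (a, p a) \<noteq> 0" if "a < Suc i" for a using that by auto
      have le: "?r a \<le> v (p a)" if a: "a < Suc i" for a
      proof (rule ccontr)
        have pa: "p a < Suc i" using a permutes_in_image[OF p, of a] by simp
        assume "\<not> ?thesis"
        then have "b $$ (?r a, v (p a)) = 0" using b a ij by (intro upper_triangularD) auto
        then show False using nz[OF a] a pa ij b by (simp add: mult_origin_entry)
      qed
      have "(\<Sum>a\<in>{0..<Suc i}. ?r a) \<le> (\<Sum>a\<in>{0..<Suc i}. v (p a))"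
        by (intro sum_mono le) auto
      also have "\<dots> = (\<Sum>a\<in>{0..<Suc i}. v a)"
        using sum.permute[OF p, of v] by (simp add: o_def)
      finally have "(\<Sum>a = 0..<i. ?r a) + v j \<le> (\<Sum>a = 0..<i. v a) + v i" by simp
      moreover have "(\<Sum>a = 0..<i. ?r a) = (\<Sum>a = 0..<i. v a)" by (intro sum.cong) auto
      ultimately show False using ij by simp
    qed
    then show "signof p * (\<Prod>a = 0..<Suc i. ?M $$ (a, p a)) = 0"
      by (subst prod_zero) auto
  qed
  finally show ?thesis by (simp add: minor_def)
qed

lemma schubert_noninversion:
  assumes c: "chart_point c \<in> schubert" and ij: "i < j" "j < n" "v i < v j"
  shows "c i j = 0"
proof (rule ccontr)
  assume nz: "c i j \<noteq> 0"
  have "chart_point c \<in> minor_open i j"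
    unfolding chart_point_def using ij nz by (subst flag_in_minor_open) (auto simp: minor_chart_mat)
  then obtain b where b: "b \<in> borel n" "b <#\<^bsub>GL n\<^esub> chart_point (\<lambda>_ _. 0) \<in> minor_open i j"
    using c openin_minor_open[of i j] ij unfolding schubert_def in_closure_of by auto
  then have "flag n (b * chart_mat (\<lambda>_ _. 0)) \<in> minor_open i j"
    using coset_flag[of b n "chart_mat (\<lambda>_ _. 0)"] borel_GL by (simp add: chart_point_def)
  then show False
    using minor_borel_origin[OF b(1) ij] flag_in_minor_open[of i j "b * chart_mat (\<lambda>_ _. 0)"] ij
      GL_mult[OF borel_GL[OF b(1)] chart_mat_GL] by auto
qed

lemma swap_perm:
  assumes "i < n" "j < n"
  shows "perm_chart n (v \<circ> transpose i j)"
  using assms perm by unfold_locales (intro permutes_compose permutes_swap_id; simp)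

text \<open>A curve in the Schubert cell degenerates to the smaller fixed point: column i is s
  e_v(i) + e_v(j), column j is e_v(i), and all other columns are those of \<open>v\<close>.\<close>

lemma schubert_swap:
  assumes ij: "i < j" "j < n" "v j < v i"
  shows "perm_chart.chart_point n (v \<circ> transpose i j) (\<lambda>_ _. 0) \<in> schubert"
proof -
  interpret U: perm_chart n "v \<circ> transpose i j" using ij by (intro swap_perm) auto
  define M where "M s = Matrix.mat n n (\<lambda>(r, k).
     if k = i then (if r = v j then 1 else if r = v i then s else 0)
     else if k = j then (if r = v i then 1 else 0) else if r = v k then 1 else 0)" for s :: complex
  have M0: "M 0 = U.chart_mat (\<lambda>_ _. 0)"
  proof (rule U.v_mat_eqI)
    fix a k assume "a < n" "k < n"
    then show "M 0 $$ ((v \<circ> transpose i j) a, k) = U.chart_mat (\<lambda>_ _. 0) $$ ((v \<circ> transpose i j) a, k)"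
      unfolding U.chart_mat_entry[OF \<open>a < n\<close> \<open>k < n\<close>]
      using ij by (auto simp: M_def transpose_def)
  qed (auto simp: M_def)
  have "flag n (M 0) \<in> schubert" unfolding schubert_def
  proof (rule closure_flag_curve)
    fix r k assume rk: "r < n" "k < n"
    show "\<exists>p. \<forall>s. M s $$ (r, k) = poly p s"
    proof (cases "k = i \<and> r = v i")
      case True
      then show ?thesis using rk ij by (intro exI[of _ "[:0, 1:]"]) (auto simp: M_def)
    next
      case False
      then show ?thesis using rk by (intro exI[of _ "[:M 0 $$ (r, k):]"]) (auto simp: M_def)
    qed
  next
    show "M 0 \<in> carrier (GL n)" by (simp add: M0)
    fix s :: complex assume s: "s \<noteq> 0"
    \<comment> \<open>Left multiplication by b adds 1/s times row v(i) to row v(j); b is upper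
      triangular because v(j) < v(i).\<close>
    define b where "b = Matrix.mat n n (\<lambda>(r, k). if r = k then 1 else if r = v j \<and> k = v i then 1 / s else 0)"
    \<comment> \<open>Right multiplication by \<beta> scales column i by s and turns column j into
      column i minus 1/s times column j; it is upper triangular because i < j.\<close>
    define \<beta> where "\<beta> = Matrix.mat n n (\<lambda>(l, k).
      (if l = k then (if k = i then s else if k = j then - 1 / s else 1) else 0) + (if l = i then (if k = j then 1 else 0) else 0))"
    have b: "b \<in> borel n" using ij by (intro borelI) (auto simp: b_def)
    have \<beta>: "\<beta> \<in> borel n" using ij s by (intro borelI) (auto simp: \<beta>_def)
    let ?P = "chart_mat (\<lambda>_ _. 0)"
    have bP: "b * ?P \<in> carrier (GL n)" by (intro GL_mult borel_GL[OF b] chart_mat_GL)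
    have "M s = b * ?P * \<beta>"
    proof (rule v_mat_eqI)
      fix a k assume ak: "a < n" "k < n"
      have "(b * ?P * \<beta>) $$ (v a, k) = (\<Sum>l<n. (b * ?P) $$ (v a, l) * \<beta> $$ (l, k))"
        using bP \<beta> ak by (intro mult_entry) (auto simp: carrier_GL borel_iff)
      also have "\<dots> = (\<Sum>l<n. b $$ (v a, v l) * \<beta> $$ (l, k))"
        using b ak by (intro sum.cong) (auto simp: mult_origin_entry borel_iff)
      also have "\<dots> = (\<Sum>l<n. (if l = k then b $$ (v a, v k) * (if k = i then s else if k = j then - 1 / s else 1) else 0)
        + (if l = i then b $$ (v a, v i) * (if k = j then 1 else 0) else 0))"
        using ak by (intro sum.cong) (auto simp: \<beta>_def algebra_simps)
      also have "\<dots> = b $$ (v a, v k) * (if k = i then s else if k = j then - 1 / s else 1)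
        + b $$ (v a, v i) * (if k = j then 1 else 0)"
        using ak ij by (simp add: sum.distrib)
      also have "\<dots> = M s $$ (v a, k)"
        using ak ij s by (auto simp: b_def M_def)
      finally show "M s $$ (v a, k) = (b * ?P * \<beta>) $$ (v a, k)" by simp
    next
      show "b * ?P * \<beta> \<in> carrier_mat n n" using GL_mult[OF bP borel_GL[OF \<beta>]] by (rule GL_D)
    qed (simp add: M_def)
    moreover have "flag n (b * ?P * \<beta>) = b <#\<^bsub>GL n\<^esub> chart_point (\<lambda>_ _. 0)"
      using flag_mult_borel[OF bP \<beta>] coset_flag[OF borel_GL[OF b] chart_mat_GL]
      by (simp add: chart_point_def)
    ultimately show "M s \<in> carrier (GL n) \<and> flag n (M s) \<in> {b <#\<^bsub>GL n\<^esub> chart_point (\<lambda>_ _. 0) | b. b \<in> borel n}"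
      using GL_mult[OF bP borel_GL[OF \<beta>]] b by auto
  qed
  then show ?thesis by (simp add: M0 U.chart_point_def)
qed

lemma minor_swap:
  assumes ij: "i < j" "j < n"
  shows "minor i j (perm_chart.chart_mat n (v \<circ> transpose i j) (\<lambda>_ _. 0)) = 1"
proof -
  interpret U: perm_chart n "v \<circ> transpose i j" using ij by (intro swap_perm) auto
  have "Matrix.mat (Suc i) (Suc i) (\<lambda>(a, k). U.chart_mat (\<lambda>_ _. 0) $$ (v (if a < i then a else j), k)) = 1\<^sub>m (Suc i)"
  proof (rule eq_matI)
    fix a k assume "a < dim_row (1\<^sub>m (Suc i))" "k < dim_col (1\<^sub>m (Suc i))"
    then have ak: "a \<le> i" "k \<le> i" by auto
    have "v (if a < i then a else j) = (v \<circ> transpose i j) a" using ak ij by (auto simp: transpose_def)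
    then have "U.chart_mat (\<lambda>_ _. 0) $$ (v (if a < i then a else j), k) = (if a = k then 1 else 0)"
      using U.chart_mat_entry[of a k "\<lambda>_ _. 0"] ak ij by simp
    then show "Matrix.mat (Suc i) (Suc i) (\<lambda>(a, k). U.chart_mat (\<lambda>_ _. 0) $$ (v (if a < i then a else j), k)) $$ (a, k) = 1\<^sub>m (Suc i) $$ (a, k)"
      using ak by simp
  qed auto
  then show ?thesis by (simp add: minor_def)
qed

text \<open>The fixed point of \<open>v\<close> with i and j exchanged lies in the Schubert variety,
  and its minor (i, j) is 1. Near it the orbit must have a point where this minor is nonzero, and on
  the orbit the minor is a multiple of \<open>c i j\<close>.\<close>

lemma generic_inversion:
  assumes g: "{p \<in> schubert. torus_fixed n p} \<subseteq> zariski_closure n (torus_orbit n (chart_point c))"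
    and ij: "i < j" "j < n" "v j < v i"
  shows "c i j \<noteq> 0"
proof
  assume z: "c i j = 0"
  interpret U: perm_chart n "v \<circ> transpose i j" using ij by (intro swap_perm) auto
  have "U.chart_point (\<lambda>_ _. 0) \<in> zariski_closure n (torus_orbit n (chart_point c))"
    using schubert_swap[OF ij] U.torus_fixed_origin g by blast
  moreover have "U.chart_point (\<lambda>_ _. 0) \<in> minor_open i j"
    unfolding U.chart_point_def using ij minor_swap[OF ij(1,2)] by (subst flag_in_minor_open) auto
  ultimately obtain q where q: "q \<in> torus_orbit n (chart_point c)" "q \<in> minor_open i j"
    using openin_minor_open[of i j] ij unfolding in_closure_of by auto
  then obtain \<tau> where "q = flag n (chart_mat (scale \<tau> c))"
    using q(1)[unfolded torus_orbit_chart_point] by (auto simp: chart_point_def)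
  then have "minor i j (chart_mat (scale \<tau> c)) \<noteq> 0" using q(2) ij flag_in_minor_open[of i j] by auto
  then show False using ij z by (simp add: minor_chart_mat scale_def)
qed

end

section \<open>The tangent space\<close>

lemma sum_fun_apply: "(\<Sum>x\<in>A. F x) y = (\<Sum>x\<in>A. F x (y :: 'b) :: 'c::comm_monoid_add)"
  by (induction A rule: infinite_finite_induct) auto

lemma regular_at_add:
  assumes "regular_at n f g" "regular_at n f' g"
  shows "regular_at n (\<lambda>x. f x + f' x) g"
proof -
  obtain a b where 1: "a \<in> poly_funs n" "b \<in> poly_funs n" "b g \<noteq> 0"
    "\<forall>x \<in> carrier (GL n). b x \<noteq> 0 \<longrightarrow> f x = a x / b x" using assms(1) by (auto simp: regular_at_def)
  obtain a' b' where 2: "a' \<in> poly_funs n" "b' \<in> poly_funs n" "b' g \<noteq> 0"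
    "\<forall>x \<in> carrier (GL n). b' x \<noteq> 0 \<longrightarrow> f' x = a' x / b' x" using assms(2) by (auto simp: regular_at_def)
  show ?thesis unfolding regular_at_def
    by (rule bexI[of _ "\<lambda>x. a x * b' x + a' x * b x"], rule bexI[of _ "\<lambda>x. b x * b' x"])
       (use 1 2 in \<open>auto intro: poly_funs.intros simp: field_simps\<close>)
qed

lemma regular_at_mult:
  assumes "regular_at n f g" "regular_at n f' g"
  shows "regular_at n (\<lambda>x. f x * f' x) g"
proof -
  obtain a b where 1: "a \<in> poly_funs n" "b \<in> poly_funs n" "b g \<noteq> 0"
    "\<forall>x \<in> carrier (GL n). b x \<noteq> 0 \<longrightarrow> f x = a x / b x" using assms(1) by (auto simp: regular_at_def)
  obtain a' b' where 2: "a' \<in> poly_funs n" "b' \<in> poly_funs n" "b' g \<noteq> 0"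
    "\<forall>x \<in> carrier (GL n). b' x \<noteq> 0 \<longrightarrow> f' x = a' x / b' x" using assms(2) by (auto simp: regular_at_def)
  show ?thesis unfolding regular_at_def
    by (rule bexI[of _ "\<lambda>x. a x * a' x"], rule bexI[of _ "\<lambda>x. b x * b' x"])
       (use 1 2 in \<open>auto intro: poly_funs.intros\<close>)
qed

lemma local_functions_add:
  assumes "f \<in> local_functions n p" "g \<in> local_functions n p"
  shows "(\<lambda>q. f q + g q) \<in> local_functions n p"
proof -
  obtain U where U: "openin (flag_topology n) U" "p \<in> U"
    "\<forall>x \<in> carrier (GL n). flag n x \<in> U \<longrightarrow> regular_at n (\<lambda>x. f (flag n x)) x"
    using assms(1) by (auto simp: local_functions_def)
  obtain V where V: "openin (flag_topology n) V" "p \<in> V"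
    "\<forall>x \<in> carrier (GL n). flag n x \<in> V \<longrightarrow> regular_at n (\<lambda>x. g (flag n x)) x"
    using assms(2) by (auto simp: local_functions_def)
  show ?thesis unfolding local_functions_def
    by (rule CollectI, rule exI[of _ "U \<inter> V"]) (use U V in \<open>auto intro: openin_Int regular_at_add\<close>)
qed

lemma local_functions_mult:
  assumes "f \<in> local_functions n p" "g \<in> local_functions n p"
  shows "(\<lambda>q. f q * g q) \<in> local_functions n p"
proof -
  obtain U where U: "openin (flag_topology n) U" "p \<in> U"
    "\<forall>x \<in> carrier (GL n). flag n x \<in> U \<longrightarrow> regular_at n (\<lambda>x. f (flag n x)) x"
    using assms(1) by (auto simp: local_functions_def)
  obtain V where V: "openin (flag_topology n) V" "p \<in> V"
    "\<forall>x \<in> carrier (GL n). flag n x \<in> V \<longrightarrow> regular_at n (\<lambda>x. g (flag n x)) x"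
    using assms(2) by (auto simp: local_functions_def)
  show ?thesis unfolding local_functions_def
    by (rule CollectI, rule exI[of _ "U \<inter> V"]) (use U V in \<open>auto intro: openin_Int regular_at_mult\<close>)
qed

interpretation fun_space: vector_space "\<lambda>c (D :: 'b \<Rightarrow> complex) f. c * D f"
  by (rule vector_space_fun_scale)

context
  fixes n :: nat and Y :: "complex mat set set" and p :: "complex mat set"
    and D :: "(complex mat set \<Rightarrow> complex) \<Rightarrow> complex"
  assumes D: "D \<in> tangent_space n Y p"
begin

lemma tangent_outside: "f \<notin> local_functions n p \<Longrightarrow> D f = 0"
  using D by (simp add: tangent_space_def)

lemma tangent_add:
  "f \<in> local_functions n p \<Longrightarrow> g \<in> local_functions n p \<Longrightarrow> D (\<lambda>q. f q + g q) = D f + D g"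
  using D by (simp add: tangent_space_def)

lemma tangent_mult:
  "f \<in> local_functions n p \<Longrightarrow> g \<in> local_functions n p \<Longrightarrow> D (\<lambda>q. f q * g q) = f p * D g + g p * D f"
  using D by (simp add: tangent_space_def)

lemma tangent_cmult: "f \<in> local_functions n p \<Longrightarrow> D (\<lambda>q. c * f q) = c * D f"
  using D by (simp add: tangent_space_def)

lemma tangent_vanish:
  "f \<in> local_functions n p \<Longrightarrow> openin (flag_topology n) U \<Longrightarrow> p \<in> U \<Longrightarrow> (\<And>q. q \<in> U \<Longrightarrow> q \<in> Y \<Longrightarrow> f q = 0) \<Longrightarrow> D f = 0"
  using D unfolding tangent_space_def by blast

end

lemma subspace_tangent_space: "fun_space.subspace (tangent_space n Y p)"
proof (rule fun_space.subspaceI)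
  show "0 \<in> tangent_space n Y p" by (simp add: tangent_space_def)
next
  fix D E assume DE: "D \<in> tangent_space n Y p" "E \<in> tangent_space n Y p"
  note t = tangent_add[OF DE(1)] tangent_add[OF DE(2)] tangent_mult[OF DE(1)] tangent_mult[OF DE(2)]
    tangent_cmult[OF DE(1)] tangent_cmult[OF DE(2)] tangent_outside[OF DE(1)] tangent_outside[OF DE(2)]
  show "D + E \<in> tangent_space n Y p"
    unfolding tangent_space_def
    by (auto simp: t algebra_simps intro: tangent_vanish[OF DE(1)] tangent_vanish[OF DE(2)])
       (metis IntI tangent_vanish[OF DE(1)] tangent_vanish[OF DE(2)] add_0)
next
  fix c D assume D: "D \<in> tangent_space n Y p"
  note t = tangent_add[OF D] tangent_mult[OF D] tangent_cmult[OF D] tangent_outside[OF D]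
  show "(\<lambda>f. c * D f) \<in> tangent_space n Y p"
    unfolding tangent_space_def
    by (auto simp: t algebra_simps) (metis IntI tangent_vanish[OF D])
qed

section \<open>Partial derivatives at the origin of the chart\<close>

context perm_chart
begin

abbreviation origin :: "complex mat set" where
  "origin \<equiv> chart_point (\<lambda>_ _. 0)"

lemma origin_in_chart: "origin \<in> chart"
  by (simp add: chart_def)

lemma flag_rep: "q \<in> chart \<Longrightarrow> flag n (rep q) = q"
  by (auto simp: chart_def chart_point_def[symmetric])

lemma rep_GL: "q \<in> chart \<Longrightarrow> rep q \<in> carrier (GL n)"
  by (auto simp: chart_def)

lemma local_functions_rep:
  assumes "h \<in> poly_funs n"
  shows "(\<lambda>q. h (rep q)) \<in> local_functions n origin"
proof -
  obtain a N where a: "a \<in> poly_funs n"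
    "\<And>x. x \<in> carrier (GL n) \<Longrightarrow> den x \<noteq> 0 \<Longrightarrow> h (rep (flag n x)) = a x / den x ^ N"
    using rep_rational[OF assms] by blast
  have "regular_at n (\<lambda>x. h (rep (flag n x))) g" if g: "g \<in> carrier (GL n)" "flag n g \<in> chart" for g
    unfolding regular_at_def
  proof (rule bexI[of _ "\<lambda>x. a x * den x"], rule bexI[of _ "\<lambda>x. den x ^ Suc N"], intro conjI ballI impI)
    show "den g ^ Suc N \<noteq> 0" using den_nz[OF g(1)] g(2) by simp
    fix x assume "x \<in> carrier (GL n)" "den x ^ Suc N \<noteq> 0"
    then show "h (rep (flag n x)) = a x * den x / den x ^ Suc N" using a(2)[of x] by simp
  qed (intro poly_funs.mult a(1) poly_funs_power den_poly_funs)+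
  then show ?thesis unfolding local_functions_def
    using openin_chart origin_in_chart by blast
qed

lemma local_functions_const: "(\<lambda>_. c) \<in> local_functions n origin"
  using local_functions_rep[OF poly_funs.const[of c]] by simp

text \<open>A fraction valid near one matrix over the fixed point can be evaluated on the section
  \<open>rep\<close>, which turns it into a fraction in the chart coordinates.\<close>

lemma local_function_quotient:
  assumes "f \<in> local_functions n origin"
  obtains a b where "a \<in> poly_funs n" "b \<in> poly_funs n" "b (chart_mat (\<lambda>_ _. 0)) \<noteq> 0"
    "\<And>q. q \<in> chart \<Longrightarrow> b (rep q) \<noteq> 0 \<Longrightarrow> f q = a (rep q) / b (rep q)"
proof -
  have "regular_at n (\<lambda>x. f (flag n x)) (chart_mat (\<lambda>_ _. 0))"
    using assms unfolding local_functions_def by (auto simp: chart_point_def)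
  then obtain a b where ab: "a \<in> poly_funs n" "b \<in> poly_funs n" "b (chart_mat (\<lambda>_ _. 0)) \<noteq> 0"
    "\<And>x. x \<in> carrier (GL n) \<Longrightarrow> b x \<noteq> 0 \<Longrightarrow> f (flag n x) = a x / b x" by (auto simp: regular_at_def)
  show thesis using that[OF ab(1-3)] ab(4) flag_rep rep_GL by metis
qed

text \<open>The edges E(w), written with positions counted from 0 in place of values.\<close>

definition covers :: "(nat \<times> nat) set" where
  "covers = {(i, j). i < j \<and> j < n \<and> v j < v i \<and> (\<forall>k. i < k \<longrightarrow> k < j \<longrightarrow> \<not> (v j < v k \<and> v k < v i))}"

lemma finite_covers: "finite covers"
  by (rule finite_subset[of _ "{..<n} \<times> {..<n}"]) (auto simp: covers_def)

definition axis :: "nat \<times> nat \<Rightarrow> complex \<Rightarrow> nat \<Rightarrow> nat \<Rightarrow> complex" where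
  "axis e s = (\<lambda>a b. if (a, b) = e then s else 0)"

lemma axis_0 [simp]: "axis e 0 = (\<lambda>_ _. 0)"
  by (auto simp: axis_def fun_eq_iff)

lemma axis_mat_poly:
  "r < n \<Longrightarrow> k < n \<Longrightarrow> \<exists>p. \<forall>s. chart_mat (axis e s) $$ (r, k) = poly p s"
  by (cases "k < pos r \<and> (k, pos r) = e")
     (auto intro: exI[of _ "[:0, 1:]"] exI[of _ "[:chart_mat (axis e 0) $$ (r, k):]"] simp: chart_mat_def axis_def)

text \<open>The partial derivative at the origin in the coordinate e. The value 0 outside the local
  functions follows the normalization of \<open>tangent_space\<close>.\<close>

definition axis_deriv :: "nat \<times> nat \<Rightarrow> (complex mat set \<Rightarrow> complex) \<Rightarrow> complex" where
  "axis_deriv e f = (if f \<in> local_functions n origin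
     then THE d. ((\<lambda>s. f (chart_point (axis e s))) has_field_derivative d) (at 0) else 0)"

lemma axis_deriv_eq:
  "f \<in> local_functions n origin \<Longrightarrow> ((\<lambda>s. f (chart_point (axis e s))) has_field_derivative d) (at 0) \<Longrightarrow> axis_deriv e f = d"
  by (auto simp: axis_deriv_def intro: DERIV_unique)

lemma poly_nz_eventually: "poly p a \<noteq> 0 \<Longrightarrow> eventually (\<lambda>s. poly p s \<noteq> 0) (nhds (a :: complex))"
  using tendsto_imp_eventually_ne[OF poly_isCont[of a p, unfolded isCont_def], of 0]
  by (simp add: eventually_nhds_conv_at)

lemma axis_deriv_exists:
  assumes "f \<in> local_functions n origin"
  shows "((\<lambda>s. f (chart_point (axis e s))) has_field_derivative axis_deriv e f) (at 0)"
proof -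
  obtain a b where ab: "a \<in> poly_funs n" "b \<in> poly_funs n" "b (chart_mat (\<lambda>_ _. 0)) \<noteq> 0"
    "\<And>q. q \<in> chart \<Longrightarrow> b (rep q) \<noteq> 0 \<Longrightarrow> f q = a (rep q) / b (rep q)"
    using local_function_quotient[OF assms] by blast
  obtain p where p: "\<forall>s. a (chart_mat (axis e s)) = poly p s"
    using poly_funs_curve[OF ab(1), of "\<lambda>s. chart_mat (axis e s)"] axis_mat_poly by blast
  obtain q where q: "\<forall>s. b (chart_mat (axis e s)) = poly q s"
    using poly_funs_curve[OF ab(2), of "\<lambda>s. chart_mat (axis e s)"] axis_mat_poly by blast
  have q0: "poly q 0 \<noteq> 0" using q[rule_format, of 0] ab(3) by simp
  have "((\<lambda>s. poly p s / poly q s) has_field_derivative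
      (poly (pderiv p) 0 * poly q 0 - poly p 0 * poly (pderiv q) 0) / (poly q 0 * poly q 0)) (at 0)"
    using q0 by (intro DERIV_divide poly_DERIV)
  moreover have "eventually (\<lambda>s. poly p s / poly q s = f (chart_point (axis e s))) (nhds 0)"
    using poly_nz_eventually[OF q0]
  proof eventually_elim
    case (elim s)
    then show ?case using ab(4)[of "chart_point (axis e s)"] p q by (simp add: chart_def)
  qed
  ultimately have "((\<lambda>s. f (chart_point (axis e s))) has_field_derivative
      (poly (pderiv p) 0 * poly q 0 - poly p 0 * poly (pderiv q) 0) / (poly q 0 * poly q 0)) (at 0)"
    by (subst (asm) DERIV_cong_ev[OF refl _ refl]) auto
  then show ?thesis using axis_deriv_eq[OF assms] by metis
qed

text \<open>A function that vanishes on Y in a Zariski neighbourhood of the origin vanishes on the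
  axis wherever some polynomial with nonzero value at 0 does not vanish, hence for all s near 0 in
  the usual topology.\<close>

lemma axis_deriv_tangent:
  assumes Y: "\<And>s. chart_point (axis e s) \<in> Y"
  shows "axis_deriv e \<in> tangent_space n Y origin"
  unfolding tangent_space_def
proof (rule CollectI, intro conjI allI ballI impI)
  fix f assume "f \<notin> local_functions n origin"
  then show "axis_deriv e f = 0" by (simp add: axis_deriv_def)
next
  fix f g assume fg: "f \<in> local_functions n origin" "g \<in> local_functions n origin"
  note d = axis_deriv_exists[OF fg(1), of e] axis_deriv_exists[OF fg(2), of e]
  show "axis_deriv e (\<lambda>q. f q + g q) = axis_deriv e f + axis_deriv e g"
    by (intro axis_deriv_eq local_functions_add fg DERIV_add d)
  have "axis_deriv e (\<lambda>q. f q * g q) = axis_deriv e f * g (chart_point (axis e 0)) + axis_deriv e g * f (chart_point (axis e 0))"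
    by (intro axis_deriv_eq local_functions_mult fg DERIV_mult d)
  then show "axis_deriv e (\<lambda>q. f q * g q) = f origin * axis_deriv e g + g origin * axis_deriv e f"
    by simp
next
  fix c f assume f: "f \<in> local_functions n origin"
  show "axis_deriv e (\<lambda>q. c * f q) = c * axis_deriv e f"
    by (intro axis_deriv_eq local_functions_mult local_functions_const f DERIV_cmult axis_deriv_exists)
next
  fix f assume f: "f \<in> local_functions n origin"
    and "\<exists>U. openin (flag_topology n) U \<and> origin \<in> U \<and> (\<forall>q \<in> U \<inter> Y. f q = 0)"
  then obtain U where U: "openin (flag_topology n) U" "origin \<in> U" "\<forall>q \<in> U \<inter> Y. f q = 0" by blast
  obtain p where p: "poly p 0 \<noteq> 0" "\<forall>s. poly p s \<noteq> 0 \<longrightarrow> chart_mat (axis e s) \<in> carrier (GL n) \<longrightarrow> flag n (chart_mat (axis e s)) \<in> U"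
    using open_flag_curve[of n "\<lambda>s. chart_mat (axis e s)" U 0] axis_mat_poly U by (auto simp: chart_point_def)
  have "eventually (\<lambda>s. 0 = f (chart_point (axis e s))) (nhds 0)"
    using poly_nz_eventually[OF p(1)]
  proof eventually_elim
    case (elim s)
    then show ?case using p(2) U(3) Y[of s] by (auto simp: chart_point_def)
  qed
  then have "((\<lambda>s. f (chart_point (axis e s))) has_field_derivative 0) (at 0)"
    using DERIV_const[of 0 "at 0"] by (subst (asm) DERIV_cong_ev[OF refl _ refl]) auto
  then show "axis_deriv e f = 0" by (intro axis_deriv_eq f)
qed

definition coord :: "nat \<times> nat \<Rightarrow> complex mat set \<Rightarrow> complex" where
  "coord e q = rep q $$ (v (snd e), fst e)"

lemma coord_local: "fst e < n \<Longrightarrow> snd e < n \<Longrightarrow> coord e \<in> local_functions n origin"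
  unfolding coord_def[abs_def] by (rule local_functions_rep[OF poly_funs.entry]) auto

lemma coord_chart_point: "i < j \<Longrightarrow> j < n \<Longrightarrow> coord (i, j) (chart_point c) = c i j"
  by (simp add: coord_def chart_mat_entry)

lemma axis_deriv_coord:
  assumes "i < j" "j < n"
  shows "axis_deriv e (coord (i, j)) = (if e = (i, j) then 1 else 0)"
proof (rule axis_deriv_eq)
  show "coord (i, j) \<in> local_functions n origin" using assms by (intro coord_local) auto
  have "(\<lambda>s. coord (i, j) (chart_point (axis e s))) = (\<lambda>s. if e = (i, j) then s else 0)"
    using assms by (auto simp: coord_chart_point axis_def)
  then show "((\<lambda>s. coord (i, j) (chart_point (axis e s))) has_field_derivative (if e = (i, j) then 1 else 0)) (at 0)"
    by simp
qed

lemma chart_point_in_orbit: "chart_point c \<in> torus_orbit n (chart_point c)"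
  unfolding torus_orbit_chart_point by (rule CollectI, rule exI[of _ "\<lambda>_. 1"]) (simp add: scale_def)

lemma origin_in_orbit_closure: "origin \<in> zariski_closure n (torus_orbit n (chart_point c))"
proof -
  have "torus_orbit n origin \<subseteq> zariski_closure n (torus_orbit n (chart_point c))"
    \<comment> \<open>Positions as weights increase strictly from i to j, so this subgroup contracts
      every coordinate to 0.\<close>
    by (rule torus_limit[where \<mu> = int]) auto
  then show ?thesis using chart_point_in_orbit by blast
qed

end

text \<open>Genericity of the orbit enters only through the support of the coordinates, which
  consists exactly of the inversions.\<close>

locale generic_point = perm_chart +
  fixes \<xi> :: "nat \<Rightarrow> nat \<Rightarrow> complex"
  assumes \<xi>_nz: "\<And>i j. i < j \<Longrightarrow> j < n \<Longrightarrow> \<xi> i j \<noteq> 0 \<longleftrightarrow> v j < v i"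
begin

definition orbit_closure :: "complex mat set set" where
  "orbit_closure = zariski_closure n (torus_orbit n (chart_point \<xi>))"

text \<open>Nonvanishing at a point of the chart is an open condition, so identities on the orbit
  closure need to be checked on torus translates only.\<close>

lemma orbit_closure_vanish:
  assumes h: "h \<in> poly_funs n" "\<And>\<tau>. (\<And>k. \<tau> k \<noteq> 0) \<Longrightarrow> h (chart_mat (scale \<tau> \<xi>)) = 0"
    and q: "q \<in> orbit_closure" "q \<in> chart"
  shows "h (rep q) = 0"
proof (rule ccontr)
  assume "h (rep q) \<noteq> 0"
  then have "q \<in> {q \<in> chart. h (rep q) \<noteq> 0}" using q by simp
  moreover have "\<forall>T. q \<in> T \<and> openin (flag_topology n) T \<longrightarrow> (\<exists>y. y \<in> torus_orbit n (chart_point \<xi>) \<and> y \<in> T)"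
    using q(1) by (simp add: orbit_closure_def in_closure_of)
  ultimately have "\<exists>y. y \<in> torus_orbit n (chart_point \<xi>) \<and> y \<in> {q \<in> chart. h (rep q) \<noteq> 0}"
    using openin_chart_nonzero[OF h(1)] by (elim allE[of _ "{q \<in> chart. h (rep q) \<noteq> 0}"]) simp
  then obtain \<tau> where "\<forall>k. \<tau> k \<noteq> 0" "h (rep (chart_point (scale \<tau> \<xi>))) \<noteq> 0"
    unfolding torus_orbit_chart_point by auto
  then show False using h(2)[of \<tau>] by simp
qed

text \<open>Contracting the cover \<open>(i, j)\<close> of the inversion order leaves an acyclic order, and the weight
  below is a linear extension of it.\<close>

lemma axis_in_closure:
  assumes e: "(i, j) \<in> covers"
  shows "chart_point (axis (i, j) s) \<in> orbit_closure"
proof (cases "s = 0")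
  case True
  then show ?thesis using origin_in_orbit_closure by (simp add: orbit_closure_def)
next
  case False
  have ij: "i < j" "j < n" "v j < v i" and
    cov: "\<And>k. i < k \<Longrightarrow> k < j \<Longrightarrow> v j < v k \<Longrightarrow> v k < v i \<Longrightarrow> False"
    using e by (auto simp: covers_def)
  define lt where "lt a b \<longleftrightarrow> a < b \<and> v b < v a" for a b
  \<comment> \<open>Bands of weights: positions below i or j keep k < n, the contracted pair sits at
    n + 1, unrelated positions get n + 1 + k \<le> 2 n, and positions above i or j start at 2 n + 2.
    Inside a band k increases along \<open>lt\<close>. An unrelated position 0 shares the weight n +
    1, but it is comparable with neither i nor j.\<close>
  define \<mu> where "\<mu> k = int (if k = i \<or> k = j then n + 1 else if lt i k \<or> lt j k then 2 * n + 2 + k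
    else if lt k i \<or> lt k j then k else n + 1 + k)" for k
  have mono: "\<mu> a \<le> \<mu> b \<and> (\<mu> a = \<mu> b \<longleftrightarrow> (a, b) = (i, j))" if ab: "a < b" "b < n" "lt a b" for a b
  proof -
    \<comment> \<open>Here the cover condition enters: no position is both above i and below j, so
      no position belongs to two bands.\<close>
    have no: False if "lt i k" "lt k j" for k using that cov by (auto simp: lt_def)
    have tr: "lt x z" if "lt x y" "lt y z" for x y z using that by (auto simp: lt_def)
    have lij: "lt i j" using ij by (simp add: lt_def)
    have as: "\<not> lt x y" if "lt y x" for x y using that by (auto simp: lt_def)
    have ir: "\<not> lt x x" for x by (auto simp: lt_def)
    consider "a = i \<and> b = j" | "a = j \<and> b = i" | "(a = i \<or> a = j) \<and> b \<noteq> i \<and> b \<noteq> j"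
      | "a \<noteq> i \<and> a \<noteq> j \<and> (b = i \<or> b = j)" | "a \<noteq> i \<and> a \<noteq> j \<and> b \<noteq> i \<and> b \<noteq> j"
      using less_imp_neq[OF ab(1)] by blast
    then show ?thesis
    proof cases
      case 1
      then show ?thesis by (simp add: \<mu>_def)
    next
      case 2
      then show ?thesis using ab ij by simp
    next
      case 3
      then show ?thesis using ab ij by (auto simp: \<mu>_def)
    next
      case 4
      have "\<not> lt i a" "\<not> lt j a" using 4 ab no tr as lij ir by metis+
      then show ?thesis using 4 ab ij by (auto simp: \<mu>_def)
    next
      case 5
      have u: "lt i b \<or> lt j b" if "lt i a \<or> lt j a" using that ab tr by blast
      have d: "lt a i \<or> lt a j" if "lt b i \<or> lt b j" using that ab tr by blast
      consider "lt i a \<or> lt j a" | "\<not> (lt i a \<or> lt j a)" "lt a i \<or> lt a j"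
        | "\<not> (lt i a \<or> lt j a)" "\<not> (lt a i \<or> lt a j)" by blast
      then show ?thesis
      proof cases
        case 1
        then show ?thesis using 5 ab u by (simp add: \<mu>_def)
      next
        case 2
        then show ?thesis using 5 ab by (simp add: \<mu>_def)
      next
        case 3
        then have "\<not> (lt b i \<or> lt b j)" using d by blast
        then show ?thesis using 5 3 ab by (simp add: \<mu>_def)
      qed
    qed
  qed
  have "torus_orbit n (chart_point (axis (i, j) (\<xi> i j))) \<subseteq> orbit_closure" unfolding orbit_closure_def
  proof (rule torus_limit[where \<mu> = \<mu>])
    fix a b assume ab: "a < b" "b < n"
    show "\<mu> a \<le> \<mu> b" if "\<xi> a b \<noteq> 0"
      using mono[of a b] ab that \<xi>_nz[of a b] by (simp add: lt_def)
    show "axis (i, j) (\<xi> i j) a b = (if \<mu> a = \<mu> b then \<xi> a b else 0)"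
      using mono[of a b] ab \<xi>_nz[of a b] by (cases "\<xi> a b = 0") (auto simp: axis_def lt_def)
  qed
  moreover have "chart_point (axis (i, j) s) \<in> torus_orbit n (chart_point (axis (i, j) (\<xi> i j)))"
    unfolding torus_orbit_chart_point
  proof (rule CollectI, rule exI[of _ "\<lambda>k. if k = j then s / \<xi> i j else 1"], intro conjI)
    have nz: "\<xi> i j \<noteq> 0" using \<xi>_nz ij by simp
    then show "\<forall>k. (if k = j then s / \<xi> i j else 1) \<noteq> 0" using False by simp
    have "scale (\<lambda>k. if k = j then s / \<xi> i j else 1) (axis (i, j) (\<xi> i j)) = axis (i, j) s"
      using nz ij by (auto simp: scale_def axis_def fun_eq_iff)
    then show "chart_point (axis (i, j) s) = chart_point (scale (\<lambda>k. if k = j then s / \<xi> i j else 1) (axis (i, j) (\<xi> i j)))"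
      by simp
  qed
  ultimately show ?thesis by blast
qed

lemma tangent_cong:
  assumes D: "D \<in> tangent_space n orbit_closure origin"
    and fg: "f \<in> local_functions n origin" "g \<in> local_functions n origin"
    and U: "openin (flag_topology n) U" "origin \<in> U" "\<And>q. q \<in> U \<Longrightarrow> q \<in> orbit_closure \<Longrightarrow> f q = g q"
  shows "D f = D g"
proof -
  have g': "(\<lambda>q. - 1 * g q) \<in> local_functions n origin"
    by (intro local_functions_mult local_functions_const fg)
  have "D (\<lambda>q. f q + - 1 * g q) = 0"
    by (rule tangent_vanish[OF D local_functions_add[OF fg(1) g'] U(1,2)]) (simp add: U(3))
  moreover have "D (\<lambda>q. f q + - 1 * g q) = D f + - 1 * D g"
    using tangent_add[OF D fg(1) g'] tangent_cmult[OF D fg(2), of "- 1"] by simp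
  ultimately show ?thesis by simp
qed

lemma tangent_const:
  assumes D: "D \<in> tangent_space n orbit_closure origin"
  shows "D (\<lambda>_. c) = 0"
proof -
  have "D (\<lambda>_. 1) = 0"
    using tangent_mult[OF D local_functions_const[of 1] local_functions_const[of 1]] by simp
  then show ?thesis using tangent_cmult[OF D local_functions_const[of 1], of c] by simp
qed

lemma tangent_coord:
  assumes D: "D \<in> tangent_space n orbit_closure origin" and z: "\<And>e. e \<in> covers \<Longrightarrow> D (coord e) = 0"
    and ij: "i < j" "j < n"
  shows "D (coord (i, j)) = 0"
proof -
  have l: "coord (a, b) \<in> local_functions n origin" if "a < n" "b < n" for a b
    using that coord_local by simp
  consider "v i < v j" | "(i, j) \<in> covers" | "v j < v i" "(i, j) \<notin> covers"
    using v_eq[of i j] ij by linarith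
  then show ?thesis
  proof cases
    case 1
    have "D (coord (i, j)) = D (\<lambda>_. 0)"
    proof (rule tangent_cong[OF D l local_functions_const openin_chart origin_in_chart])
      fix q assume q: "q \<in> chart" "q \<in> orbit_closure"
      have "rep q $$ (v j, i) = 0"
      proof (rule orbit_closure_vanish[OF _ _ q(2,1), where h = "\<lambda>A. A $$ (v j, i)"])
        show "(\<lambda>A. A $$ (v j, i)) \<in> poly_funs n" using ij by (intro poly_funs.entry) auto
        show "chart_mat (scale \<tau> \<xi>) $$ (v j, i) = 0" for \<tau>
          using ij 1 \<xi>_nz[of i j] by (simp add: chart_mat_entry scale_def)
      qed
      then show "coord (i, j) q = 0" by (simp add: coord_def)
    qed (use ij in auto)
    then show ?thesis by (simp add: tangent_const[OF D])
  next
    case 2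
    then show ?thesis by (rule z)
  next
    case 3
    then obtain k where k: "i < k" "k < j" "v j < v k" "v k < v i"
      using ij by (auto simp: covers_def)
    have kn: "k < n" "i < n" using k ij by auto
    \<comment> \<open>The characters of (i, k) and (k, j) multiply to that of (i, j), so this
      quotient of coordinates is constant on the orbit; c is its value at the base point.\<close>
    define c where "c = \<xi> i j / (\<xi> i k * \<xi> k j)"
    have nz: "\<xi> i k \<noteq> 0" "\<xi> k j \<noteq> 0" using \<xi>_nz[of i k] \<xi>_nz[of k j] k ij by auto
    let ?g = "\<lambda>q. coord (i, k) q * coord (k, j) q"
    have gl: "?g \<in> local_functions n origin" using kn ij by (intro local_functions_mult l) auto
    have "D (coord (i, j)) = D (\<lambda>q. c * ?g q)"
    proof (rule tangent_cong[OF D l _ openin_chart origin_in_chart])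
      show "(\<lambda>q. c * ?g q) \<in> local_functions n origin"
        by (rule local_functions_mult[OF local_functions_const gl])
      fix q assume q: "q \<in> chart" "q \<in> orbit_closure"
      let ?h = "\<lambda>A. A $$ (v j, i) + - c * (A $$ (v k, i) * A $$ (v j, k))"
      have "?h (rep q) = 0"
      proof (rule orbit_closure_vanish[OF _ _ q(2,1)])
        show "?h \<in> poly_funs n"
          using ij kn by (intro poly_funs.add poly_funs.mult poly_funs.const poly_funs.entry) auto
        fix \<tau> :: "nat \<Rightarrow> complex" assume "\<And>k. \<tau> k \<noteq> 0"
        then show "?h (chart_mat (scale \<tau> \<xi>)) = 0"
          using ij kn k nz by (simp add: chart_mat_entry scale_def c_def)
      qed
      then show "coord (i, j) q = c * ?g q" by (simp add: coord_def)
    qed (use ij in auto)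
    also have "\<dots> = c * D ?g" by (rule tangent_cmult[OF D gl])
    \<comment> \<open>By the Leibniz rule, since both factors vanish at the origin.\<close>
    also have "D ?g = 0"
      using tangent_mult[OF D, of "coord (i, k)" "coord (k, j)"] l kn ij k by (simp add: coord_chart_point)
    finally show ?thesis by simp
  qed
qed

lemma tangent_rep:
  assumes D: "D \<in> tangent_space n orbit_closure origin" and z: "\<And>e. e \<in> covers \<Longrightarrow> D (coord e) = 0"
    and "h \<in> poly_funs n"
  shows "D (\<lambda>q. h (rep q)) = 0"
  using assms(3)
proof induction
  case (const c)
  then show ?case by (rule tangent_const[OF D])
next
  case (entry r k)
  have l: "(\<lambda>q. rep q $$ (r, k)) \<in> local_functions n origin"
    by (rule local_functions_rep[OF poly_funs.entry[OF entry]])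
  show ?case
  proof (cases "k < pos r")
    case True
    then show ?thesis using tangent_coord[OF D z True] entry by (simp add: coord_def[abs_def])
  next
    case False
    have "D (\<lambda>q. rep q $$ (r, k)) = D (\<lambda>_. if pos r = k then 1 else 0)"
      by (rule tangent_cong[OF D l local_functions_const openin_chart origin_in_chart])
         (use False entry in \<open>auto simp: chart_def chart_mat_def\<close>)
    then show ?thesis using tangent_const[OF D] by simp
  qed
next
  case (add f g)
  then show ?case using tangent_add[OF D local_functions_rep local_functions_rep, of f g] by simp
next
  case (mult f g)
  then show ?case using tangent_mult[OF D local_functions_rep local_functions_rep, of f g] by simp
qed

text \<open>Near the origin f = a / b with a and b polynomial in the coordinates. The Leibniz rule
  for f b = a expresses D f through D a and D b, which vanish, and b is nonzero at the
  origin.\<close>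

lemma tangent_determined:
  assumes D: "D \<in> tangent_space n orbit_closure origin" and z: "\<And>e. e \<in> covers \<Longrightarrow> D (coord e) = 0"
  shows "D = 0"
proof (rule ext)
  fix f show "D f = 0 f"
  proof (cases "f \<in> local_functions n origin")
    case True
    obtain a b where ab: "a \<in> poly_funs n" "b \<in> poly_funs n" "b (chart_mat (\<lambda>_ _. 0)) \<noteq> 0"
      "\<And>q. q \<in> chart \<Longrightarrow> b (rep q) \<noteq> 0 \<Longrightarrow> f q = a (rep q) / b (rep q)"
      using local_function_quotient[OF True] by blast
    note l = local_functions_rep[OF ab(1)] local_functions_rep[OF ab(2)]
    have "D (\<lambda>q. f q * b (rep q)) = D (\<lambda>q. a (rep q))"
      by (rule tangent_cong[OF D local_functions_mult[OF True l(2)] l(1) openin_chart_nonzero[OF ab(2)]])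
         (use ab origin_in_chart in auto)
    then have "f origin * D (\<lambda>q. b (rep q)) + b (rep origin) * D f = 0"
      using tangent_mult[OF D True l(2)] tangent_rep[OF D z ab(1)] by simp
    then show ?thesis using tangent_rep[OF D z ab(2)] ab(3) by simp
  qed (use tangent_outside[OF D] in simp)
qed

text \<open>The axis derivatives are dual to the cover coordinates, hence independent. Subtracting
  from D their combination with coefficients \<open>D (coord e)\<close> leaves a tangent vector that
  kills all cover coordinates, hence 0.\<close>

theorem tangent_dim_orbit_closure: "tangent_dim n orbit_closure origin = card covers"
  unfolding tangent_dim_def
proof (rule fun_space.dim_unique)
  let ?T = "tangent_space n orbit_closure origin"
  have coord: "axis_deriv e (coord e') = (if e = e' then 1 else 0)" if "e' \<in> covers" for e e'
    using that axis_deriv_coord[of "fst e'" "snd e'" e] by (auto simp: covers_def)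
  show sub: "axis_deriv ` covers \<subseteq> ?T"
    using axis_in_closure by (auto intro!: axis_deriv_tangent)
  have inj: "inj_on axis_deriv covers"
  proof (rule inj_onI)
    fix e e' assume e: "e \<in> covers" "e' \<in> covers" "axis_deriv e = axis_deriv e'"
    then show "e = e'" using coord[of e' e] coord[of e' e'] by (auto split: if_splits)
  qed
  then show "card (axis_deriv ` covers) = card covers" by (rule card_image)
  have lin: "\<forall>x\<in>axis_deriv ` covers. u x = 0" if u: "(\<Sum>x\<in>axis_deriv ` covers. (\<lambda>f. u x * x f)) = 0" for u
  proof (rule ballI)
    fix x assume "x \<in> axis_deriv ` covers"
    then obtain e where e: "e \<in> covers" "x = axis_deriv e" by blast
    have "0 = (\<Sum>x\<in>axis_deriv ` covers. (\<lambda>f. u x * x f)) (coord e)" by (simp add: u)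
    also have "\<dots> = (\<Sum>e'\<in>covers. u (axis_deriv e') * axis_deriv e' (coord e))"
      by (simp add: sum_fun_apply sum.reindex[OF inj])
    also have "\<dots> = (\<Sum>e'\<in>covers. if e' = e then u x else 0)"
    proof (rule sum.cong[OF refl])
      fix e' show "u (axis_deriv e') * axis_deriv e' (coord e) = (if e' = e then u x else 0)"
        by (cases "e' = e") (simp_all add: coord[OF e(1)] e(2))
    qed
    also have "\<dots> = u x" using e(1) finite_covers by simp
    finally show "u x = 0" by (rule sym)
  qed
  show "fun_space.independent (axis_deriv ` covers)"
    by (rule fun_space.independent_if_scalars_zero, simp add: finite_covers, drule lin, erule (1) bspec)
  show "?T \<subseteq> fun_space.span (axis_deriv ` covers)"
  proof
    fix D assume D: "D \<in> ?T"
    define E where "E = (\<Sum>e\<in>covers. (\<lambda>f. D (coord e) * axis_deriv e f))"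
    have E: "E \<in> ?T" unfolding E_def
      using sub by (intro fun_space.subspace_sum[OF subspace_tangent_space]
        fun_space.subspace_scale[OF subspace_tangent_space]) auto
    have "D - E = 0"
    proof (rule tangent_determined)
      show "D - E \<in> ?T" by (rule fun_space.subspace_diff[OF subspace_tangent_space D E])
      fix e assume e: "e \<in> covers"
      have "E (coord e) = (\<Sum>e'\<in>covers. D (coord e') * axis_deriv e' (coord e))"
        unfolding E_def by (simp add: sum_fun_apply)
      also have "\<dots> = (\<Sum>e'\<in>covers. if e' = e then D (coord e) else 0)"
      proof (rule sum.cong[OF refl])
        fix e' show "D (coord e') * axis_deriv e' (coord e) = (if e' = e then D (coord e) else 0)"
          by (cases "e' = e") (simp_all add: coord[OF e])
      qed
      also have "\<dots> = D (coord e)" using e finite_covers by simp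
      finally show "(D - E) (coord e) = 0" by simp
    qed
    moreover have "E \<in> fun_space.span (axis_deriv ` covers)" unfolding E_def
      by (rule fun_space.span_sum, rule fun_space.span_scale, rule fun_space.span_base, rule imageI)
    ultimately show "D \<in> fun_space.span (axis_deriv ` covers)" by simp
  qed
qed

end

section \<open>Bridges and potentials\<close>

definition sym_conn :: "('a \<times> 'a) set \<Rightarrow> ('a \<times> 'a) set" where
  "sym_conn F = (F \<union> F\<inverse>)\<^sup>*"

lemma sym_conn_mono: "F \<subseteq> F' \<Longrightarrow> sym_conn F \<subseteq> sym_conn F'"
  unfolding sym_conn_def by (rule rtrancl_mono) blast

lemma sym_conn_sym: "(a, b) \<in> sym_conn F \<Longrightarrow> (b, a) \<in> sym_conn F"
  unfolding sym_conn_def by (rule symD[OF sym_rtrancl]) (auto intro: symI)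

lemma sym_conn_trans: "(a, b) \<in> sym_conn F \<Longrightarrow> (b, c) \<in> sym_conn F \<Longrightarrow> (a, c) \<in> sym_conn F"
  unfolding sym_conn_def by (rule rtrancl_trans)

lemma sym_conn_edge: "(a, b) \<in> F \<Longrightarrow> (a, b) \<in> sym_conn F"
  unfolding sym_conn_def by blast

text \<open>For edges without loops and antiparallel pairs this says that the graph is a forest. In
  this form a violation directly names an edge whose removal keeps its ends connected.\<close>

definition bridges_only :: "('a \<times> 'a) set \<Rightarrow> bool" where
  "bridges_only E \<longleftrightarrow> (\<forall>e\<in>E. e \<notin> sym_conn (E - {e}))"

text \<open>A bridge (a, b) joins two components of the remaining graph. Adding a constant to the
  potential on the component of b corrects the value on the bridge and changes no other
  difference.\<close>

lemma bridges_only_potential: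
  fixes y :: "'a \<times> 'a \<Rightarrow> int"
  assumes "finite E" "bridges_only E"
  shows "\<exists>\<mu>. \<forall>(a, b)\<in>E. \<mu> b - \<mu> a = y (a, b)"
  using assms
proof (induction E rule: finite_induct)
  case (insert e E)
  obtain a b where e: "e = (a, b)" by fastforce
  have "bridges_only E"
    unfolding bridges_only_def
  proof
    fix d assume "d \<in> E"
    then have "d \<notin> sym_conn (insert e E - {d})" using insert.prems by (simp add: bridges_only_def)
    moreover have "sym_conn (E - {d}) \<subseteq> sym_conn (insert e E - {d})" by (rule sym_conn_mono) blast
    ultimately show "d \<notin> sym_conn (E - {d})" by blast
  qed
  then obtain \<mu> where \<mu>: "\<forall>(a, b)\<in>E. \<mu> b - \<mu> a = y (a, b)" using insert.IH by blast
  have ab: "(a, b) \<notin> sym_conn E"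
    using insert.prems insert.hyps(2) by (simp add: bridges_only_def e)
  define \<nu> where "\<nu> x = \<mu> x + (if (b, x) \<in> sym_conn E then y (a, b) - (\<mu> b - \<mu> a) else 0)" for x
  have "\<nu> d - \<nu> c = y (c, d)" if cd: "(c, d) \<in> E" for c d
  proof -
    have "(b, c) \<in> sym_conn E \<longleftrightarrow> (b, d) \<in> sym_conn E"
      using sym_conn_trans[of b c E d] sym_conn_trans[of b d E c] sym_conn_edge[OF cd]
        sym_conn_sym[OF sym_conn_edge[OF cd]] by blast
    moreover have "\<mu> d - \<mu> c = y (c, d)" using \<mu> cd by auto
    ultimately show ?thesis by (simp add: \<nu>_def)
  qed
  moreover have "\<nu> b - \<nu> a = y (a, b)"
  proof -
    have "(b, a) \<notin> sym_conn E" using ab sym_conn_sym[of b a E] by blast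
    moreover have "(b, b) \<in> sym_conn E" by (simp add: sym_conn_def)
    ultimately show ?thesis by (simp add: \<nu>_def)
  qed
  ultimately show ?case by (intro exI[of _ \<nu>]) (auto simp: e)
qed simp

lemma sym_conn_image:
  assumes "inj \<phi>"
  shows "(\<phi> a, \<phi> b) \<in> sym_conn (map_prod \<phi> \<phi> ` F) \<longleftrightarrow> (a, b) \<in> sym_conn F"
proof
  assume "(a, b) \<in> sym_conn F"
  then show "(\<phi> a, \<phi> b) \<in> sym_conn (map_prod \<phi> \<phi> ` F)"
    unfolding sym_conn_def
  proof induction
    case (step y z)
    then have "(\<phi> y, \<phi> z) \<in> map_prod \<phi> \<phi> ` F \<union> (map_prod \<phi> \<phi> ` F)\<inverse>" by force
    then show ?case using step by (meson rtrancl.rtrancl_into_rtrancl)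
  qed simp
next
  have "\<exists>x. z = \<phi> x \<and> (a, x) \<in> sym_conn F" if "(\<phi> a, z) \<in> sym_conn (map_prod \<phi> \<phi> ` F)" for z
    using that unfolding sym_conn_def
  proof induction
    case (step y z)
    then obtain x where x: "y = \<phi> x" "(a, x) \<in> (F \<union> F\<inverse>)\<^sup>*" by blast
    with step(2) obtain x' where "z = \<phi> x'" "(x, x') \<in> F \<union> F\<inverse>"
      using injD[OF assms] by auto
    then show ?case using rtrancl.rtrancl_into_rtrancl[OF x(2)] by blast
  qed auto
  then show "(\<phi> a, \<phi> b) \<in> sym_conn (map_prod \<phi> \<phi> ` F) \<Longrightarrow> (a, b) \<in> sym_conn F"
    using injD[OF assms] by blast
qed

lemma bridges_only_image:
  assumes "inj \<phi>"
  shows "bridges_only (map_prod \<phi> \<phi> ` E) \<longleftrightarrow> bridges_only E"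
proof -
  have inj: "inj (map_prod \<phi> \<phi>)" by (rule prod.inj_map[OF assms assms])
  have "map_prod \<phi> \<phi> e \<in> sym_conn (map_prod \<phi> \<phi> ` E - {map_prod \<phi> \<phi> e}) \<longleftrightarrow> e \<in> sym_conn (E - {e})" for e
  proof -
    have "map_prod \<phi> \<phi> ` E - {map_prod \<phi> \<phi> e} = map_prod \<phi> \<phi> ` (E - {e})"
      using image_set_diff[OF inj, of E "{e}"] by simp
    then show ?thesis using sym_conn_image[OF assms, of "fst e" "snd e" "E - {e}"]
      by (simp add: map_prod_def split_beta)
  qed
  then show ?thesis unfolding bridges_only_def by (simp only: ball_simps)
qed

section \<open>The local dimension\<close>

lemma linear_dependence:
  fixes u :: "nat \<Rightarrow> 'b \<Rightarrow> complex"
  assumes B: "finite B" "card B < N" and u: "\<And>k. k < N \<Longrightarrow> u k \<in> fun_space.span B"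
  shows "\<exists>c. (\<exists>k<N. c k \<noteq> 0) \<and> (\<forall>x. (\<Sum>k<N. c k * u k x) = 0)"
proof (cases "inj_on u {..<N}")
  case True
  have "fun_space.dependent (u ` {..<N})"
  proof (rule ccontr)
    assume "fun_space.independent (u ` {..<N})"
    then have "card (u ` {..<N}) \<le> card B"
      using fun_space.independent_span_bound[OF B(1), of "u ` {..<N}"] u by auto
    then show False using B(2) True by (simp add: card_image)
  qed
  then obtain r where r: "\<exists>g\<in>u ` {..<N}. r g \<noteq> 0" "(\<Sum>g\<in>u ` {..<N}. (\<lambda>x. r g * g x)) = 0"
    by (subst (asm) fun_space.dependent_finite) auto
  have "(\<Sum>k<N. r (u k) * u k x) = 0" for x
  proof -
    have "(\<Sum>k<N. r (u k) * u k x) = (\<Sum>g\<in>u ` {..<N}. (\<lambda>x. r g * g x)) x"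
      by (simp add: sum_fun_apply sum.reindex[OF True])
    then show ?thesis by (simp add: r(2))
  qed
  then show ?thesis using r(1) by (intro exI[of _ "\<lambda>k. r (u k)"]) auto
next
  case False
  then obtain k l where kl: "k < N" "l < N" "k \<noteq> l" "u k = u l" by (auto simp: inj_on_def)
  \<comment> \<open>Independence speaks of sets, so a family with a repetition is treated apart,
    with the coefficients 1 and -1 at the two equal members.\<close>
  let ?c = "\<lambda>i. (if i = k then 1 else 0) + (if i = l then - 1 else 0 :: complex)"
  have "(\<Sum>i<N. ?c i * u i x) = 0" for x
  proof -
    have "(\<Sum>i<N. ?c i * u i x) = (\<Sum>i<N. (if i = k then u k x else 0) + (if i = l then - u l x else 0))"
      by (intro sum.cong) auto
    also have "\<dots> = u k x - u l x" using kl by (simp add: sum.distrib)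
    finally show ?thesis using kl by simp
  qed
  moreover have "?c k \<noteq> 0" using kl by simp
  then have "\<exists>k<N. ?c k \<noteq> 0" using kl(1) by (intro exI[of _ k] conjI)
  ultimately show ?thesis by (intro exI[of _ ?c] conjI allI)
qed

text \<open>Zeros are replaced by 1, which makes the characters total. Functions on the torus can
  then live in the full function space on all \<tau>.\<close>

definition nz :: "('a \<Rightarrow> complex) \<Rightarrow> 'a \<Rightarrow> complex" where
  "nz \<tau> k = (if \<tau> k = 0 then 1 else \<tau> k)"

lemma nz_nonzero [simp]: "nz \<tau> k \<noteq> 0"
  by (simp add: nz_def)

lemma nz_eq: "(\<And>k. \<tau> k \<noteq> 0) \<Longrightarrow> nz \<tau> = \<tau>"
  by (auto simp: nz_def fun_eq_iff)

definition laurent_mono :: "('a \<times> 'a) set \<Rightarrow> ('a \<times> 'a \<Rightarrow> int) \<Rightarrow> ('a \<Rightarrow> complex) \<Rightarrow> complex" where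
  "laurent_mono F e \<tau> = (\<Prod>x\<in>F. (nz \<tau> (snd x) / nz \<tau> (fst x)) powi e x)"

definition laurent_space :: "('a \<times> 'a) set \<Rightarrow> nat \<Rightarrow> (('a \<Rightarrow> complex) \<Rightarrow> complex) set" where
  "laurent_space F d = fun_space.span (laurent_mono F ` {e. \<forall>x\<in>F. \<bar>e x\<bar> \<le> int d})"

text \<open>A monomial depends on its exponents on \<open>F\<close> only, and each of these takes
  one of 2 d + 1 values.\<close>

lemma laurent_monos_bound:
  assumes "finite F"
  shows "finite (laurent_mono F ` {e. \<forall>x\<in>F. \<bar>e x\<bar> \<le> int d})" (is "finite ?M")
    and "card (laurent_mono F ` {e. \<forall>x\<in>F. \<bar>e x\<bar> \<le> int d}) \<le> (2 * d + 1) ^ card F"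
proof -
  let ?P = "PiE F (\<lambda>_. {- int d..int d})"
  have sub: "?M \<subseteq> laurent_mono F ` ?P"
  proof
    fix g assume "g \<in> ?M"
    then obtain e where e: "\<forall>x\<in>F. \<bar>e x\<bar> \<le> int d" "g = laurent_mono F e" by auto
    then have "restrict e F \<in> ?P" by (auto simp: abs_le_iff)
    moreover have "g = laurent_mono F (restrict e F)"
      unfolding e(2) laurent_mono_def[abs_def] by (intro ext prod.cong) auto
    ultimately show "g \<in> laurent_mono F ` ?P" by blast
  qed
  have P: "finite ?P" "card ?P = (2 * d + 1) ^ card F"
    using assms by (auto simp: finite_PiE card_PiE nat_add_distrib nat_mult_distrib)
  show "finite ?M" using sub P(1) finite_surj by blast
  have "card ?M \<le> card (laurent_mono F ` ?P)" by (rule card_mono) (use sub P in auto)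
  also have "\<dots> \<le> card ?P" by (rule card_image_le[OF P(1)])
  finally show "card ?M \<le> (2 * d + 1) ^ card F" by (simp add: P(2))
qed

lemma laurent_mono_in: "(\<And>x. x \<in> F \<Longrightarrow> \<bar>e x\<bar> \<le> int d) \<Longrightarrow> laurent_mono F e \<in> laurent_space F d"
  unfolding laurent_space_def by (rule fun_space.span_base) auto

lemma laurent_space_mono: "d \<le> d' \<Longrightarrow> laurent_space F d \<subseteq> laurent_space F d'"
  unfolding laurent_space_def by (intro fun_space.span_mono image_mono) force

lemma laurent_const: "(\<lambda>_. c) \<in> laurent_space F d"
proof -
  have "(\<lambda>\<tau>. c * laurent_mono F (\<lambda>_. 0) \<tau>) \<in> laurent_space F d"
    unfolding laurent_space_def
    by (rule fun_space.span_scale, rule laurent_mono_in[unfolded laurent_space_def]) simp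
  then show ?thesis by (simp add: laurent_mono_def)
qed

lemma laurent_scale: "f \<in> laurent_space F d \<Longrightarrow> (\<lambda>\<tau>. c * f \<tau>) \<in> laurent_space F d"
  unfolding laurent_space_def by (rule fun_space.span_scale)

lemma laurent_add:
  "f \<in> laurent_space F d \<Longrightarrow> g \<in> laurent_space F d \<Longrightarrow> (\<lambda>\<tau>. f \<tau> + g \<tau>) \<in> laurent_space F d"
  using fun_space.span_add[of f _ g] unfolding laurent_space_def plus_fun_def by blast

lemma laurent_induct [consumes 1, case_names zero step]:
  assumes "f \<in> laurent_space F d" "P (\<lambda>_. 0)"
    "\<And>c e g. (\<And>x. x \<in> F \<Longrightarrow> \<bar>e x\<bar> \<le> int d) \<Longrightarrow> P g \<Longrightarrow> P (\<lambda>\<tau>. c * laurent_mono F e \<tau> + g \<tau>)"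
  shows "P f"
  using assms(1) unfolding laurent_space_def
proof (rule fun_space.span_induct_alt)
  show "P 0" using assms(2) by (simp add: zero_fun_def)
  fix c h g assume "h \<in> laurent_mono F ` {e. \<forall>x\<in>F. \<bar>e x\<bar> \<le> int d}" "P g"
  then obtain e where "\<forall>x\<in>F. \<bar>e x\<bar> \<le> int d" "h = laurent_mono F e" by auto
  then show "P ((\<lambda>f. c * h f) + g)"
    using assms(3)[of e g c] \<open>P g\<close> by (simp add: plus_fun_def)
qed

lemma laurent_mono_mult:
  "laurent_mono F e \<tau> * laurent_mono F e' \<tau> = laurent_mono F (\<lambda>x. e x + e' x) \<tau>"
  unfolding laurent_mono_def by (simp add: prod.distrib[symmetric] power_int_add)

lemma laurent_mult:
  assumes "f \<in> laurent_space F d" "g \<in> laurent_space F d'"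
  shows "(\<lambda>\<tau>. f \<tau> * g \<tau>) \<in> laurent_space F (d + d')"
  using assms(1)
proof (induction rule: laurent_induct)
  case zero
  then show ?case using laurent_const[of 0] by simp
next
  case (step c e h)
  have "(\<lambda>\<tau>. laurent_mono F e \<tau> * g \<tau>) \<in> laurent_space F (d + d')"
    using assms(2)
  proof (induction rule: laurent_induct)
    case zero
    then show ?case using laurent_const[of 0] by simp
  next
    case (step c' e' k)
    have "laurent_mono F (\<lambda>x. e x + e' x) \<in> laurent_space F (d + d')"
    proof (rule laurent_mono_in)
      fix x assume "x \<in> F"
      then have "\<bar>e x\<bar> \<le> int d" "\<bar>e' x\<bar> \<le> int d'" using \<open>\<And>x. x \<in> F \<Longrightarrow> \<bar>e x\<bar> \<le> int d\<close> step(1) by auto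
      then show "\<bar>e x + e' x\<bar> \<le> int (d + d')" by linarith
    qed
    from laurent_add[OF laurent_scale[OF this, of c'] step(2)] show ?case
      by (simp add: laurent_mono_mult[symmetric] algebra_simps)
  qed
  from laurent_add[OF laurent_scale[OF this, of c] step(2)] show ?case
    by (simp add: algebra_simps)
qed

lemma laurent_power: "f \<in> laurent_space F d \<Longrightarrow> (\<lambda>\<tau>. f \<tau> ^ a) \<in> laurent_space F (a * d)"
  by (induction a) (use laurent_const[of 1] laurent_mult[of f F d] in auto)

text \<open>Telescoping along a path from i to j: an edge of \<open>F\<close> traversed forwards
  raises its exponent by 1, one traversed backwards lowers it.\<close>

lemma connected_exponents:
  assumes "finite F" "(i, j) \<in> sym_conn F"
  shows "\<exists>e. \<forall>\<tau>. nz \<tau> j / nz \<tau> i = laurent_mono F e \<tau>"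
  using assms(2) unfolding sym_conn_def
proof induction
  case base
  show ?case by (rule exI[of _ "\<lambda>_. 0"]) (simp add: laurent_mono_def)
next
  case (step y z)
  then obtain e where e: "\<forall>\<tau>. nz \<tau> y / nz \<tau> i = laurent_mono F e \<tau>" by blast
  have shift: "laurent_mono F (\<lambda>x. e x + (if x = a then s else 0)) \<tau> =
      laurent_mono F e \<tau> * (nz \<tau> (snd a) / nz \<tau> (fst a)) powi s" if "a \<in> F" for a s \<tau>
  proof -
    have "laurent_mono F (\<lambda>x. if x = a then s else 0) \<tau> = (nz \<tau> (snd a) / nz \<tau> (fst a)) powi s"
      unfolding laurent_mono_def using that assms(1) by (subst prod.remove[of _ a]) auto
    then show ?thesis by (simp add: laurent_mono_mult[symmetric])
  qed
  have zi: "nz \<tau> z / nz \<tau> i = nz \<tau> y / nz \<tau> i * (nz \<tau> z / nz \<tau> y)" for \<tau> by simp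
  from step(2) show ?case
  proof
    assume "(y, z) \<in> F"
    from shift[OF this, of 1] show ?thesis
      using e zi by (intro exI[of _ "\<lambda>x. e x + (if x = (y, z) then 1 else 0)"]) simp
  next
    assume "(y, z) \<in> F\<inverse>"
    then have "(z, y) \<in> F" by simp
    from shift[OF this, of "- 1"] show ?thesis
      using e zi by (intro exI[of _ "\<lambda>x. e x + (if x = (z, y) then - 1 else 0)"]) (simp add: power_int_minus)
  qed
qed

lemma notin_closureI: "openin X U \<Longrightarrow> x \<in> U \<Longrightarrow> U \<inter> S = {} \<Longrightarrow> x \<notin> X closure_of S"
  by (auto simp: in_closure_of)

section \<open>Irreducible closed sets and algebraic independence in the chart\<close>

context perm_chart
begin

text \<open>By irreducibility D is not covered by C and the complement of the chart, so it has a
  point in the chart off C. There the functions that cut out the open complement of C are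
  available.\<close>

lemma closed_separation:
  assumes C: "closedin (flag_topology n) C" and D: "irreducible_in (flag_topology n) D"
    and "origin \<in> D" "\<not> D \<subseteq> C"
  shows "\<exists>f. f \<in> poly_funs n \<and> (\<forall>q\<in>C \<inter> chart. f (rep q) = 0) \<and> (\<exists>q\<in>D \<inter> chart. f (rep q) \<noteq> 0)"
proof -
  have cl: "closedin (flag_topology n) (flag_variety n - chart)"
    using openin_chart by (metis openin_closedin_eq topspace_flag closedin_def openin_subset Diff_subset double_diff subset_refl)
  have "\<not> D \<subseteq> C \<union> (flag_variety n - chart)"
    using D C cl assms(3,4) origin_in_chart unfolding irreducible_in_def by blast
  moreover have "D \<subseteq> flag_variety n" using D by (simp add: irreducible_in_def topspace_flag)
  ultimately obtain q where q: "q \<in> D" "q \<in> chart" "q \<notin> C" by blast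
  have U: "openin (flag_topology n) (flag_variety n - C)"
    using C by (metis closedin_def topspace_flag)
  then obtain F where F: "F \<subseteq> poly_funs n"
    "{g \<in> carrier (GL n). flag n g \<in> flag_variety n - C} = {A \<in> carrier (GL n). \<exists>f\<in>F. f A \<noteq> 0}"
    unfolding openin_flag_topology openin_zariski_GL by blast
  have key: "q' \<notin> C \<longleftrightarrow> (\<exists>f\<in>F. f (rep q') \<noteq> 0)" if "q' \<in> chart" for q'
  proof -
    have "rep q' \<in> {g \<in> carrier (GL n). flag n g \<in> flag_variety n - C} \<longleftrightarrow> q' \<notin> C"
      using rep_GL[OF that] flag_rep[OF that] flag_in_variety[OF rep_GL[OF that]] by simp
    then show ?thesis unfolding F(2) using rep_GL[OF that] by simp
  qed
  then obtain f where f: "f \<in> F" "f (rep q) \<noteq> 0" using q by blast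
  have "f (rep q') = 0" if "q' \<in> C" "q' \<in> chart" for q' using key that f by blast
  then show ?thesis using f F(1) q by (intro exI[of _ f]) blast
qed

lemma closedin_zero_set:
  assumes "h \<in> poly_funs n"
  shows "closedin (flag_topology n) (flag_variety n - {q \<in> chart. h (rep q) \<noteq> 0})"
  using openin_closedin_eq[THEN iffD1, OF openin_chart_nonzero[OF assms]] by (simp add: topspace_flag)

text \<open>The functions on an irreducible set form a domain: the zero loci of f and g, each
  enlarged by the complement of the chart, are closed and cover D.\<close>

lemma irreducible_domain:
  assumes D: "irreducible_in (flag_topology n) D"
    and fg: "f \<in> poly_funs n" "g \<in> poly_funs n" "\<And>q. q \<in> D \<Longrightarrow> q \<in> chart \<Longrightarrow> f (rep q) * g (rep q) = 0"
  shows "(\<forall>q\<in>D \<inter> chart. f (rep q) = 0) \<or> (\<forall>q\<in>D \<inter> chart. g (rep q) = 0)"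
proof -
  let ?C = "\<lambda>f. flag_variety n - {q \<in> chart. f (rep q) \<noteq> 0}"
  have "D \<subseteq> flag_variety n" using D by (simp add: irreducible_in_def topspace_flag)
  then have "D \<subseteq> ?C f \<union> ?C g" using fg(3) by auto
  then have "D \<subseteq> ?C f \<or> D \<subseteq> ?C g"
    using D closedin_zero_set[OF fg(1)] closedin_zero_set[OF fg(2)] unfolding irreducible_in_def by blast
  then show ?thesis by blast
qed

lemma chart_point_in_variety: "chart_point c \<in> flag_variety n"
  by (simp add: chart_point_def flag_in_variety)

text \<open>Join a torus element whose point is off C to one whose point is off D by a line in the
  diagonal entries. All but finitely many parameters stay in the torus and avoid both closed
  sets.\<close>

lemma irreducible_torus_orbit: "irreducible_in (flag_topology n) (torus_orbit n (chart_point c))"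
  unfolding irreducible_in_def
proof (intro conjI allI impI)
  show "torus_orbit n (chart_point c) \<subseteq> topspace (flag_topology n)"
    by (auto simp: torus_orbit_chart_point topspace_flag chart_point_in_variety)
  show "torus_orbit n (chart_point c) \<noteq> {}"
    unfolding torus_orbit_chart_point by (auto intro: exI[of _ "\<lambda>_. 1"])
  fix C D
  assume CD: "closedin (flag_topology n) C \<and> closedin (flag_topology n) D \<and> torus_orbit n (chart_point c) \<subseteq> C \<union> D"
  show "torus_orbit n (chart_point c) \<subseteq> C \<or> torus_orbit n (chart_point c) \<subseteq> D"
  proof (rule ccontr)
    assume "\<not> ?thesis"
    then obtain \<sigma> \<tau> where \<sigma>: "\<forall>k. \<sigma> k \<noteq> 0" "chart_point (scale \<sigma> c) \<notin> C"
      and \<tau>: "\<forall>k. \<tau> k \<noteq> 0" "chart_point (scale \<tau> c) \<notin> D"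
      by (auto simp: torus_orbit_chart_point)
    define T where "T s k = \<sigma> k + s * (\<tau> k - \<sigma> k)" for s k
    \<comment> \<open>The product is left without normalization because its entries are polynomial
      in s, whereas the scaled coordinates contain the quotients
      \<open>T s j / T s i\<close>.\<close>
    define M where "M s = mat_diag n (\<lambda>r. T s (pos r)) * chart_mat c" for s
    have TG: "mat_diag n (\<lambda>r. T s (pos r)) \<in> carrier (GL n)" if "\<And>k. k < n \<Longrightarrow> T s k \<noteq> 0" for s
      using that by (intro borel_GL torus_borel torusI) auto
    have M: "M s \<in> carrier (GL n)" "flag n (M s) = chart_point (scale (T s) c)"
      if "\<And>k. k < n \<Longrightarrow> T s k \<noteq> 0" for s
    proof -
      show "M s \<in> carrier (GL n)" unfolding M_def by (rule GL_mult[OF TG[OF that] chart_mat_GL])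
      show "flag n (M s) = chart_point (scale (T s) c)"
        using torus_chart_point[of "T s" c] coset_flag[OF TG[OF that] chart_mat_GL, of c] that
        by (simp add: M_def chart_point_def)
    qed
    have T01: "T 0 = \<sigma>" "T 1 = \<tau>" by (auto simp: T_def fun_eq_iff)
    have e: "\<exists>p. \<forall>s. M s $$ (i, j) = poly p s" if "i < n" "j < n" for i j
      by (rule exI[of _ "smult (chart_mat c $$ (i, j)) [:\<sigma> (pos i), \<tau> (pos i) - \<sigma> (pos i):]"])
         (use that in \<open>simp add: M_def mat_diag_mult_left[OF chart_mat_carrier] T_def algebra_simps\<close>)
    have op: "openin (flag_topology n) (flag_variety n - C)" "openin (flag_topology n) (flag_variety n - D)"
      using CD by (metis closedin_def topspace_flag)+
    obtain p where p: "poly p 0 \<noteq> 0"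
      "\<forall>s. poly p s \<noteq> 0 \<longrightarrow> M s \<in> carrier (GL n) \<longrightarrow> flag n (M s) \<in> flag_variety n - C"
      using open_flag_curve[OF e op(1), of 0] M[of 0] \<sigma> chart_point_in_variety by (auto simp: T01)
    obtain q where q: "poly q 1 \<noteq> 0"
      "\<forall>s. poly q s \<noteq> 0 \<longrightarrow> M s \<in> carrier (GL n) \<longrightarrow> flag n (M s) \<in> flag_variety n - D"
      using open_flag_curve[OF e op(2), of 1] M[of 1] \<tau> chart_point_in_variety by (auto simp: T01)
    \<comment> \<open>The roots of r are the parameters at which the line leaves the torus.\<close>
    define r where "r = (\<Prod>k<n. [:\<sigma> k, \<tau> k - \<sigma> k:])"
    have r: "poly r s = (\<Prod>k<n. T s k)" for s
      by (simp add: r_def poly_prod T_def)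
    have "poly r 0 \<noteq> 0" using \<sigma>(1) by (simp add: r T01)
    then have "p * q * r \<noteq> 0" using p(1) q(1) by auto
    then obtain s where "poly (p * q * r) s \<noteq> 0" by (rule poly_nonroot)
    then have s: "poly p s \<noteq> 0" "poly q s \<noteq> 0" "\<And>k. k < n \<Longrightarrow> T s k \<noteq> 0" by (auto simp: r)
    have "chart_point (scale (T s) c) \<in> torus_orbit n (chart_point c)"
      using torus_chart_point[of "T s" c] s(3) torusI[of n "\<lambda>r. T s (pos r)"] unfolding torus_orbit_def by force
    moreover have "flag n (M s) \<notin> C" "flag n (M s) \<notin> D"
      using p(2)[rule_format, OF s(1) M(1)] q(2)[rule_format, OF s(2) M(1)] s(3) by auto
    ultimately show False using CD M(2)[of s] s(3) by auto
  qed
qed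

lemma irreducible_closure:
  assumes "irreducible_in X S"
  shows "irreducible_in X (X closure_of S)"
  using assms closure_of_subset[of S X] unfolding irreducible_in_def
  by (auto simp: closure_of_subset_topspace dest: closure_of_minimal) (meson closure_of_minimal subset_trans in_mono)+

text \<open>A value strictly between v(j) and v(i) at a position between i and j splits the
  inversion into two shorter ones.\<close>

lemma inversion_trancl_covers:
  assumes "i < j" "j < n" "v j < v i"
  shows "(i, j) \<in> covers\<^sup>+"
  using assms
proof (induction "j - i" arbitrary: i j rule: less_induct)
  case less
  show ?case
  proof (cases "(i, j) \<in> covers")
    case False
    then obtain k where k: "i < k" "k < j" "v j < v k" "v k < v i" using less.prems by (auto simp: covers_def)
    then have "(i, k) \<in> covers\<^sup>+" "(k, j) \<in> covers\<^sup>+" using less by auto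
    then show ?thesis by (rule trancl_trans)
  qed blast
qed

text \<open>The monomial in f 0, ..., f (m-1) whose exponents are the base-k digits of N. Thus N <
  k^m lists all monomials with exponents below k by a single index.\<close>

fun digit_mono :: "nat \<Rightarrow> (nat \<Rightarrow> complex mat \<Rightarrow> complex) \<Rightarrow> nat \<Rightarrow> nat \<Rightarrow> complex mat \<Rightarrow> complex" where
  "digit_mono k f 0 N A = 1"
| "digit_mono k f (Suc m) N A = digit_mono k f m (N mod k ^ m) A * f m A ^ (N div k ^ m)"

lemma digit_mono_poly_funs:
  "(\<And>i. i < m \<Longrightarrow> f i \<in> poly_funs n) \<Longrightarrow> digit_mono k f m N \<in> poly_funs n"
proof (induction m arbitrary: N)
  case 0
  then show ?case using poly_funs.const[of 1 n] by simp
next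
  case (Suc m)
  then show ?case by (simp add: poly_funs.mult poly_funs_power)
qed

text \<open>A relation on the largest set is a polynomial in the last function f with coefficients G
  j. If all G below j vanish, f^j can be cancelled, since f is not zero on this irreducible set. On
  the next smaller set f is zero, which leaves \<open>G j = 0\<close> there: a relation between one
  function fewer.\<close>

lemma digit_mono_independent:
  assumes k: "k > 0"
    and Z: "\<And>i. i \<le> m \<Longrightarrow> irreducible_in (flag_topology n) (Z i) \<and> origin \<in> Z i"
      "\<And>i. i < m \<Longrightarrow> Z i \<subseteq> Z (Suc i)"
    and f: "\<And>i. i < m \<Longrightarrow> f i \<in> poly_funs n"
      "\<And>i q. i < m \<Longrightarrow> q \<in> Z i \<Longrightarrow> q \<in> chart \<Longrightarrow> f i (rep q) = 0"
      "\<And>i. i < m \<Longrightarrow> \<exists>q\<in>Z (Suc i) \<inter> chart. f i (rep q) \<noteq> 0"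
    and c: "\<And>q. q \<in> Z m \<Longrightarrow> q \<in> chart \<Longrightarrow> (\<Sum>N<k ^ m. c N * digit_mono k f m N (rep q)) = 0"
    and "N < k ^ m"
  shows "c N = 0"
  using Z f c \<open>N < k ^ m\<close>
proof (induction m arbitrary: c N)
  case 0
  \<comment> \<open>The empty monomial is 1, so evaluation at the origin, a point of
    \<open>Z 0\<close>, yields the claim.\<close>
  then show ?case using origin_in_chart by force
next
  case (Suc m)
  let ?K = "k ^ m"
  have K: "?K > 0" using k by simp
  define G where "G j A = (\<Sum>N<?K. c (j * ?K + N) * digit_mono k f m N A)" for j A
  have Gp: "G j \<in> poly_funs n" for j
    unfolding G_def[abs_def]
    by (intro poly_funs_sum poly_funs.mult poly_funs.const digit_mono_poly_funs Suc.prems(3)) auto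
  have expand: "(\<Sum>N<k ^ Suc m. c N * digit_mono k f (Suc m) N A) = (\<Sum>j<k. G j A * f m A ^ j)" for A
  proof -
    have "(\<Sum>N<k ^ Suc m. c N * digit_mono k f (Suc m) N A) =
      (\<Sum>j<k. \<Sum>N = j * ?K..<j * ?K + ?K. c N * digit_mono k f (Suc m) N A)"
      using sum.nat_group[of "\<lambda>N. c N * digit_mono k f (Suc m) N A" ?K k] by simp
    also have "\<dots> = (\<Sum>j<k. G j A * f m A ^ j)"
    proof (rule sum.cong[OF refl])
      fix j
      have "(\<Sum>N = j * ?K..<j * ?K + ?K. c N * digit_mono k f (Suc m) N A) =
        (\<Sum>N<?K. c (j * ?K + N) * digit_mono k f (Suc m) (j * ?K + N) A)"
        using sum.shift_bounds_nat_ivl[of "\<lambda>N. c N * digit_mono k f (Suc m) N A" 0 "j * ?K" ?K]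
        by (simp add: atLeast0LessThan add.commute)
      also have "\<dots> = (\<Sum>N<?K. c (j * ?K + N) * digit_mono k f m N A * f m A ^ j)"
        using K by (intro sum.cong) auto
      finally show "(\<Sum>N = j * ?K..<j * ?K + ?K. c N * digit_mono k f (Suc m) N A) = G j A * f m A ^ j"
        by (simp add: G_def sum_distrib_right)
    qed
    finally show ?thesis .
  qed
  have "\<forall>N<?K. c (j * ?K + N) = 0" if "j < k" for j
    using that
  proof (induction j rule: less_induct)
    case (less j)
    have G0: "G j' A = 0" if "j' < j" for j' A
      unfolding G_def using less that by (intro sum.neutral) auto
    \<comment> \<open>The cofactor of \<open>f m A ^ j\<close>; its constant term as a polynomial in
      \<open>f m A\<close> is \<open>G j A\<close>.\<close>
    define H where "H A = (\<Sum>j'=j..<k. G j' A * f m A ^ (j' - j))" for A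
    have Hp: "H \<in> poly_funs n"
      unfolding H_def[abs_def] using Suc.prems(3)
      by (intro poly_funs_sum poly_funs.mult Gp poly_funs_power) auto
    have fH: "f m A ^ j * H A = (\<Sum>j<k. G j A * f m A ^ j)" for A
    proof -
      have "(\<Sum>j<k. G j A * f m A ^ j) = (\<Sum>j'=j..<k. G j' A * f m A ^ j')"
        using G0 by (intro sum.mono_neutral_right) auto
      also have "\<dots> = (\<Sum>j'=j..<k. f m A ^ j * (G j' A * f m A ^ (j' - j)))"
        by (intro sum.cong) (auto simp: power_add[symmetric])
      finally show ?thesis by (simp add: H_def sum_distrib_left)
    qed
    have "\<forall>q\<in>Z (Suc m) \<inter> chart. H (rep q) = 0"
    proof -
      have "(\<forall>q\<in>Z (Suc m) \<inter> chart. f m (rep q) ^ j = 0) \<or> (\<forall>q\<in>Z (Suc m) \<inter> chart. H (rep q) = 0)"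
      proof (rule irreducible_domain)
        show "irreducible_in (flag_topology n) (Z (Suc m))" using Suc.prems(1) by blast
        show "(\<lambda>A. f m A ^ j) \<in> poly_funs n" using Suc.prems(3) by (intro poly_funs_power) auto
        show "H \<in> poly_funs n" by (rule Hp)
        show "f m (rep q) ^ j * H (rep q) = 0" if "q \<in> Z (Suc m)" "q \<in> chart" for q
          using Suc.prems(6)[OF that] by (simp only: fH expand)
      qed
      moreover have "\<exists>q\<in>Z (Suc m) \<inter> chart. f m (rep q) \<noteq> 0" using Suc.prems(5) by blast
      ultimately show ?thesis by auto
    qed
    moreover have "H (rep q) = G j (rep q)" if q: "q \<in> Z m" "q \<in> chart" for q
    proof -
      have "f m (rep q) = 0" using Suc.prems(4)[of m q] q by blast
      then have "H (rep q) = (\<Sum>j'=j..<k. if j' = j then G j (rep q) else 0)"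
        unfolding H_def by (intro sum.cong) auto
      then show ?thesis using less.prems by simp
    qed
    ultimately have "G j (rep q) = 0" if "q \<in> Z m" "q \<in> chart" for q
      using that Suc.prems(2)[of m] by (metis IntI lessI subsetD)
    then have "c (j * ?K + N) = 0" if "N < ?K" for N
      using that Suc.prems by (intro Suc.IH[where c = "\<lambda>N. c (j * ?K + N)"]) (auto simp: G_def)
    then show ?case by blast
  qed
  moreover have "N div ?K < k" using Suc.prems(7) K by (simp add: less_mult_imp_div_less)
  moreover have "N mod ?K < ?K" using K by simp
  ultimately have "c (N div ?K * ?K + N mod ?K) = 0" by blast
  then show ?case by (simp only: div_mult_mod_eq)
qed

end

section \<open>The upper bound for the local dimension\<close>

context generic_point
begin

text \<open>At an inversion the entry is a constant times a character, and a path in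
  \<open>F\<close> writes the character as a Laurent monomial. The other entries are constant on the
  orbit.\<close>

lemma poly_funs_laurent:
  assumes F: "finite F" "\<And>i j. i < j \<Longrightarrow> j < n \<Longrightarrow> v j < v i \<Longrightarrow> (i, j) \<in> sym_conn F"
    and "h \<in> poly_funs n"
  shows "\<exists>d. (\<lambda>\<tau>. h (chart_mat (scale (nz \<tau>) \<xi>))) \<in> laurent_space F d"
  using assms(3)
proof induction
  case (const c)
  show ?case using laurent_const by blast
next
  case (entry r k)
  show ?case
  proof (cases "k < pos r \<and> v (pos r) < v k")
    case True
    then have "(k, pos r) \<in> sym_conn F" using F(2)[of k "pos r"] entry by simp
    then obtain e where e: "\<forall>\<tau>. nz \<tau> (pos r) / nz \<tau> k = laurent_mono F e \<tau>"
      using connected_exponents[OF F(1)] by blast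
    define d where "d = nat (\<Sum>x\<in>F. \<bar>e x\<bar>)"
    have "\<bar>e x\<bar> \<le> int d" if "x \<in> F" for x
      using that member_le_sum[of x F "\<lambda>x. \<bar>e x\<bar>"] F(1) by (simp add: d_def sum_nonneg)
    then have "laurent_mono F e \<in> laurent_space F d" by (rule laurent_mono_in)
    from laurent_scale[OF this, of "\<xi> k (pos r)"]
    have "(\<lambda>\<tau>. chart_mat (scale (nz \<tau>) \<xi>) $$ (r, k)) \<in> laurent_space F d"
      using True entry by (simp add: chart_mat_def scale_def e[rule_format, symmetric] mult.commute)
    then show ?thesis by blast
  next
    case False
    have "(\<lambda>\<tau>. chart_mat (scale (nz \<tau>) \<xi>) $$ (r, k)) = (\<lambda>_. if pos r = k then 1 else 0)"
    proof
      fix \<tau> show "chart_mat (scale (nz \<tau>) \<xi>) $$ (r, k) = (if pos r = k then 1 else 0)"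
        using False entry \<xi>_nz[of k "pos r"] by (auto simp: chart_mat_def scale_def)
    qed
    then show ?thesis using laurent_const by metis
  qed
next
  case (add f g)
  then obtain d d' where d: "(\<lambda>\<tau>. f (chart_mat (scale (nz \<tau>) \<xi>))) \<in> laurent_space F d"
    "(\<lambda>\<tau>. g (chart_mat (scale (nz \<tau>) \<xi>))) \<in> laurent_space F d'" by blast
  have "(\<lambda>\<tau>. f (chart_mat (scale (nz \<tau>) \<xi>)) + g (chart_mat (scale (nz \<tau>) \<xi>))) \<in> laurent_space F (max d d')"
    using d laurent_space_mono[of d "max d d'" F] laurent_space_mono[of d' "max d d'" F]
    by (intro laurent_add) auto
  then show ?case by blast
next
  case (mult f g)
  then show ?case using laurent_mult by blast
qed

text \<open>Each of the m factors is a power with exponent below k, so the degree grows linearly in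
  k; the later count relies on this.\<close>

lemma digit_mono_laurent:
  assumes "\<And>i. i < m \<Longrightarrow> (\<lambda>\<tau>. f i (chart_mat (scale (nz \<tau>) \<xi>))) \<in> laurent_space F d"
    and "N < k ^ m"
  shows "(\<lambda>\<tau>. digit_mono k f m N (chart_mat (scale (nz \<tau>) \<xi>))) \<in> laurent_space F (m * (k * d))"
  using assms
proof (induction m arbitrary: N)
  case 0
  then show ?case using laurent_const by simp
next
  case (Suc m)
  have K: "k ^ m > 0" using Suc.prems(2) by (cases "k = 0") auto
  have "N div k ^ m < k" using Suc.prems(2) K by (simp add: less_mult_imp_div_less)
  then have "(\<lambda>\<tau>. f m (chart_mat (scale (nz \<tau>) \<xi>)) ^ (N div k ^ m)) \<in> laurent_space F (k * d)"
    using laurent_power[OF Suc.prems(1)[of m], of "N div k ^ m"]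
      laurent_space_mono[of "N div k ^ m * d" "k * d" F] by auto
  moreover have "(\<lambda>\<tau>. digit_mono k f m (N mod k ^ m) (chart_mat (scale (nz \<tau>) \<xi>))) \<in> laurent_space F (m * (k * d))"
    using Suc.prems(1) K by (intro Suc.IH) auto
  ultimately have "(\<lambda>\<tau>. digit_mono k f m (N mod k ^ m) (chart_mat (scale (nz \<tau>) \<xi>)) *
      f m (chart_mat (scale (nz \<tau>) \<xi>)) ^ (N div k ^ m)) \<in> laurent_space F (m * (k * d) + k * d)"
    by (intro laurent_mult)
  then show ?case by (simp add: add.commute)
qed

theorem local_dim_orbit_closure_le:
  assumes F: "finite F" "\<And>i j. i < j \<Longrightarrow> j < n \<Longrightarrow> v j < v i \<Longrightarrow> (i, j) \<in> sym_conn F"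
  shows "local_dim (flag_topology n) orbit_closure origin \<le> enat (card F)"
  unfolding local_dim_def
proof (rule SUP_least, clarify)
  fix m and Z :: "nat \<Rightarrow> complex mat set set"
  assume Z: "\<forall>i\<le>m. closedin (flag_topology n) (Z i) \<and> irreducible_in (flag_topology n) (Z i) \<and> origin \<in> Z i \<and> Z i \<subseteq> orbit_closure"
    and strict: "\<forall>i<m. Z i \<subset> Z (Suc i)"
  have "m \<le> card F"
  proof (rule ccontr)
    assume "\<not> m \<le> card F"
    then have m: "Suc (card F) \<le> m" by simp
    have "\<forall>i. \<exists>f. i < m \<longrightarrow> f \<in> poly_funs n \<and> (\<forall>q\<in>Z i \<inter> chart. f (rep q) = 0) \<and> (\<exists>q\<in>Z (Suc i) \<inter> chart. f (rep q) \<noteq> 0)"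
    proof
      fix i
      show "\<exists>f. i < m \<longrightarrow> f \<in> poly_funs n \<and> (\<forall>q\<in>Z i \<inter> chart. f (rep q) = 0) \<and> (\<exists>q\<in>Z (Suc i) \<inter> chart. f (rep q) \<noteq> 0)"
      proof (cases "i < m")
        case True
        then have "closedin (flag_topology n) (Z i)" "irreducible_in (flag_topology n) (Z (Suc i))"
          "origin \<in> Z (Suc i)"
          using Z by simp_all
        moreover have "\<not> Z (Suc i) \<subseteq> Z i" using strict True by blast
        ultimately show ?thesis using closed_separation[of "Z i" "Z (Suc i)"] by simp
      qed simp
    qed
    from choice[OF this] obtain f
      where f: "\<forall>i. i < m \<longrightarrow> f i \<in> poly_funs n \<and> (\<forall>q\<in>Z i \<inter> chart. f i (rep q) = 0) \<and> (\<exists>q\<in>Z (Suc i) \<inter> chart. f i (rep q) \<noteq> 0)"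
      by blast
    have "\<exists>d. \<forall>i<m. (\<lambda>\<tau>. f i (chart_mat (scale (nz \<tau>) \<xi>))) \<in> laurent_space F d"
    proof -
      have "\<forall>i. \<exists>d. i < m \<longrightarrow> (\<lambda>\<tau>. f i (chart_mat (scale (nz \<tau>) \<xi>))) \<in> laurent_space F d"
        using poly_funs_laurent[OF F] f by blast
      from choice[OF this] obtain d
        where d: "\<And>i. i < m \<Longrightarrow> (\<lambda>\<tau>. f i (chart_mat (scale (nz \<tau>) \<xi>))) \<in> laurent_space F (d i)" by blast
      have "d i \<le> (\<Sum>i<m. d i)" if "i < m" for i using that by (intro member_le_sum) auto
      then show ?thesis using d laurent_space_mono by blast
    qed
    then obtain d where d: "\<And>i. i < m \<Longrightarrow> (\<lambda>\<tau>. f i (chart_mat (scale (nz \<tau>) \<xi>))) \<in> laurent_space F d" by blast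
    \<comment> \<open>Since 2 m k d + 1 \<le> k (2 m d + 1), there are at most k^|F| (2 m d + 1)^|F|
      Laurent monomials. With k larger than the second factor this is less than k^(|F|+1) \<le>
      k^m.\<close>
    define k where "k = (2 * m * d + 1) ^ card F + 1"
    let ?B = "laurent_mono F ` {e. \<forall>x\<in>F. \<bar>e x\<bar> \<le> int (m * (k * d))}"
    have "card ?B \<le> (2 * (m * (k * d)) + 1) ^ card F" by (rule laurent_monos_bound(2)[OF F(1)])
    also have "\<dots> \<le> (k * (2 * m * d + 1)) ^ card F"
      by (rule power_mono) (auto simp: k_def algebra_simps)
    also have "\<dots> = k ^ card F * (2 * m * d + 1) ^ card F" by (rule power_mult_distrib)
    also have "\<dots> < k ^ card F * k" by (rule mult_strict_left_mono) (auto simp: k_def)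
    also have "\<dots> = k ^ Suc (card F)" by simp
    also have "\<dots> \<le> k ^ m" using m by (rule power_increasing) (simp add: k_def)
    finally have card: "card ?B < k ^ m" .
    obtain c where c: "\<exists>N<k ^ m. c N \<noteq> 0"
      "\<And>\<tau>. (\<Sum>N<k ^ m. c N * digit_mono k f m N (chart_mat (scale (nz \<tau>) \<xi>))) = 0"
      using linear_dependence[OF laurent_monos_bound(1)[OF F(1)] card,
          of "\<lambda>N \<tau>. digit_mono k f m N (chart_mat (scale (nz \<tau>) \<xi>))"]
        digit_mono_laurent[where f = f and m = m and d = d and F = F and k = k, OF d] unfolding laurent_space_def by blast
    let ?h = "\<lambda>A. \<Sum>N<k ^ m. c N * digit_mono k f m N A"
    have "c N = 0" if "N < k ^ m" for N
    proof (rule digit_mono_independent[where Z = Z and m = m and f = f and k = k])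
      show "k > 0" by (simp add: k_def)
      fix q assume q: "q \<in> Z m" "q \<in> chart"
      show "?h (rep q) = 0"
      proof (rule orbit_closure_vanish)
        show "?h \<in> poly_funs n"
          using f by (intro poly_funs_sum poly_funs.mult poly_funs.const digit_mono_poly_funs) auto
        show "?h (chart_mat (scale \<tau> \<xi>)) = 0" if "\<And>k. \<tau> k \<noteq> 0" for \<tau>
          using c(2)[of \<tau>] nz_eq[of \<tau>] that by simp
      qed (use q Z in auto)
    qed (use Z strict f that in auto)
    then show False using c(1) by blast
  qed
  then show "enat m \<le> enat (card F)" by simp
qed

section \<open>The lower bound for the local dimension\<close>

lemma inversion_potential_mono:
  fixes \<mu> :: "nat \<Rightarrow> int"
  assumes "\<And>a b. (a, b) \<in> covers \<Longrightarrow> \<mu> a \<le> \<mu> b" "i < j" "j < n" "v j < v i"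
  shows "\<mu> i \<le> \<mu> j"
  using inversion_trancl_covers[OF assms(2-4)]
  by induction (use assms(1) in \<open>force intro: order_trans\<close>)+

text \<open>Let \<mu> i have the value 0 on the first i covers and 1 on the others. The limit along
  \<mu> i keeps the coordinates of those inversions on which \<mu> i is constant: none for i = 0,
  all of them for i = r.\<close>

theorem local_dim_orbit_closure_ge:
  assumes pot: "\<And>y :: nat \<times> nat \<Rightarrow> int. \<exists>\<mu>. \<forall>(a, b)\<in>covers. \<mu> b - \<mu> a = y (a, b)"
  shows "enat (card covers) \<le> local_dim (flag_topology n) orbit_closure origin"
proof -
  let ?r = "card covers"
  obtain h where h: "bij_betw h {0..<?r} covers"
    using ex_bij_betw_nat_finite[OF finite_covers] by blast
  have "\<forall>i. \<exists>\<mu> :: nat \<Rightarrow> int. \<forall>(a, b)\<in>covers. \<mu> b - \<mu> a = (if (a, b) \<in> h ` {0..<i} then 0 else 1)"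
    using pot[of "\<lambda>e. if e \<in> h ` {0..<i} then 0 else 1" for i] by simp
  then obtain \<mu> :: "nat \<Rightarrow> nat \<Rightarrow> int"
    where \<mu>: "\<And>i a b. (a, b) \<in> covers \<Longrightarrow> \<mu> i b - \<mu> i a = (if (a, b) \<in> h ` {0..<i} then 0 else 1)"
    by (metis (mono_tags, lifting) case_prodD)
  define c where "c i a b = (if \<mu> i a = \<mu> i b then \<xi> a b else 0)" for i a b
  define Z where "Z i = zariski_closure n (torus_orbit n (chart_point (c i)))" for i
  have mono: "\<mu> i a \<le> \<mu> i b" if "a < b" "b < n" "v b < v a" for i a b
  proof (rule inversion_potential_mono[OF _ that])
    fix a' b' assume "(a', b') \<in> covers"
    from \<mu>[OF this, of i] show "\<mu> i a' \<le> \<mu> i b'" by (simp split: if_splits)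
  qed
  \<comment> \<open>The difference of \<mu> i and the next potential is 1 on the cover
    \<open>h i\<close> and 0 on the other covers, hence it does not decrease along inversions. So an
    inversion kept at stage i is still kept at the next one.\<close>
  have mono': "\<mu> (Suc i) b - \<mu> (Suc i) a \<le> \<mu> i b - \<mu> i a" if "a < b" "b < n" "v b < v a" for i a b
  proof -
    have "\<mu> i a' - \<mu> (Suc i) a' \<le> \<mu> i b' - \<mu> (Suc i) b'" if "(a', b') \<in> covers" for a' b'
      using \<mu>[OF that, of i] \<mu>[OF that, of "Suc i"] by (auto split: if_splits)
    from inversion_potential_mono[of "\<lambda>x. \<mu> i x - \<mu> (Suc i) x", OF this \<open>a < b\<close> \<open>b < n\<close> \<open>v b < v a\<close>]
    show ?thesis by simp
  qed
  have inv: "v b < v a" if "a < b" "b < n" "\<xi> a b \<noteq> 0" for a b using \<xi>_nz that by blast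
  have cl: "closedin (flag_topology n) (Z i)" for i unfolding Z_def by simp
  have sub: "Z i \<subseteq> Z (Suc i)" for i
    unfolding Z_def
  proof (rule closure_of_minimal)
    show "torus_orbit n (chart_point (c i)) \<subseteq> zariski_closure n (torus_orbit n (chart_point (c (Suc i))))"
    proof (rule torus_limit[where \<mu> = "\<mu> i"])
      fix a b assume ab: "a < b" "b < n"
      show "\<mu> i a \<le> \<mu> i b" if "c (Suc i) a b \<noteq> 0"
        using that mono[OF ab inv[OF ab]] by (auto simp: c_def split: if_splits)
      show "c i a b = (if \<mu> i a = \<mu> i b then c (Suc i) a b else 0)"
      proof (cases "\<xi> a b = 0")
        case False
        then have "v b < v a" using inv ab by blast
        then show ?thesis using mono[OF ab, of "Suc i"] mono'[OF ab, of i] by (auto simp: c_def)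
      qed (simp add: c_def)
    qed
  qed simp
  have strict: "Z i \<subset> Z (Suc i)" if "i < ?r" for i
  proof -
    have hi: "h i \<in> covers" "h i \<notin> h ` {0..<i}"
      using h that inj_on_image_mem_iff[of h "{0..<?r}" i "{0..<i}"] by (auto simp: bij_betw_def)
    obtain a b where ab: "h i = (a, b)" by fastforce
    have abn: "a < b" "b < n" "v b < v a" using hi(1) ab by (auto simp: covers_def)
    have c1: "c i a b = 0" using \<mu>[of a b i] hi ab by (auto simp: c_def)
    have "(a, b) \<in> h ` {0..<Suc i}" using ab by (metis imageI atLeastLessThan_iff lessI le0)
    then have c2: "c (Suc i) a b \<noteq> 0"
      using \<mu>[of a b "Suc i"] hi ab abn \<xi>_nz by (auto simp: c_def)
    \<comment> \<open>The coordinate of the cover \<open>h i\<close> separates the two stages: it is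
      nonzero at the new base point and zero on the whole old orbit.\<close>
    have "chart_point (c (Suc i)) \<in> minor_open a b"
      unfolding chart_point_def using abn c2 by (subst flag_in_minor_open) (auto simp: minor_chart_mat)
    moreover have "chart_point (scale \<tau> (c i)) \<notin> minor_open a b" for \<tau>
      unfolding chart_point_def using abn c1
      by (subst flag_in_minor_open) (auto simp: minor_chart_mat scale_def)
    then have "minor_open a b \<inter> torus_orbit n (chart_point (c i)) = {}"
      by (auto simp: torus_orbit_chart_point)
    ultimately have "chart_point (c (Suc i)) \<notin> Z i"
      unfolding Z_def using openin_minor_open[of a b] abn by (intro notin_closureI) auto
    moreover have "torus_orbit n (chart_point (c (Suc i))) \<subseteq> Z (Suc i)" unfolding Z_def
      by (rule closure_of_subset) (use irreducible_torus_orbit in \<open>simp add: irreducible_in_def\<close>)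
    then have "chart_point (c (Suc i)) \<in> Z (Suc i)" using chart_point_in_orbit by blast
    ultimately show ?thesis using sub by blast
  qed
  have Y: "Z i \<subseteq> orbit_closure" for i
    unfolding Z_def orbit_closure_def
  proof (rule closure_of_minimal)
    show "torus_orbit n (chart_point (c i)) \<subseteq> zariski_closure n (torus_orbit n (chart_point \<xi>))"
      by (rule torus_limit[where \<mu> = "\<mu> i"]) (use mono inv in \<open>auto simp: c_def\<close>)
  qed simp
  show ?thesis unfolding local_dim_def
  proof (rule SUP_upper, rule CollectI, rule exI[of _ Z], intro conjI allI impI)
    fix i
    show "irreducible_in (flag_topology n) (Z i)" unfolding Z_def
      by (rule irreducible_closure[OF irreducible_torus_orbit])
    show "origin \<in> Z i" unfolding Z_def by (rule origin_in_orbit_closure)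
  qed (use cl Y strict in auto)
qed

end

section \<open>Cycles and covers\<close>

definition pair_graph :: "('a \<times> 'a) set \<Rightarrow> 'a pair_pre_digraph" where
  "pair_graph E = \<lparr>pverts = fst ` E \<union> snd ` E, parcs = E\<rparr>"

context
  fixes G :: "('a, 'a \<times> 'a) pre_digraph"
  assumes G: "tail G = fst" "head G = snd"
begin

interpretation pre_digraph G .

text \<open>A simple path visits its end z only once, so none of its arcs can leave z.\<close>

lemma cas_last_tail:
  assumes "cas u p z" "distinct (awalk_verts u p)" "x \<in> set p"
  shows "fst x \<noteq> z" "fst x \<in> set (awalk_verts u p)"
proof -
  have *: "z \<in> set (awalk_verts u p)" if "cas u p z" for u p
    using that by (induction p arbitrary: u) (auto simp: G)
  have "fst x \<noteq> z \<and> fst x \<in> set (awalk_verts u p)"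
    using assms
  proof (induction p arbitrary: u)
    case (Cons y ys)
    then have c: "fst y = u" "cas (snd y) ys z" by (auto simp: G)
    then have d: "u \<notin> set (awalk_verts (snd y) ys)" "distinct (awalk_verts (snd y) ys)"
      using Cons.prems(2) by (auto simp: G)
    show ?case
    proof (cases "x = y")
      case True
      then show ?thesis using *[OF c(2)] c(1) d(1) by (auto simp: G)
    next
      case False
      then show ?thesis using Cons.IH[OF c(2) d(2)] Cons.prems(3) by (auto simp: G)
    qed
  qed simp
  then show "fst x \<noteq> z" "fst x \<in> set (awalk_verts u p)" by auto
qed

text \<open>A simple path leaves its start only once, so the arc (u, z) comes first; having reached
  z the path is over.\<close>

lemma cas_direct_arc:
  assumes "cas u p z" "distinct (awalk_verts u p)" "(u, z) \<in> set p"
  shows "p = [(u, z)]"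
proof (cases p)
  case (Cons y ys)
  then have c: "fst y = u" "cas (snd y) ys z" using assms(1) by (auto simp: G)
  have d: "u \<notin> set (awalk_verts (snd y) ys)" "distinct (awalk_verts (snd y) ys)"
    using assms(2) Cons c(1) by (auto simp: G)
  have "(u, z) \<notin> set ys" using cas_last_tail(2)[OF c(2) d(2)] d(1) by fastforce
  then have y: "y = (u, z)" using assms(3) Cons by simp
  then have "ys = []" using c(2) d(2) cas_last_tail(1)[of z ys z "hd ys"] by (cases ys) (auto simp: G)
  then show ?thesis using Cons y by simp
qed (use assms in simp)

lemma cas_rtrancl: "cas u p z \<Longrightarrow> set p \<subseteq> R \<Longrightarrow> (u, z) \<in> R\<^sup>*"
proof (induction p arbitrary: u)
  case (Cons y ys)
  then have "(u, snd y) \<in> R" "(snd y, z) \<in> R\<^sup>*" by (auto simp: G)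
  then show ?case by (rule converse_rtrancl_into_rtrancl)
qed simp

lemma cas_suffix:
  assumes "cas u p z" "distinct (awalk_verts u p)" "a \<in> set (awalk_verts u p)"
  shows "\<exists>q. cas a q z \<and> set q \<subseteq> set p \<and> distinct (awalk_verts a q)"
  using assms
proof (induction p arbitrary: u)
  case Nil
  then show ?case by (intro exI[of _ "[]"]) auto
next
  case (Cons y ys)
  show ?case
  proof (cases "a = u")
    case True
    then show ?thesis using Cons.prems by (intro exI[of _ "y # ys"]) auto
  next
    case False
    then have "\<exists>q. cas a q z \<and> set q \<subseteq> set ys \<and> distinct (awalk_verts a q)"
      using Cons.prems by (intro Cons.IH[of "snd y"]) (auto simp: G)
    then show ?thesis by auto
  qed
qed

text \<open>An arc is put in front of a simple path; if its start already occurs there, the part of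
  the path from that vertex on is used.\<close>

lemma rtrancl_simple_path:
  assumes "(u, z) \<in> R\<^sup>*"
  shows "\<exists>p. cas u p z \<and> set p \<subseteq> R \<and> distinct (awalk_verts u p)"
  using assms
proof (induction rule: converse_rtrancl_induct)
  case base
  show ?case by (intro exI[of _ "[]"]) auto
next
  case (step u x)
  then obtain p where p: "cas x p z" "set p \<subseteq> R" "distinct (awalk_verts x p)" by blast
  show ?case
  proof (cases "u \<in> set (awalk_verts x p)")
    case True
    then show ?thesis using cas_suffix[OF p(1,3)] p(2) by blast
  next
    case False
    then show ?thesis using p step(1) by (intro exI[of _ "(u, x) # p"]) (auto simp: G)
  qed
qed

end

text \<open>Without its first arc, a cycle of length at least 3 is a simple path of length at least
  2 that avoids the edge in both directions, so the edge is no bridge. Conversely, a simple path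
  around an edge closes up to a cycle.\<close>

lemma underlying_forest_iff:
  assumes "\<And>a b. (a, b) \<in> E \<Longrightarrow> (b, a) \<notin> E"
  shows "underlying_forest (pair_graph E) \<longleftrightarrow> bridges_only E"
proof -
  define G where "G = with_proj (mk_symmetric (with_proj (pair_graph E)))"
  have G: "tail G = fst" "head G = snd" and arcs: "arcs G = E \<union> E\<inverse>" and verts: "verts G = fst ` E \<union> snd ` E"
    by (auto simp: G_def mk_symmetric_def pair_graph_def with_proj_def)
  interpret pre_digraph G .
  have "(\<exists>p. 3 \<le> length p \<and> cycle p) \<longleftrightarrow> \<not> bridges_only E"
  proof
    assume "\<exists>p. 3 \<le> length p \<and> cycle p"
    then obtain p u where p: "3 \<le> length p" "awalk u p u" "distinct (tl (awalk_verts u p))"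
      by (auto simp: cycle_def)
    then obtain x ps where x: "p = x # ps" by (cases p) auto
    define z where "z = snd x"
    have xu: "x = (u, z)" and c: "cas z ps u" and d: "distinct (awalk_verts z ps)"
      and R: "x \<in> E \<union> E\<inverse>" "set ps \<subseteq> E \<union> E\<inverse>"
      using p(2,3) by (auto simp: x awalk_def G z_def prod_eq_iff arcs)
    have l: "length ps \<ge> 2" using p(1) x by simp
    have n1: "(z, u) \<notin> set ps" using cas_direct_arc[OF G c d] l by auto
    have n2: "(u, z) \<notin> set ps" using cas_last_tail(1)[OF G c d] by fastforce
    \<comment> \<open>The first arc of the cycle in the orientation that belongs to
      \<open>E\<close>.\<close>
    define e where "e = (if x \<in> E then x else (z, u))"
    have e: "e \<in> E" using R(1) xu by (auto simp: e_def)
    have "set ps \<subseteq> (E - {e}) \<union> (E - {e})\<inverse>"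
    proof
      fix y assume y: "y \<in> set ps"
      then have "y \<noteq> (u, z)" "y \<noteq> (z, u)" using n1 n2 by auto
      then show "y \<in> (E - {e}) \<union> (E - {e})\<inverse>" using y R(2) xu by (cases y) (auto simp: e_def)
    qed
    then have "(z, u) \<in> sym_conn (E - {e})" unfolding sym_conn_def by (rule cas_rtrancl[OF G c])
    then have "e \<in> sym_conn (E - {e})" using sym_conn_sym[of z u] xu by (auto simp: e_def)
    then show "\<not> bridges_only E" using e by (auto simp: bridges_only_def)
  next
    assume "\<not> bridges_only E"
    then obtain a b where ab: "(a, b) \<in> E" "(a, b) \<in> sym_conn (E - {(a, b)})"
      by (auto simp: bridges_only_def)
    obtain p where p: "cas a p b" "set p \<subseteq> (E - {(a, b)}) \<union> (E - {(a, b)})\<inverse>" "distinct (awalk_verts a p)"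
      using rtrancl_simple_path[OF G ab(2)[unfolded sym_conn_def]] by blast
    \<comment> \<open>Since (b, a) is not an edge, the path cannot use (a, b) as the reverse of
      another edge; hence it has at least two arcs.\<close>
    have "(a, b) \<notin> set p" using p(2) assms[OF ab(1)] by auto
    moreover have "a \<noteq> b" using assms[of a a] ab(1) by auto
    ultimately have "2 \<le> length p"
      using p(1) by (cases p; cases "tl p") (auto simp: G prod_eq_iff)
    moreover have "awalk b ((b, a) # p) b"
      using p(1,2) ab(1) by (auto simp: awalk_def G arcs verts image_iff intro: bexI[of _ "(a, b)"])
    moreover have "distinct (tl (awalk_verts b ((b, a) # p)))" using p(3) by (simp add: G)
    ultimately show "\<exists>p. 3 \<le> length p \<and> cycle p"
      by (intro exI[of _ "(b, a) # p"]) (auto simp: cycle_def)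
  qed
  then show ?thesis unfolding underlying_forest_def G_def[symmetric] by blast
qed

section \<open>Change of length under a transposition\<close>

lemma length_transpose_difference:
  fixes w :: "nat \<Rightarrow> nat"
  assumes w: "inj w" and ij: "1 \<le> i" "i < j" "j \<le> n"
  defines "s \<equiv> \<lambda>p q. if w q < w p then 1 else - 1 :: int"
  shows "int (perm_length n w) - int (perm_length n (transpose (w i) (w j) \<circ> w)) =
    s i j + (\<Sum>k\<in>{i<..<j}. s i k + s k j)"
proof -
  let ?\<tau> = "transpose i j"
  have w': "(transpose (w i) (w j) \<circ> w) k = w (?\<tau> k)" for k
    using injD[OF w] by (auto simp: transpose_def)
  define P where "P = {(p, q). 1 \<le> p \<and> p < q \<and> q \<le> n}"
  have finP: "finite P" by (rule finite_subset[of _ "{..n} \<times> {..n}"]) (auto simp: P_def)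
  have len: "int (perm_length n u) = (\<Sum>(p, q)\<in>P. if u q < u p then 1 else 0)" for u :: "nat \<Rightarrow> nat"
  proof -
    have "{(i, j). 1 \<le> i \<and> i < j \<and> j \<le> n \<and> u j < u i} = {x \<in> P. u (snd x) < u (fst x)}"
      by (auto simp: P_def)
    then have "int (perm_length n u) = (\<Sum>x | x \<in> P \<and> u (snd x) < u (fst x). 1)"
      by (simp add: perm_length_def)
    also have "\<dots> = (\<Sum>x\<in>P. if u (snd x) < u (fst x) then 1 else 0)"
      by (rule sum.inter_filter[OF finP])
    finally show ?thesis by (simp add: split_beta)
  qed
  \<comment> \<open>The image of a pair of positions under the transposition, sorted again. This
    involution of P allows the two inversion counts to be compared pair by pair.\<close>
  define \<sigma> where "\<sigma> = (\<lambda>(p, q). if ?\<tau> p < ?\<tau> q then (?\<tau> p, ?\<tau> q) else (?\<tau> q, ?\<tau> p))"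
  have tP: "1 \<le> ?\<tau> p \<and> ?\<tau> p \<le> n" if "1 \<le> p" "p \<le> n" for p
    using that ij by (auto simp: transpose_def)
  have \<sigma>P: "\<sigma> x \<in> P" if "x \<in> P" for x
  proof -
    obtain p q where x: "x = (p, q)" "1 \<le> p" "p < q" "q \<le> n" using \<open>x \<in> P\<close> by (auto simp: P_def)
    have "?\<tau> p \<noteq> ?\<tau> q" using x(3) ij(2) by (auto simp: transpose_def)
    then show ?thesis using x tP[of p] tP[of q] by (auto simp: \<sigma>_def P_def)
  qed
  have \<sigma>\<sigma>: "\<sigma> (\<sigma> x) = x" if "x \<in> P" for x
    using that by (auto simp: \<sigma>_def P_def)
  have "int (perm_length n (transpose (w i) (w j) \<circ> w)) =
      (\<Sum>(p, q)\<in>P. if w (?\<tau> q) < w (?\<tau> p) then 1 else 0)"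
    by (simp only: len w')
  also have "\<dots> = (\<Sum>(p, q)\<in>P. if ?\<tau> p < ?\<tau> q then (if w q < w p then 1 else 0) else (if w p < w q then 1 else 0))"
  proof (rule sum.reindex_bij_witness[of _ \<sigma> \<sigma>])
    fix x assume "x \<in> P"
    obtain p q where "x = (p, q)" by fastforce
    then show "(case \<sigma> x of (p, q) \<Rightarrow> if ?\<tau> p < ?\<tau> q then (if w q < w p then 1 else 0) else (if w p < w q then 1 else 0)) =
        (case x of (p, q) \<Rightarrow> if w (?\<tau> q) < w (?\<tau> p) then 1 else (0 :: int))"
      using \<open>x \<in> P\<close> by (cases "?\<tau> p < ?\<tau> q") (simp_all add: \<sigma>_def P_def)
  qed (simp_all add: \<sigma>\<sigma> \<sigma>P)
  finally have "int (perm_length n w) - int (perm_length n (transpose (w i) (w j) \<circ> w)) =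
      (\<Sum>x\<in>P. (case x of (p, q) \<Rightarrow> if w q < w p then 1 else 0) -
        (case x of (p, q) \<Rightarrow> if ?\<tau> p < ?\<tau> q then (if w q < w p then 1 else 0) else (if w p < w q then 1 else 0)))"
    by (simp add: len sum_subtractf)
  also have "\<dots> = (\<Sum>(p, q)\<in>P. if ?\<tau> p < ?\<tau> q then 0 else s p q)"
  proof (rule sum.cong[OF refl])
    fix x assume "x \<in> P"
    then obtain p q where x: "x = (p, q)" "p < q" by (auto simp: P_def)
    then have "w p \<noteq> w q" using injD[OF w, of p q] by auto
    then show "(case x of (p, q) \<Rightarrow> if w q < w p then 1 else 0) -
        (case x of (p, q) \<Rightarrow> if ?\<tau> p < ?\<tau> q then (if w q < w p then 1 else 0) else (if w p < w q then 1 else 0)) =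
        (case x of (p, q) \<Rightarrow> if ?\<tau> p < ?\<tau> q then 0 else s p q)"
      using x by (auto simp: s_def)
  qed
  \<comment> \<open>The pairs whose order the transposition reverses are (i, j) and, for i < k < j,
    (i, k) and (k, j); all others cancel.\<close>
  also have "\<dots> = (\<Sum>(p, q)\<in>{(i, j)} \<union> (Pair i ` {i<..<j} \<union> (\<lambda>k. (k, j)) ` {i<..<j}). s p q)"
  proof (rule sum.mono_neutral_cong_right[OF finP])
    show "{(i, j)} \<union> (Pair i ` {i<..<j} \<union> (\<lambda>k. (k, j)) ` {i<..<j}) \<subseteq> P"
      using ij by (auto simp: P_def)
    show "\<forall>x\<in>P - ({(i, j)} \<union> (Pair i ` {i<..<j} \<union> (\<lambda>k. (k, j)) ` {i<..<j})).
        (case x of (p, q) \<Rightarrow> if ?\<tau> p < ?\<tau> q then 0 else s p q) = 0"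
    proof
      fix x assume x: "x \<in> P - ({(i, j)} \<union> (Pair i ` {i<..<j} \<union> (\<lambda>k. (k, j)) ` {i<..<j}))"
      obtain p q where pq: "x = (p, q)" by fastforce
      have "p < q" "\<not> (p = i \<and> q \<le> j)" "\<not> (q = j \<and> i \<le> p)"
        using x ij by (auto simp: pq P_def)
      then have "?\<tau> p < ?\<tau> q" using ij by (auto simp: transpose_def)
      then show "(case x of (p, q) \<Rightarrow> if ?\<tau> p < ?\<tau> q then 0 else s p q) = 0" by (simp add: pq)
    qed
    fix x assume "x \<in> {(i, j)} \<union> (Pair i ` {i<..<j} \<union> (\<lambda>k. (k, j)) ` {i<..<j})"
    then show "(case x of (p, q) \<Rightarrow> if ?\<tau> p < ?\<tau> q then 0 else s p q) = (case x of (p, q) \<Rightarrow> s p q)"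
      using ij by (auto simp: transpose_def)
  qed
  also have "\<dots> = s i j + ((\<Sum>k\<in>{i<..<j}. s i k) + (\<Sum>k\<in>{i<..<j}. s k j))"
  proof -
    have "(\<Sum>(p, q)\<in>{(i, j)} \<union> (Pair i ` {i<..<j} \<union> (\<lambda>k. (k, j)) ` {i<..<j}). s p q) =
      (\<Sum>(p, q)\<in>{(i, j)}. s p q) + ((\<Sum>(p, q)\<in>Pair i ` {i<..<j}. s p q) + (\<Sum>(p, q)\<in>(\<lambda>k. (k, j)) ` {i<..<j}. s p q))"
      by (subst sum.union_disjoint, simp, simp, force, subst sum.union_disjoint) auto
    then show ?thesis by (simp add: sum.reindex inj_on_def)
  qed
  finally show ?thesis by (simp add: sum.distrib)
qed

text \<open>If w(j) < w(i), the summand of k is 2 when w(k) lies between the two values and 0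
  otherwise. If w(i) < w(j), the leading term is -1 and no summand is positive.\<close>

lemma length_transpose_cover:
  fixes w :: "nat \<Rightarrow> nat"
  assumes w: "inj w" and ij: "1 \<le> i" "i < j" "j \<le> n"
  shows "int (perm_length n w) - int (perm_length n (transpose (w i) (w j) \<circ> w)) = 1 \<longleftrightarrow>
    w j < w i \<and> (\<forall>k. i < k \<longrightarrow> k < j \<longrightarrow> \<not> (w j < w k \<and> w k < w i))"
proof -
  define s where "s p q = (if w q < w p then 1 else - 1 :: int)" for p q
  have d: "int (perm_length n w) - int (perm_length n (transpose (w i) (w j) \<circ> w)) =
      s i j + (\<Sum>k\<in>{i<..<j}. s i k + s k j)"
    unfolding s_def by (rule length_transpose_difference[OF assms])
  have ne: "w k \<noteq> w i" "w k \<noteq> w j" if "k \<in> {i<..<j}" for k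
    using that injD[OF w, of k i] injD[OF w, of k j] by auto
  have "w i \<noteq> w j" using injD[OF w, of i j] ij by auto
  then consider "w j < w i" | "w i < w j" by linarith
  then show ?thesis
  proof cases
    case 1
    have t: "s i k + s k j = (if w j < w k \<and> w k < w i then 2 else 0)" if "k \<in> {i<..<j}" for k
      using ne[OF that] 1 by (auto simp: s_def)
    have "(\<Sum>k\<in>{i<..<j}. s i k + s k j) = 0 \<longleftrightarrow> (\<forall>k\<in>{i<..<j}. s i k + s k j = 0)"
      by (rule sum_nonneg_eq_0_iff) (auto simp: t)
    then show ?thesis unfolding d using 1 by (auto simp: s_def[of i j] t)
  next
    case 2
    have "(\<Sum>k\<in>{i<..<j}. s i k + s k j) \<le> 0"
      by (rule sum_nonpos) (use 2 in \<open>auto simp: s_def\<close>)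
    then show ?thesis unfolding d using 2 by (simp add: s_def[of i j])
  qed
qed

lemma cover_graph_eq: "cover_graph n w = pair_graph (cover_pairs n w)"
  by (simp add: cover_graph_def pair_graph_def)

section \<open>Reduction of the theorem to the chart\<close>

context perm_chart
begin

lemma origin_in_schubert: "origin \<in> schubert"
proof -
  have "1\<^sub>m n <#\<^bsub>GL n\<^esub> origin = origin"
    using coset_flag[OF borel_GL[OF one_borel] chart_mat_GL, of "\<lambda>_ _. 0"]
      left_mult_one_mat[OF chart_mat_carrier] by (simp add: chart_point_def)
  then have "origin \<in> {b <#\<^bsub>GL n\<^esub> origin | b. b \<in> borel n}" using one_borel by (metis (mono_tags, lifting) mem_Collect_eq)
  moreover have "{b <#\<^bsub>GL n\<^esub> origin | b. b \<in> borel n} \<subseteq> topspace (flag_topology n)"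
    using coset_flag[OF borel_GL chart_mat_GL] flag_in_variety[OF GL_mult[OF borel_GL chart_mat_GL]]
    by (auto simp: chart_point_def topspace_flag)
  ultimately show ?thesis unfolding schubert_def using closure_of_subset by blast
qed

text \<open>The chart is an open neighbourhood of the origin, so it meets the orbit. It is also
  stable under the torus, and the inverse torus element brings the point found back to p.\<close>

lemma generic_orbit_meets_chart:
  assumes p: "p \<in> flag_variety n" and o: "origin \<in> zariski_closure n (torus_orbit n p)"
  obtains c where "p = chart_point c"
proof -
  obtain g where g: "g \<in> carrier (GL n)" "p = flag n g" using p by (auto simp: flag_variety_def)
  have "\<exists>q. q \<in> torus_orbit n p \<and> q \<in> chart"
    using o openin_chart origin_in_chart by (simp add: in_closure_of)
  then obtain t c where t: "t \<in> torus n" "t <#\<^bsub>GL n\<^esub> p = chart_point c"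
    by (auto simp: torus_orbit_def chart_def)
  have tG: "t \<in> carrier (GL n)" using t(1) by (simp add: torus_def)
  have tg: "flag n (t * g) = chart_point c" using coset_flag[OF tG g(1)] t(2) g(2) by simp
  have nz: "t $$ (i, i) \<noteq> 0" if "i < n" for i using borel_diag[OF torus_borel[OF t(1)] that] .
  define u where "u = mat_diag n (\<lambda>i. inverse (t $$ (i, i)))"
  have u: "u \<in> torus n" unfolding u_def using nz by (intro torusI) simp
  have uG: "u \<in> carrier (GL n)" using u by (simp add: torus_def)
  have "u * t = 1\<^sub>m n"
    unfolding u_def mat_diag_mult_left[OF GL_D[OF tG]]
    using t(1) nz GL_D[OF tG] by (intro eq_matI) (auto simp: torus_def diagonal_mat_def)
  then have "u * (t * g) = g"
    using assoc_mult_mat[OF GL_D[OF uG] GL_D[OF tG] GL_D[OF g(1)]] left_mult_one_mat[OF GL_D[OF g(1)]] by simp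
  then have "u <#\<^bsub>GL n\<^esub> chart_point c = p"
    using coset_flag[OF uG GL_mult[OF tG g(1)]] tg g(2) by simp
  then have "p \<in> torus_orbit n (chart_point c)" using u by (auto simp: torus_orbit_def)
  then show thesis using that by (auto simp: torus_orbit_chart_point)
qed

lemma covers_conn:
  assumes "covers \<subseteq> sym_conn F" "i < j" "j < n" "v j < v i"
  shows "(i, j) \<in> sym_conn F"
  using inversion_trancl_covers[OF assms(2-4)]
proof induction
  case (base y)
  then show ?case using assms(1) by blast
next
  case (step y z)
  then show ?case using assms(1) sym_conn_trans[of i y F z] by blast
qed

end

context generic_point
begin

theorem smooth_at_iff_bridges_only:
  "smooth_at n orbit_closure origin \<longleftrightarrow> bridges_only covers"
proof
  assume "bridges_only covers"
  then have "enat (card covers) \<le> local_dim (flag_topology n) orbit_closure origin"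
    by (intro local_dim_orbit_closure_ge bridges_only_potential finite_covers)
  moreover have "local_dim (flag_topology n) orbit_closure origin \<le> enat (card covers)"
    by (intro local_dim_orbit_closure_le finite_covers covers_conn) (auto intro: sym_conn_edge)
  ultimately show "smooth_at n orbit_closure origin"
    unfolding smooth_at_def tangent_dim_orbit_closure by (rule order.antisym)
next
  assume s: "smooth_at n orbit_closure origin"
  show "bridges_only covers"
  proof (rule ccontr)
    assume "\<not> bridges_only covers"
    then obtain e where e: "e \<in> covers" "e \<in> sym_conn (covers - {e})" by (auto simp: bridges_only_def)
    have "covers \<subseteq> sym_conn (covers - {e})"
      using e(2) sym_conn_edge[of _ _ "covers - {e}"] by auto
    \<comment> \<open>The ends of e stay connected without e, so the remaining covers still generate
      all characters and bound the dimension.\<close>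
    then have "local_dim (flag_topology n) orbit_closure origin \<le> enat (card (covers - {e}))"
      using finite_covers by (intro local_dim_orbit_closure_le covers_conn) auto
    then have "enat (card covers) \<le> enat (card (covers - {e}))"
      using s unfolding smooth_at_def tangent_dim_orbit_closure by (rule ord_eq_le_trans[rotated])
    then have "card covers \<le> card (covers - {e})" by simp
    then show False using e(1) finite_covers by (metis card_Diff1_less not_less)
  qed
qed

end

theorem theorem6p8:
  fixes n :: nat and w :: "nat \<Rightarrow> nat" and Q Y :: "complex mat set set"
  assumes "w permutes {1..n}"
    and "generic_orbit n w Q"
    and "Y = zariski_closure n Q"
  shows "smooth_at n Y (flag n (perm_mat n w)) \<longleftrightarrow> underlying_forest (cover_graph n w)"
proof -
  \<comment> \<open>The permutation shifted to positions and values from 0. For k < n the value of w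
    is at least 1, so the subtraction is exact.\<close>
  define v where "v k = (if k < n then w (Suc k) - 1 else k)" for k
  have wr: "1 \<le> w (Suc k) \<and> w (Suc k) \<le> n" if "k < n" for k
    using permutes_in_image[OF assms(1), of "Suc k"] that by simp
  have vw: "Suc (v k) = w (Suc k)" if "k < n" for k
    using wr[OF that] that by (simp add: v_def)
  have vlt: "v a < v b \<longleftrightarrow> w (Suc a) < w (Suc b)" if "a < n" "b < n" for a b
    using vw[OF that(1)] vw[OF that(2)] by (metis Suc_less_eq)
  have injw: "inj w" using permutes_inj[OF assms(1)] .
  have "inj_on v {0..<n}"
  proof (rule inj_onI)
    fix a b assume "a \<in> {0..<n}" "b \<in> {0..<n}" "v a = v b"
    then have "w (Suc a) = w (Suc b)" using vw[of a] vw[of b] by simp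
    then show "a = b" using injD[OF injw] by blast
  qed
  moreover have "v ` {0..<n} \<subseteq> {0..<n}"
  proof (rule image_subsetI)
    fix k assume "k \<in> {0..<n}"
    then show "v k \<in> {0..<n}" using vw[of k] wr[of k] by simp
  qed
  ultimately have "bij_betw v {0..<n} {0..<n}"
    using endo_inj_surj[of "{0..<n}" v] by (simp add: bij_betw_def)
  then have "v permutes {0..<n}" by (rule bij_imp_permutes) (simp add: v_def)
  then interpret perm_chart n v by unfold_locales
  have perm: "perm_mat n w = chart_mat (\<lambda>_ _. 0)"
  proof (rule v_mat_eqI)
    fix j k assume "j < n" "k < n"
    then show "perm_mat n w $$ (v j, k) = chart_mat (\<lambda>_ _. 0) $$ (v j, k)"
      using vw[of j] injD[OF injw, of "Suc j" "Suc k"] by (auto simp: perm_mat_def chart_mat_entry)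
  qed (simp_all add: perm_mat_def)
  have schubert: "schubert_variety n w = schubert"
    by (simp add: schubert_variety_def schubert_def perm chart_point_def)
  obtain p where p: "p \<in> schubert" "Q = torus_orbit n p"
    and fixed: "{p \<in> schubert. torus_fixed n p} \<subseteq> zariski_closure n Q"
    using assms(2) by (auto simp: generic_orbit_def schubert)
  have "p \<in> flag_variety n"
    using subsetD[OF closure_of_subset_topspace p(1)[unfolded schubert_def]] by (simp add: topspace_flag)
  moreover have "origin \<in> zariski_closure n (torus_orbit n p)"
    using fixed origin_in_schubert torus_fixed_origin p(2) by blast
  ultimately obtain \<xi> where \<xi>: "p = chart_point \<xi>" by (rule generic_orbit_meets_chart)
  interpret generic_point n v \<xi>
  proof unfold_locales
    fix i j assume ij: "i < j" "j < n"
    show "\<xi> i j \<noteq> 0 \<longleftrightarrow> v j < v i"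
    proof
      assume "\<xi> i j \<noteq> 0"
      then have "\<not> v i < v j" using schubert_noninversion[OF p(1)[unfolded \<xi>] ij] by blast
      moreover have "v i \<noteq> v j" using ij by simp
      ultimately show "v j < v i" by linarith
    next
      assume "v j < v i"
      then show "\<xi> i j \<noteq> 0" using generic_inversion[OF fixed[unfolded p(2) \<xi>] ij] by blast
    qed
  qed
  have "Y = orbit_closure" by (simp add: assms(3) p(2) \<xi> orbit_closure_def)
  moreover have "flag n (perm_mat n w) = origin" by (simp add: perm chart_point_def)
  ultimately have smooth: "smooth_at n Y (flag n (perm_mat n w)) \<longleftrightarrow> bridges_only covers"
    by (simp add: smooth_at_iff_bridges_only)
  \<comment> \<open>The passage from positions counted from 0 to the values that label the vertices
    of the graph; bridges are preserved because \<phi> is injective.\<close>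
  define \<phi> where "\<phi> k = w (Suc k)" for k
  have inj\<phi>: "inj \<phi>" using injw by (auto simp: \<phi>_def inj_def)
  have pairs: "cover_pairs n w = map_prod \<phi> \<phi> ` covers"
  proof (rule Set.set_eqI, rule iffI)
    fix x assume "x \<in> cover_pairs n w"
    then obtain i j where x: "x = (w i, w j)" and ij: "1 \<le> i" "i < j" "j \<le> n"
      and l: "int (perm_length n w) - int (perm_length n (transpose (w i) (w j) \<circ> w)) = 1"
      by (auto simp: cover_pairs_def)
    have c: "w j < w i" "\<And>k. i < k \<Longrightarrow> k < j \<Longrightarrow> \<not> (w j < w k \<and> w k < w i)"
      using l length_transpose_cover[OF injw ij] by auto
    obtain i' j' where ij': "i = Suc i'" "j = Suc j'" using ij by (cases i; cases j) auto
    have "(i', j') \<in> covers"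
      unfolding covers_def
    proof (rule CollectI, rule case_prodI, intro conjI allI impI)
      show "i' < j'" "j' < n" using ij ij' by auto
      show "v j' < v i'" using c(1) ij ij' by (simp add: vlt)
      fix k assume "i' < k" "k < j'"
      then show "\<not> (v j' < v k \<and> v k < v i')"
        using c(2)[of "Suc k"] ij ij' by (simp add: vlt)
    qed
    moreover have "x = map_prod \<phi> \<phi> (i', j')" by (simp add: x \<phi>_def ij')
    ultimately show "x \<in> map_prod \<phi> \<phi> ` covers" by blast
  next
    fix x assume "x \<in> map_prod \<phi> \<phi> ` covers"
    then obtain i j where x: "x = (w (Suc i), w (Suc j))" and c: "(i, j) \<in> covers" by (auto simp: \<phi>_def)
    have ij: "i < j" "j < n" "v j < v i" and cov: "\<And>k. i < k \<Longrightarrow> k < j \<Longrightarrow> \<not> (v j < v k \<and> v k < v i)"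
      using c by (auto simp: covers_def)
    have "\<not> (w (Suc j) < w k \<and> w k < w (Suc i))" if k: "Suc i < k" "k < Suc j" for k
    proof -
      obtain k' where "k = Suc k'" using k by (cases k) auto
      then show ?thesis using cov[of k'] k ij by (simp add: vlt)
    qed
    moreover have "w (Suc j) < w (Suc i)" using ij by (simp add: vlt)
    ultimately have "int (perm_length n w) - int (perm_length n (transpose (w (Suc i)) (w (Suc j)) \<circ> w)) = 1"
      using length_transpose_cover[OF injw, of "Suc i" "Suc j" n] ij by simp
    then show "x \<in> cover_pairs n w"
      unfolding cover_pairs_def x using ij by (intro CollectI exI[of _ "Suc i"] exI[of _ "Suc j"]) simp
  qed
  \<comment> \<open>Edges run from the larger value to the smaller one, which rules out loops and
    antiparallel pairs.\<close>
  have less: "y < x" if "(x, y) \<in> map_prod \<phi> \<phi> ` covers" for x y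
    using that by (auto simp: covers_def \<phi>_def vlt)
  have "(y, x) \<notin> map_prod \<phi> \<phi> ` covers" if "(x, y) \<in> map_prod \<phi> \<phi> ` covers" for x y
  proof
    assume "(y, x) \<in> map_prod \<phi> \<phi> ` covers"
    from less[OF this] less[OF that] show False by simp
  qed
  then have "underlying_forest (cover_graph n w) \<longleftrightarrow> bridges_only (map_prod \<phi> \<phi> ` covers)"
    unfolding cover_graph_eq pairs by (rule underlying_forest_iff)
  then show ?thesis by (simp only: smooth bridges_only_image[OF inj\<phi>])
qed

end
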